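(* Let $m[\Phi_0(B)]:=\lim_{L\to\infty}\frac{1}{|\Lambda_L|}\langle \Phi_0^{(\Lambda_L)}(B),O^{(\Lambda_L)}\Phi_0^{(\Lambda_L)}(B)\rangle$ for $B>0$, where the limit is taken along a sequence of $L$ for which the weak$^\ast$-limit of the vector states $\langle \Phi_0^{(\Lambda_L)}(B),(\cdots)\Phi_0^{(\Lambda_L)}(B)\rangle$ on the quasi-local algebra exists. Then the limit $$m_{\rm s}=\lim_{B\searrow 0} m[\Phi_0(B)]=\lim_{B\searrow 0}\lim_{L\to\infty}\frac{1}{|\Lambda_L|}\langle \Phi_0^{(\Lambda_L)}(B),O^{(\Lambda_L)}\Phi_0^{(\Lambda_L)}(B)\rangle$$ exists. Further, $m_{\rm s}$ is equal to the maximum spontaneous magnetization over all infinite-volume ground states (with zero field).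
   Context: Fix $d\ge 1$ and a spin magnitude $S\in\{1/2,1,3/2,\dots\}$. To each $x\in\mathbb{Z}^d$ associate spin-$S$ operators $S_x^{(1)},S_x^{(2)},S_x^{(3)}$ (Hermitian $(2S+1)\times(2S+1)$ matrices acting on $\mathbb{C}^{2S+1}$ at site $x$) with $[S_x^{(1)},S_x^{(2)}]=iS_x^{(3)}$ and cyclic permutations, and $\sum_i (S_x^{(i)})^2=S(S+1)$; write $\mathbf{S}_x\cdot\mathbf{S}_y=\sum_{i}S_x^{(i)}S_y^{(i)}$. For finite $\Gamma\subset\mathbb{Z}^d$ let $\mathfrak{A}_\Gamma=\bigotimes_{x\in\Gamma}M_{2S+1}(\mathbb{C})$ (with the natural embeddings), $\mathfrak{A}_{\rm loc}=\bigcup_{\Gamma\text{ finite}}\mathfrak{A}_\Gamma$, and the quasi-local algebra is the norm completion of $\mathfrak{A}_{\rm loc}$. For a positive integer $L$ let $\Lambda_L=\{-L+1,\dots,L\}^d$ with periodic boundary conditions (nearest-neighbor pairs $\{x,y\}\subset\Lambda_L$, $|x-y|=1$, are understood with respect to this periodicity). Define $H_{0,{\rm p}}^{(\Lambda)}=\sum_{\{x,y\}\subset\Lambda:|x-y|=1}\mathbf{S}_x\cdot\mathbf{S}_y$, the staggered magnetization $O^{(\Lambda)}=\sum_{x\in\Lambda}(-1)^{x^{(1)}+\cdots+x^{(d)}}S_x^{(3)}$, and $H_{\rm p}^{(\Lambda)}(B)=H_{0,{\rm p}}^{(\Lambda)}-BO^{(\Lambda)}$ for $B\in\mathbb{R}$.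 For each $L$ and $B$, $\Phi_0^{(\Lambda_L)}(B)$ is a normalized ground-state vector of $H_{\rm p}^{(\Lambda_L)}(B)$ chosen invariant under translations by $2$ in each lattice direction. A state $\omega$ on the quasi-local algebra is an infinite-volume ground state (for $B=0$) if $\lim_{L\to\infty}\omega(a^\ast[H_{0,{\rm p}}^{(\Lambda_L)},a])\ge 0$ for all $a\in\mathfrak{A}_{\rm loc}$. For such $\omega$ its (maximum) spontaneous magnetization is $\lim_{N\to\infty}\sup_{|\Lambda_L|\ge N}\frac{1}{|\Lambda_L|}\omega(O^{(\Lambda_L)})$. *)

theory Defs
  imports Complex_Main "HOL-Library.Extended_Real" "HOL-Library.Liminf_Limsup"
begin

text \<open>Spin magnitude S is encoded by n = 2S (a positive natural number).
  Single-site basis vectors are indexed by k in {0..n}, with S3-eigenvalue S - k.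
  Lattice sites are points of Z^d, represented as functions 'd => int for a finite
  index type 'd (d = CARD('d)).  A basis configuration of a finite region G is a
  function sigma : site => nat with sigma x <= n on G and sigma x = 0 off G.
  Operators are matrix kernels on configurations.\<close>

type_synonym 'd site = "'d \<Rightarrow> int"
type_synonym 'd cfg = "'d site \<Rightarrow> nat"
type_synonym 'd op = "'d cfg \<Rightarrow> 'd cfg \<Rightarrow> complex"

definition conf :: "nat \<Rightarrow> 'd site set \<Rightarrow> 'd cfg set" where
  "conf n G = {\<sigma>. (\<forall>x\<in>G. \<sigma> x \<le> n) \<and> (\<forall>x. x \<notin> G \<longrightarrow> \<sigma> x = 0)}"

definition alg :: "nat \<Rightarrow> 'd site set \<Rightarrow> 'd op set" where
  "alg n G = {A. \<forall>\<sigma> \<tau>. (\<sigma> \<notin> conf n G \<or> \<tau> \<notin> conf n G) \<longrightarrow> A \<sigma> \<tau> = 0}"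

definition opmult :: "nat \<Rightarrow> 'd site set \<Rightarrow> 'd op \<Rightarrow> 'd op \<Rightarrow> 'd op" where
  "opmult n G A B = (\<lambda>\<sigma> \<tau>. \<Sum>\<rho>\<in>conf n G. A \<sigma> \<rho> * B \<rho> \<tau>)"

definition adj :: "'d op \<Rightarrow> 'd op" where
  "adj A = (\<lambda>\<sigma> \<tau>. cnj (A \<tau> \<sigma>))"

definition ident :: "nat \<Rightarrow> 'd site set \<Rightarrow> 'd op" where
  "ident n G = (\<lambda>\<sigma> \<tau>. if \<sigma> \<in> conf n G \<and> \<sigma> = \<tau> then 1 else 0)"

definition restr :: "'d site set \<Rightarrow> 'd cfg \<Rightarrow> 'd cfg" where
  "restr G \<sigma> = (\<lambda>x. if x \<in> G then \<sigma> x else 0)"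

text \<open>Natural embedding A_G -> A_G' (G subset G'): A |-> A (tensor) identity.\<close>
definition emb :: "nat \<Rightarrow> 'd site set \<Rightarrow> 'd site set \<Rightarrow> 'd op \<Rightarrow> 'd op" where
  "emb n G G' A = (\<lambda>\<sigma> \<tau>. if \<sigma> \<in> conf n G' \<and> \<tau> \<in> conf n G' \<and> (\<forall>x. x \<notin> G \<longrightarrow> \<sigma> x = \<tau> x)
                          then A (restr G \<sigma>) (restr G \<tau>) else 0)"

definition splus :: "nat \<Rightarrow> nat \<Rightarrow> nat \<Rightarrow> complex" where
  "splus n j k = (if j + 1 = k \<and> k \<le> n then complex_of_real (sqrt (real (k * (n + 1 - k)))) else 0)"

definition sminus :: "nat \<Rightarrow> nat \<Rightarrow> nat \<Rightarrow> complex" where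
  "sminus n j k = cnj (splus n k j)"

definition spin_mat :: "nat \<Rightarrow> nat \<Rightarrow> nat \<Rightarrow> nat \<Rightarrow> complex" where
  "spin_mat n i j k =
     (if i = 1 then (splus n j k + sminus n j k) / 2
      else if i = 2 then (splus n j k - sminus n j k) / (2 * \<i>)
      else (if j = k \<and> k \<le> n then complex_of_real (real n / 2 - real k) else 0))"

definition site_op :: "nat \<Rightarrow> 'd site set \<Rightarrow> 'd site \<Rightarrow> (nat \<Rightarrow> nat \<Rightarrow> complex) \<Rightarrow> 'd op" where
  "site_op n G x M = (\<lambda>\<sigma> \<tau>. if \<sigma> \<in> conf n G \<and> \<tau> \<in> conf n G \<and> (\<forall>y. y \<noteq> x \<longrightarrow> \<sigma> y = \<tau> y)
                             then M (\<sigma> x) (\<tau> x) else 0)"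

definition spin_dot :: "nat \<Rightarrow> 'd site set \<Rightarrow> 'd site \<Rightarrow> 'd site \<Rightarrow> 'd op" where
  "spin_dot n G x y = (\<lambda>\<sigma> \<tau>. \<Sum>i\<in>{1,2,3::nat}.
      opmult n G (site_op n G x (spin_mat n i)) (site_op n G y (spin_mat n i)) \<sigma> \<tau>)"

definition box :: "nat \<Rightarrow> ('d::finite) site set" where
  "box L = {x. \<forall>i. - int L + 1 \<le> x i \<and> x i \<le> int L}"

definition pnn :: "nat \<Rightarrow> 'd site \<Rightarrow> 'd site \<Rightarrow> bool" where
  "pnn L x y = (x \<noteq> y \<and> (\<exists>i. ((y i - x i) mod (2 * int L) = 1 \<or> (y i - x i) mod (2 * int L) = 2 * int L - 1)
                              \<and> (\<forall>j. j \<noteq> i \<longrightarrow> x j = y j)))"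

text \<open>Sum over unordered nearest-neighbour pairs, written as half the sum over ordered pairs.\<close>
definition ham0 :: "nat \<Rightarrow> nat \<Rightarrow> ('d::finite) op" where
  "ham0 n L = (\<lambda>\<sigma> \<tau>. (1/2) * (\<Sum>x\<in>box L. \<Sum>y\<in>{y\<in>box L. pnn L x y}. spin_dot n (box L) x y \<sigma> \<tau>))"

definition stsign :: "('d::finite) site \<Rightarrow> complex" where
  "stsign x = (if even (\<Sum>i\<in>UNIV. x i) then 1 else -1)"

definition stag :: "nat \<Rightarrow> nat \<Rightarrow> ('d::finite) op" where
  "stag n L = (\<lambda>\<sigma> \<tau>. \<Sum>x\<in>box L. stsign x * site_op n (box L) x (spin_mat n 3) \<sigma> \<tau>)"

definition hamB :: "nat \<Rightarrow> nat \<Rightarrow> real \<Rightarrow> ('d::finite) op" where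
  "hamB n L B = (\<lambda>\<sigma> \<tau>. ham0 n L \<sigma> \<tau> - complex_of_real B * stag n L \<sigma> \<tau>)"

definition opapply :: "nat \<Rightarrow> 'd site set \<Rightarrow> 'd op \<Rightarrow> ('d cfg \<Rightarrow> complex) \<Rightarrow> ('d cfg \<Rightarrow> complex)" where
  "opapply n G A \<Phi> = (\<lambda>\<sigma>. \<Sum>\<tau>\<in>conf n G. A \<sigma> \<tau> * \<Phi> \<tau>)"

definition expect :: "nat \<Rightarrow> 'd site set \<Rightarrow> ('d cfg \<Rightarrow> complex) \<Rightarrow> 'd op \<Rightarrow> complex" where
  "expect n G \<Phi> A = (\<Sum>\<sigma>\<in>conf n G. cnj (\<Phi> \<sigma>) * opapply n G A \<Phi> \<sigma>)"

definition is_vec :: "nat \<Rightarrow> 'd site set \<Rightarrow> ('d cfg \<Rightarrow> complex) \<Rightarrow> bool" where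
  "is_vec n G \<Phi> = (\<forall>\<sigma>. \<sigma> \<notin> conf n G \<longrightarrow> \<Phi> \<sigma> = 0)"

definition ground_vec :: "nat \<Rightarrow> 'd site set \<Rightarrow> 'd op \<Rightarrow> ('d cfg \<Rightarrow> complex) \<Rightarrow> bool" where
  "ground_vec n G H \<Phi> =
     (is_vec n G \<Phi> \<and> (\<Sum>\<sigma>\<in>conf n G. (cmod (\<Phi> \<sigma>))\<^sup>2) = 1 \<and>
      (\<exists>E::real. (\<forall>\<sigma>\<in>conf n G. opapply n G H \<Phi> \<sigma> = complex_of_real E * \<Phi> \<sigma>) \<and>
         (\<forall>\<Psi> E'. is_vec n G \<Psi> \<and> (\<exists>\<sigma>\<in>conf n G. \<Psi> \<sigma> \<noteq> 0) \<and>
                  (\<forall>\<sigma>\<in>conf n G. opapply n G H \<Psi> \<sigma> = E' * \<Psi> \<sigma>) \<longrightarrow> E \<le> Re E')))"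

definition wrap :: "nat \<Rightarrow> int \<Rightarrow> int" where
  "wrap L z = (z + int L - 1) mod (2 * int L) - int L + 1"

definition translate :: "nat \<Rightarrow> ('d::finite) site \<Rightarrow> 'd cfg \<Rightarrow> 'd cfg" where
  "translate L a \<sigma> = (\<lambda>x. if x \<in> box L then \<sigma> (\<lambda>i. wrap L (x i + a i)) else 0)"

definition trans_inv2 :: "nat \<Rightarrow> nat \<Rightarrow> (('d::finite) cfg \<Rightarrow> complex) \<Rightarrow> bool" where
  "trans_inv2 n L \<Phi> = (\<forall>i. \<forall>\<sigma>\<in>conf n (box L). \<Phi> (translate L (\<lambda>j. if j = i then 2 else 0) \<sigma>) = \<Phi> \<sigma>)"

definition vstate :: "nat \<Rightarrow> nat \<Rightarrow> (('d::finite) cfg \<Rightarrow> complex) \<Rightarrow> 'd site set \<Rightarrow> 'd op \<Rightarrow> complex" where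
  "vstate n L \<Phi> G A = expect n (box L) \<Phi> (emb n G (box L) A)"

text \<open>Weak-* convergence of the vector states (equivalently, pointwise on the local algebra).\<close>
definition wstar_conv :: "nat \<Rightarrow> (nat \<Rightarrow> nat) \<Rightarrow> (nat \<Rightarrow> ('d::finite) cfg \<Rightarrow> complex) \<Rightarrow> bool" where
  "wstar_conv n Ls \<Phi>s = (\<forall>G A. finite G \<and> A \<in> alg n G \<longrightarrow> convergent (\<lambda>k. vstate n (Ls k) (\<Phi>s k) G A))"

definition mag_density :: "nat \<Rightarrow> nat \<Rightarrow> (('d::finite) cfg \<Rightarrow> complex) \<Rightarrow> real" where
  "mag_density n L \<Phi> = Re (expect n (box L) \<Phi> (stag n L)) / real (card (box L :: 'd site set))"

text \<open>States on the quasi-local algebra, given by their (unique) restrictions to the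
  local algebras: a compatible family of normalized positive linear functionals.\<close>
definition loc_state :: "nat \<Rightarrow> ('d site set \<Rightarrow> 'd op \<Rightarrow> complex) \<Rightarrow> bool" where
  "loc_state n \<omega> =
    ((\<forall>G A B c. finite G \<and> A \<in> alg n G \<and> B \<in> alg n G \<longrightarrow>
        \<omega> G (\<lambda>\<sigma> \<tau>. c * A \<sigma> \<tau> + B \<sigma> \<tau>) = c * \<omega> G A + \<omega> G B) \<and>
     (\<forall>G A. finite G \<and> A \<in> alg n G \<longrightarrow> (\<exists>r::real. r \<ge> 0 \<and> \<omega> G (opmult n G (adj A) A) = complex_of_real r)) \<and>
     (\<forall>G. finite G \<longrightarrow> \<omega> G (ident n G) = 1) \<and>
     (\<forall>G G' A. finite G' \<and> G \<subseteq> G' \<and> A \<in> alg n G \<longrightarrow> \<omega> G' (emb n G G' A) = \<omega> G A))"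

definition inf_gs :: "nat \<Rightarrow> (('d::finite) site set \<Rightarrow> 'd op \<Rightarrow> complex) \<Rightarrow> bool" where
  "inf_gs n \<omega> =
    (\<forall>G A. finite G \<and> A \<in> alg n G \<longrightarrow>
       (\<exists>l::real. l \<ge> 0 \<and>
          (\<lambda>L. let a = emb n G (box L) A; H = ham0 n L :: 'd op
               in \<omega> (box L) (opmult n (box L) (adj a)
                      (\<lambda>\<sigma> \<tau>. opmult n (box L) H a \<sigma> \<tau> - opmult n (box L) a H \<sigma> \<tau>)))
          \<longlonglongrightarrow> complex_of_real l))"

definition spont :: "nat \<Rightarrow> (('d::finite) site set \<Rightarrow> 'd op \<Rightarrow> complex) \<Rightarrow> ereal" where
  "spont n \<omega> = limsup (\<lambda>L. ereal (Re (\<omega> (box L) (stag n L :: 'd op)) / real (card (box L :: 'd site set))))"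

end

theory Submission
  imports "HOL-Analysis.Analysis" Defs
begin

text \<open>Write \<open>m\<^sub>L(B)\<close> for the staggered magnetization per site of the finite-volume ground state.
  Two facts suffice, and no thermodynamic limit of the energy is needed.

  Upper bound: if \<open>\<omega>\<close> is an infinite-volume ground state, testing the ground state condition with
  the operators \<open>|\<phi>\<rangle>\<langle>t|\<close>, where \<open>\<phi>\<close> is the ground state in the box at field \<open>B > 0\<close> and \<open>t\<close> runs
  through a basis, shows that the zero-field energy of \<open>\<omega>\<close> in the box is at most that of \<open>\<phi>\<close> up to a
  surface term. Since \<open>\<phi>\<close> minimizes the energy at field \<open>B\<close>, the staggered magnetization of \<open>\<omega>\<close> per
  site is at most \<open>m\<^sub>L(B) + K / (B L)\<close>.

  Existence: if \<open>L\<^sub>k\<close> tends to infinity, \<open>B\<^sub>k\<close> to zero and \<open>m\<^sub>L(B)\<close> at \<open>L = L\<^sub>k\<close>, \<open>B = B\<^sub>k\<close> stays above a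
  sequence converging to \<open>c\<close>, then a weak-* cluster point of these states is an infinite-volume ground
  state; it is invariant under even translations, so its magnetization per box is a constant \<open>s \<ge> c\<close>.

  Let \<open>m\<^sub>s\<close> be the supremum of the constants \<open>s\<close> obtained in this way. The upper bound gives
  \<open>m\<^sub>s \<le> m\<^sub>L(B) + K / (B L)\<close>, and existence gives the matching upper estimate of \<open>m\<^sub>L(B)\<close> for small
  \<open>B\<close> and large \<open>L\<close>.\<close>

section \<open>Operators on finite regions\<close>

text \<open>The obstacle is that \<open>inf_gs\<close> and \<open>spont\<close> are asymptotic in
  growing periodic boxes, whereas weak-* limits control only fixed local observables. The commutator
  of the Hamiltonian with a local operator is the same operator in every larger box, so the ground
  state condition is a family of closed conditions on single observables and survives limits. A
  field enters such a condition only through B times a fixed operator.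

  The error \<open>K / (B * L)\<close> is surface over volume, divided by B: periodic bonds and
  lattice bonds differ only near the faces. It vanishes for fixed B as L grows, and also for B
  tending to 0 as long as B L tends to infinity, which is how the supremum is attained.

  Two conversions are needed on the way. States are positive only on products of an operator with
  its adjoint, which calls for a factorization of semidefinite matrices. Ground vectors are defined
  by comparing eigenvalues, which calls for the variational principle.\<close>

lemma finite_conf: "finite G \<Longrightarrow> finite (conf n G)"
proof -
  assume "finite G"
  have "conf n G = {f. \<forall>x. (x \<in> G \<longrightarrow> f x \<in> {..n}) \<and> (x \<notin> G \<longrightarrow> f x = 0)}"
    by (auto simp: conf_def)
  with finite_set_of_finite_funs[OF \<open>finite G\<close>, of "{..n}" 0] show ?thesis by simp
qed

lemma card_conf_le: "finite G \<Longrightarrow> card (conf n G) \<le> (n + 1) ^ card G"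
proof (induction G rule: finite_induct)
  case empty
  have "conf n {} = {\<lambda>_. 0}" by (auto simp: conf_def)
  then show ?case by (metis One_nat_def card.empty card.insert empty_iff finite.emptyI order_refl power_0)
next
  case (insert x G)
  have "conf n (insert x G) \<subseteq> (\<lambda>(k, \<sigma>). \<sigma>(x := k)) ` ({..n} \<times> conf n G)"
  proof
    fix \<sigma> assume "\<sigma> \<in> conf n (insert x G)"
    then have "(\<sigma> x, \<sigma>(x := 0)) \<in> {..n} \<times> conf n G" "\<sigma> = (\<sigma>(x := 0))(x := \<sigma> x)"
      using insert.hyps by (auto simp: conf_def)
    then show "\<sigma> \<in> (\<lambda>(k, \<sigma>). \<sigma>(x := k)) ` ({..n} \<times> conf n G)"
      by (metis (mono_tags, lifting) case_prod_conv image_eqI)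
  qed
  then have "card (conf n (insert x G)) \<le> card ({..n} \<times> conf n G)"
    using finite_conf[OF insert.hyps(1)]
    by (metis (no_types, lifting) finite_SigmaI finite_atMost surj_card_le)
  also have "\<dots> \<le> (n + 1) * (n + 1) ^ card G"
    unfolding card_cartesian_product using insert.IH by (intro mult_mono) auto
  finally show ?case using insert.hyps by simp
qed

lemma zero_in_conf: "(\<lambda>_. 0) \<in> conf n G"
  by (simp add: conf_def)

lemma restr_conf: "\<sigma> \<in> conf n G' \<Longrightarrow> G \<subseteq> G' \<Longrightarrow> restr G \<sigma> \<in> conf n G"
  by (auto simp: conf_def restr_def)

lemma restr_id: "\<sigma> \<in> conf n G \<Longrightarrow> restr G \<sigma> = \<sigma>"
  by (auto simp: conf_def restr_def)

lemma restr_restr: "G \<subseteq> G' \<Longrightarrow> restr G (restr G' \<sigma>) = restr G \<sigma>"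
  by (auto simp: restr_def fun_eq_iff)

lemma algD: "A \<in> alg n G \<Longrightarrow> \<sigma> \<notin> conf n G \<or> \<tau> \<notin> conf n G \<Longrightarrow> A \<sigma> \<tau> = 0"
  by (auto simp: alg_def)

definition comm :: "nat \<Rightarrow> 'd site set \<Rightarrow> 'd op \<Rightarrow> 'd op \<Rightarrow> 'd op" where
  "comm n G A B = (\<lambda>\<sigma> \<tau>. opmult n G A B \<sigma> \<tau> - opmult n G B A \<sigma> \<tau>)"

lemma alg_opmult: "A \<in> alg n G \<Longrightarrow> B \<in> alg n G \<Longrightarrow> opmult n G A B \<in> alg n G"
  by (auto simp: alg_def opmult_def intro!: sum.neutral)

lemma alg_adj: "A \<in> alg n G \<Longrightarrow> adj A \<in> alg n G"
  by (auto simp: alg_def adj_def)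

lemma alg_ident: "ident n G \<in> alg n G"
  by (auto simp: alg_def ident_def)

lemma alg_emb: "emb n G G' A \<in> alg n G'"
  by (auto simp: alg_def emb_def)

lemma alg_site_op: "site_op n G x M \<in> alg n G"
  by (auto simp: alg_def site_op_def)

lemma alg_zero: "(\<lambda>\<sigma> \<tau>. 0) \<in> alg n G"
  by (auto simp: alg_def)

lemma alg_add: "A \<in> alg n G \<Longrightarrow> B \<in> alg n G \<Longrightarrow> (\<lambda>\<sigma> \<tau>. A \<sigma> \<tau> + B \<sigma> \<tau>) \<in> alg n G"
  by (auto simp: alg_def)

lemma alg_diff: "A \<in> alg n G \<Longrightarrow> B \<in> alg n G \<Longrightarrow> (\<lambda>\<sigma> \<tau>. A \<sigma> \<tau> - B \<sigma> \<tau>) \<in> alg n G"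
  by (auto simp: alg_def)

lemma alg_scale: "A \<in> alg n G \<Longrightarrow> (\<lambda>\<sigma> \<tau>. c * A \<sigma> \<tau>) \<in> alg n G"
  by (auto simp: alg_def)

lemma alg_sum: "(\<And>i. i \<in> I \<Longrightarrow> A i \<in> alg n G) \<Longrightarrow> (\<lambda>\<sigma> \<tau>. \<Sum>i\<in>I. A i \<sigma> \<tau>) \<in> alg n G"
  by (auto simp: alg_def)

lemma alg_comm: "A \<in> alg n G \<Longrightarrow> B \<in> alg n G \<Longrightarrow> comm n G A B \<in> alg n G"
  unfolding comm_def by (intro alg_diff alg_opmult)

lemma alg_spin_dot: "spin_dot n G x y \<in> alg n G"
  unfolding spin_dot_def by (intro alg_sum alg_opmult alg_site_op)

lemma alg_stag: "stag n L \<in> alg n (box L)"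
  unfolding stag_def by (intro alg_sum alg_scale alg_site_op)

lemma alg_ham0: "ham0 n L \<in> alg n (box L)"
  unfolding ham0_def by (intro alg_sum alg_scale alg_spin_dot)

lemma alg_hamB: "hamB n L B \<in> alg n (box L)"
  unfolding hamB_def by (intro alg_diff alg_scale alg_ham0 alg_stag)

lemmas alg_intros = alg_opmult alg_adj alg_ident alg_emb alg_site_op alg_zero alg_add alg_diff
  alg_scale alg_sum alg_comm alg_spin_dot alg_stag alg_ham0 alg_hamB

lemma opmult_assoc:
  "opmult n G (opmult n G A B) C = opmult n G A (opmult n G B C)"
  unfolding opmult_def sum_distrib_left sum_distrib_right
  by (intro ext, subst sum.swap) (simp add: mult.assoc)

lemma opmult_ident_left:
  assumes "finite G" "A \<in> alg n G" shows "opmult n G (ident n G) A = A"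
proof (intro ext)
  fix \<sigma> \<tau>
  have "opmult n G (ident n G) A \<sigma> \<tau> = (\<Sum>\<rho>\<in>conf n G. if \<sigma> = \<rho> then A \<rho> \<tau> else 0)"
    unfolding opmult_def by (rule sum.cong) (auto simp: ident_def)
  also have "\<dots> = A \<sigma> \<tau>"
    using finite_conf[OF assms(1), of n] algD[OF assms(2)] by (simp add: sum.delta')
  finally show "opmult n G (ident n G) A \<sigma> \<tau> = A \<sigma> \<tau>" .
qed

lemma opmult_sum_left:
  "opmult n G (\<lambda>\<sigma> \<tau>. \<Sum>i\<in>I. A i \<sigma> \<tau>) B = (\<lambda>\<sigma> \<tau>. \<Sum>i\<in>I. opmult n G (A i) B \<sigma> \<tau>)"
  unfolding opmult_def by (intro ext, subst sum.swap) (simp add: sum_distrib_right)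

lemma opmult_sum_right:
  "opmult n G B (\<lambda>\<sigma> \<tau>. \<Sum>i\<in>I. A i \<sigma> \<tau>) = (\<lambda>\<sigma> \<tau>. \<Sum>i\<in>I. opmult n G B (A i) \<sigma> \<tau>)"
  unfolding opmult_def by (intro ext, subst sum.swap) (simp add: sum_distrib_left)

lemma opmult_scale_left:
  "opmult n G (\<lambda>\<sigma> \<tau>. c * A \<sigma> \<tau>) B = (\<lambda>\<sigma> \<tau>. c * opmult n G A B \<sigma> \<tau>)"
  by (simp add: opmult_def sum_distrib_left mult_ac)

lemma opmult_scale_right:
  "opmult n G B (\<lambda>\<sigma> \<tau>. c * A \<sigma> \<tau>) = (\<lambda>\<sigma> \<tau>. c * opmult n G B A \<sigma> \<tau>)"
  by (simp add: opmult_def sum_distrib_left mult_ac)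

lemma opmult_add_left:
  "opmult n G (\<lambda>\<sigma> \<tau>. A \<sigma> \<tau> + A' \<sigma> \<tau>) B = (\<lambda>\<sigma> \<tau>. opmult n G A B \<sigma> \<tau> + opmult n G A' B \<sigma> \<tau>)"
  by (simp add: opmult_def sum.distrib algebra_simps)

lemma opmult_add_right:
  "opmult n G B (\<lambda>\<sigma> \<tau>. A \<sigma> \<tau> + A' \<sigma> \<tau>) = (\<lambda>\<sigma> \<tau>. opmult n G B A \<sigma> \<tau> + opmult n G B A' \<sigma> \<tau>)"
  by (simp add: opmult_def sum.distrib algebra_simps)

lemma opmult_diff_left:
  "opmult n G (\<lambda>\<sigma> \<tau>. A \<sigma> \<tau> - A' \<sigma> \<tau>) B = (\<lambda>\<sigma> \<tau>. opmult n G A B \<sigma> \<tau> - opmult n G A' B \<sigma> \<tau>)"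
  by (simp add: opmult_def sum_subtractf algebra_simps)

lemma opmult_diff_right:
  "opmult n G B (\<lambda>\<sigma> \<tau>. A \<sigma> \<tau> - A' \<sigma> \<tau>) = (\<lambda>\<sigma> \<tau>. opmult n G B A \<sigma> \<tau> - opmult n G B A' \<sigma> \<tau>)"
  by (simp add: opmult_def sum_subtractf algebra_simps)

lemma opmult_zero_right: "opmult n G B (\<lambda>\<sigma> \<tau>. 0) = (\<lambda>\<sigma> \<tau>. 0)"
  by (simp add: opmult_def)

lemma adj_opmult: "adj (opmult n G A B) = opmult n G (adj B) (adj A)"
  by (simp add: adj_def opmult_def mult.commute)

section \<open>Embedding a region into a larger one\<close>

definition agree :: "nat \<Rightarrow> 'd site set \<Rightarrow> 'd site set \<Rightarrow> 'd cfg \<Rightarrow> 'd cfg \<Rightarrow> bool" where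
  "agree n G G' \<sigma> \<tau> \<longleftrightarrow> \<sigma> \<in> conf n G' \<and> \<tau> \<in> conf n G' \<and> (\<forall>x. x \<notin> G \<longrightarrow> \<sigma> x = \<tau> x)"

lemma agree_sym: "agree n G G' \<sigma> \<tau> = agree n G G' \<tau> \<sigma>"
  by (auto simp: agree_def)

lemma emb_agree: "emb n G G' A = (\<lambda>\<sigma> \<tau>. if agree n G G' \<sigma> \<tau> then A (restr G \<sigma>) (restr G \<tau>) else 0)"
  by (simp add: emb_def agree_def)

lemma adj_emb: "adj (emb n G G' A) = emb n G G' (adj A)"
  unfolding emb_agree adj_def by (subst agree_sym) (simp add: if_distrib cong: if_cong)

lemma emb_id:
  assumes "A \<in> alg n G" shows "emb n G G A = A"
proof (intro ext)
  fix \<sigma> \<tau>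
  have "agree n G G \<sigma> \<tau> \<longleftrightarrow> \<sigma> \<in> conf n G \<and> \<tau> \<in> conf n G"
    by (auto simp: agree_def conf_def)
  then show "emb n G G A \<sigma> \<tau> = A \<sigma> \<tau>"
    using algD[OF assms, of \<sigma> \<tau>] by (auto simp: emb_agree restr_id)
qed

lemma emb_emb:
  assumes "G \<subseteq> G'" "G' \<subseteq> G''"
  shows "emb n G' G'' (emb n G G' A) = emb n G G'' A"
proof (intro ext)
  fix \<sigma> \<tau>
  have "agree n G' G'' \<sigma> \<tau> \<and> agree n G G' (restr G' \<sigma>) (restr G' \<tau>) \<longleftrightarrow> agree n G G'' \<sigma> \<tau>"
  proof
    assume a: "agree n G' G'' \<sigma> \<tau> \<and> agree n G G' (restr G' \<sigma>) (restr G' \<tau>)"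
    have "\<sigma> x = \<tau> x" if "x \<notin> G" for x
      using a that unfolding agree_def restr_def by (cases "x \<in> G'") metis+
    with a show "agree n G G'' \<sigma> \<tau>" by (simp add: agree_def)
  next
    assume a: "agree n G G'' \<sigma> \<tau>"
    then show "agree n G' G'' \<sigma> \<tau> \<and> agree n G G' (restr G' \<sigma>) (restr G' \<tau>)"
      using restr_conf[OF _ assms(2), of _ n] assms(1)
      unfolding agree_def by (auto simp: restr_def)
  qed
  then show "emb n G' G'' (emb n G G' A) \<sigma> \<tau> = emb n G G'' A \<sigma> \<tau>"
    by (auto simp: emb_agree restr_restr[OF assms(1)])
qed

lemma emb_ident:
  assumes "G \<subseteq> G'" shows "emb n G G' (ident n G) = ident n G'"
proof (intro ext)
  fix \<sigma> \<tau>
  have "\<sigma> = \<tau>" if "\<forall>x. x \<notin> G \<longrightarrow> \<sigma> x = \<tau> x" "restr G \<sigma> = restr G \<tau>"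
  proof
    fix x show "\<sigma> x = \<tau> x" using that(1) fun_cong[OF that(2), of x] by (cases "x \<in> G") (auto simp only: restr_def if_True)
  qed
  then show "emb n G G' (ident n G) \<sigma> \<tau> = ident n G' \<sigma> \<tau>"
    using restr_conf[OF _ assms] by (auto simp: emb_def ident_def)
qed

lemma emb_add: "emb n G G' (\<lambda>\<sigma> \<tau>. A \<sigma> \<tau> + B \<sigma> \<tau>) = (\<lambda>\<sigma> \<tau>. emb n G G' A \<sigma> \<tau> + emb n G G' B \<sigma> \<tau>)"
  by (intro ext) (simp add: emb_agree)

lemma emb_diff: "emb n G G' (\<lambda>\<sigma> \<tau>. A \<sigma> \<tau> - B \<sigma> \<tau>) = (\<lambda>\<sigma> \<tau>. emb n G G' A \<sigma> \<tau> - emb n G G' B \<sigma> \<tau>)"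
  by (intro ext) (simp add: emb_agree)

lemma emb_scale: "emb n G G' (\<lambda>\<sigma> \<tau>. c * A \<sigma> \<tau>) = (\<lambda>\<sigma> \<tau>. c * emb n G G' A \<sigma> \<tau>)"
  by (intro ext) (simp add: emb_agree)

lemma emb_sum: "emb n G G' (\<lambda>\<sigma> \<tau>. \<Sum>i\<in>I. A i \<sigma> \<tau>) = (\<lambda>\<sigma> \<tau>. \<Sum>i\<in>I. emb n G G' (A i) \<sigma> \<tau>)"
  by (intro ext) (simp add: emb_agree)

text \<open>A configuration that agrees with \<sigma> outside \<open>G\<close> is determined by its
  restriction to \<open>G\<close>, which may be arbitrary. This is why matrix multiplication
  commutes with embedding.\<close>

lemma sum_conf_fibre:
  assumes "G \<subseteq> G'" "\<sigma> \<in> conf n G'"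
  shows "(\<Sum>\<rho>\<in>{\<rho>\<in>conf n G'. \<forall>x. x \<notin> G \<longrightarrow> \<sigma> x = \<rho> x}. F (restr G \<rho>)) = (\<Sum>\<eta>\<in>conf n G. F \<eta>)"
proof (rule sum.reindex_bij_witness[where i = "\<lambda>\<eta> x. if x \<in> G then \<eta> x else \<sigma> x" and j = "restr G"])
  show "(\<lambda>x. if x \<in> G then \<eta> x else \<sigma> x) \<in> {\<rho>\<in>conf n G'. \<forall>x. x \<notin> G \<longrightarrow> \<sigma> x = \<rho> x}"
    if "\<eta> \<in> conf n G" for \<eta> using that assms by (auto simp: conf_def)
qed (use assms in \<open>auto simp: restr_def conf_def fun_eq_iff\<close>)

lemma emb_opmult:
  assumes "G \<subseteq> G'" "finite G'"
  shows "emb n G G' (opmult n G A B) = opmult n G' (emb n G G' A) (emb n G G' B)"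
proof (intro ext)
  fix \<sigma> \<tau>
  show "emb n G G' (opmult n G A B) \<sigma> \<tau> = opmult n G' (emb n G G' A) (emb n G G' B) \<sigma> \<tau>"
  proof (cases "\<sigma> \<in> conf n G' \<and> \<tau> \<in> conf n G' \<and> (\<forall>x. x \<notin> G \<longrightarrow> \<sigma> x = \<tau> x)")
    case True
    have "opmult n G' (emb n G G' A) (emb n G G' B) \<sigma> \<tau> =
      (\<Sum>\<rho>\<in>conf n G'. if (\<forall>x. x \<notin> G \<longrightarrow> \<sigma> x = \<rho> x) then
         A (restr G \<sigma>) (restr G \<rho>) * B (restr G \<rho>) (restr G \<tau>) else 0)"
      unfolding opmult_def by (rule sum.cong) (use True in \<open>auto simp: emb_def\<close>)
    also have "\<dots> = (\<Sum>\<rho>\<in>{\<rho>\<in>conf n G'. \<forall>x. x \<notin> G \<longrightarrow> \<sigma> x = \<rho> x}.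
         A (restr G \<sigma>) (restr G \<rho>) * B (restr G \<rho>) (restr G \<tau>))"
      by (simp add: sum.inter_filter[OF finite_conf[OF assms(2)]])
    also have "\<dots> = opmult n G A B (restr G \<sigma>) (restr G \<tau>)"
      unfolding opmult_def
      by (rule sum_conf_fibre[where F = "\<lambda>\<rho>. A (restr G \<sigma>) \<rho> * B \<rho> (restr G \<tau>)"]) (use assms True in auto)
    finally show ?thesis using True by (auto simp: emb_def)
  next
    case False
    then have "emb n G G' A \<sigma> \<rho> * emb n G G' B \<rho> \<tau> = 0" for \<rho>
      by (auto simp: emb_def)
    then have "opmult n G' (emb n G G' A) (emb n G G' B) \<sigma> \<tau> = 0"
      unfolding opmult_def by (intro sum.neutral) blast
    with False show ?thesis by (auto simp: emb_def)
  qed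
qed

lemma emb_comm:
  assumes "G \<subseteq> G'" "finite G'"
  shows "emb n G G' (comm n G A B) = comm n G' (emb n G G' A) (emb n G G' B)"
  by (simp add: comm_def emb_diff emb_opmult[OF assms])

text \<open>Only one intermediate configuration contributes: the first factor fixes it off
  \<open>G1\<close>, the second fixes it off \<open>G2\<close> and hence on \<open>G1\<close>. The
  resulting product of matrix entries is symmetric in the two factors, which yields commutation at
  disjoint regions.\<close>

lemma opmult_emb_disjoint:
  assumes "G1 \<subseteq> G'" "G2 \<subseteq> G'" "G1 \<inter> G2 = {}" "finite G'"
  shows "opmult n G' (emb n G1 G' A) (emb n G2 G' B) \<sigma> \<tau> =
    (if \<sigma> \<in> conf n G' \<and> \<tau> \<in> conf n G' \<and> (\<forall>x. x \<notin> G1 \<union> G2 \<longrightarrow> \<sigma> x = \<tau> x)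
     then A (restr G1 \<sigma>) (restr G1 \<tau>) * B (restr G2 \<sigma>) (restr G2 \<tau>) else 0)"
proof -
  define P where "P \<longleftrightarrow> \<sigma> \<in> conf n G' \<and> \<tau> \<in> conf n G' \<and> (\<forall>x. x \<notin> G1 \<union> G2 \<longrightarrow> \<sigma> x = \<tau> x)"
  define \<rho>0 where "\<rho>0 = (\<lambda>x. if x \<in> G1 then \<tau> x else \<sigma> x)"
  have *: "emb n G1 G' A \<sigma> \<rho> * emb n G2 G' B \<rho> \<tau> =
    (if \<rho> = \<rho>0 then (if P
     then A (restr G1 \<sigma>) (restr G1 \<tau>) * B (restr G2 \<sigma>) (restr G2 \<tau>) else 0) else 0)"
    if "\<rho> \<in> conf n G'" for \<rho>
  proof (cases "\<rho> = \<rho>0")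
    case True
    have "restr G1 \<rho>0 = restr G1 \<tau>" "restr G2 \<rho>0 = restr G2 \<sigma>"
      using assms(3) by (auto simp: restr_def \<rho>0_def fun_eq_iff)
    moreover have "(\<forall>x. x \<notin> G1 \<longrightarrow> \<sigma> x = \<rho>0 x) \<and> (\<forall>x. x \<notin> G2 \<longrightarrow> \<rho>0 x = \<tau> x) \<longleftrightarrow>
       (\<forall>x. x \<notin> G1 \<union> G2 \<longrightarrow> \<sigma> x = \<tau> x)"
      by (auto simp: \<rho>0_def)
    ultimately show ?thesis using that True by (auto simp: emb_def P_def)
  next
    case False
    have "\<not> ((\<forall>x. x \<notin> G1 \<longrightarrow> \<sigma> x = \<rho> x) \<and> (\<forall>x. x \<notin> G2 \<longrightarrow> \<rho> x = \<tau> x))"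
    proof
      assume a: "(\<forall>x. x \<notin> G1 \<longrightarrow> \<sigma> x = \<rho> x) \<and> (\<forall>x. x \<notin> G2 \<longrightarrow> \<rho> x = \<tau> x)"
      have "\<rho> = \<rho>0"
        using a assms(3) unfolding \<rho>0_def by (intro ext) auto
      then show False using False by simp
    qed
    then show ?thesis using False by (auto simp: emb_def)
  qed
  have "\<rho>0 \<in> conf n G'" if P
    using that by (auto simp: \<rho>0_def conf_def P_def)
  then show ?thesis
    unfolding opmult_def P_def[symmetric] using finite_conf[OF assms(4), of n]
    by (simp add: * cong: sum.cong)
qed

lemma opmult_emb_commute:
  assumes "G1 \<subseteq> G'" "G2 \<subseteq> G'" "G1 \<inter> G2 = {}" "finite G'"
  shows "opmult n G' (emb n G1 G' A) (emb n G2 G' B) = opmult n G' (emb n G2 G' B) (emb n G1 G' A)"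
proof (intro ext)
  fix \<sigma> \<tau>
  have "G2 \<inter> G1 = {}" using assms(3) by auto
  then show "opmult n G' (emb n G1 G' A) (emb n G2 G' B) \<sigma> \<tau> = opmult n G' (emb n G2 G' B) (emb n G1 G' A) \<sigma> \<tau>"
    unfolding opmult_emb_disjoint[OF assms]
    by (subst opmult_emb_disjoint) (use assms in \<open>auto simp: Un_commute mult.commute\<close>)
qed

lemma comm_emb_disjoint:
  assumes "G1 \<subseteq> G'" "G2 \<subseteq> G'" "G1 \<inter> G2 = {}" "finite G'"
  shows "comm n G' (emb n G1 G' A) (emb n G2 G' B) = (\<lambda>\<sigma> \<tau>. 0)"
  by (simp add: comm_def opmult_emb_commute[OF assms])

lemma emb_site_op:
  assumes "x \<in> G" "G \<subseteq> G'"
  shows "emb n G G' (site_op n G x M) = site_op n G' x M"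
proof (intro ext)
  fix \<sigma> \<tau>
  have "(\<forall>y. y \<notin> G \<longrightarrow> \<sigma> y = \<tau> y) \<and> (\<forall>y. y \<noteq> x \<longrightarrow> restr G \<sigma> y = restr G \<tau> y) \<longleftrightarrow> (\<forall>y. y \<noteq> x \<longrightarrow> \<sigma> y = \<tau> y)"
    using assms by (auto simp: restr_def)
  then show "emb n G G' (site_op n G x M) \<sigma> \<tau> = site_op n G' x M \<sigma> \<tau>"
    using restr_conf[OF _ assms(2)] assms by (auto simp: emb_def site_op_def restr_def)
qed

lemma emb_spin_dot:
  assumes "x \<in> G" "y \<in> G" "G \<subseteq> G'" "finite G'"
  shows "emb n G G' (spin_dot n G x y) = spin_dot n G' x y"
  unfolding spin_dot_def emb_sum using assms by (simp add: emb_opmult emb_site_op)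

section \<open>Hermiticity of the Hamiltonians and of the staggered magnetization\<close>

lemma spin_mat_hermitian: "cnj (spin_mat n i k j) = spin_mat n i j k"
  by (auto simp: spin_mat_def sminus_def field_simps)

lemma adj_site_op:
  assumes "\<And>j k. cnj (M k j) = M j k"
  shows "adj (site_op n G x M) = site_op n G x M"
  using assms by (auto simp: adj_def site_op_def fun_eq_iff)

lemma adj_sum: "adj (\<lambda>\<sigma> \<tau>. \<Sum>i\<in>I. A i \<sigma> \<tau>) = (\<lambda>\<sigma> \<tau>. \<Sum>i\<in>I. adj (A i) \<sigma> \<tau>)"
  by (simp add: adj_def)

lemma site_op_commute:
  assumes "x \<in> G" "y \<in> G" "x \<noteq> y" "finite G"
  shows "opmult n G (site_op n G x M) (site_op n G y N) = opmult n G (site_op n G y N) (site_op n G x M)"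
  using opmult_emb_commute[of "{x}" G "{y}" n "site_op n {x} x M" "site_op n {y} y N"] assms
  by (simp add: emb_site_op)

text \<open>\<open>adj\<close> reverses each product, and spins at different sites commute.\<close>

lemma adj_spin_dot:
  assumes "x \<in> G" "y \<in> G" "x \<noteq> y" "finite G"
  shows "adj (spin_dot n G x y) = spin_dot n G x y"
  unfolding spin_dot_def adj_sum adj_opmult adj_site_op[OF spin_mat_hermitian]
  by (intro ext sum.cong refl fun_cong[OF fun_cong[OF site_op_commute]] assms not_sym[OF assms(3)])

lemma finite_box [simp]: "finite (box L :: ('d::finite) site set)"
proof -
  have "box L = PiE (UNIV::'d set) (\<lambda>_. {- int L + 1..int L})"
    by (auto simp: box_def PiE_def)
  then show ?thesis by (simp add: finite_PiE)
qed

lemma box_mono: "L \<le> L' \<Longrightarrow> box L \<subseteq> box L'"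
  unfolding box_def by (safe; drule_tac x = i in spec; linarith)

text \<open>Ordered pairs, so every bond occurs twice; the factor 1/2 of \<open>ham0\<close>
  compensates.\<close>

definition bonds :: "nat \<Rightarrow> (('d::finite) site \<times> 'd site) set" where
  "bonds L = {(x, y). x \<in> box L \<and> y \<in> box L \<and> pnn L x y}"

lemma bonds_Sigma: "bonds L = Sigma (box L) (\<lambda>x. {y\<in>box L. pnn L x y})"
  by (auto simp: bonds_def)

lemma finite_bonds [simp]: "finite (bonds L)"
  unfolding bonds_Sigma by (intro finite_SigmaI) auto

lemma ham0_bonds: "ham0 n L = (\<lambda>\<sigma> \<tau>. 1/2 * (\<Sum>p\<in>bonds L. spin_dot n (box L) (fst p) (snd p) \<sigma> \<tau>))"
  unfolding ham0_def bonds_Sigma by (subst sum.Sigma) (auto simp: case_prod_beta)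

lemma adj_ham0: "adj (ham0 n L :: ('a::finite) op) = ham0 n L"
proof -
  have "adj (spin_dot n (box L) (fst p) (snd p)) = spin_dot n (box L) (fst p) (snd p)"
    if "p \<in> bonds L" for p :: "'a site \<times> 'a site"
    using that by (intro adj_spin_dot) (auto simp: bonds_def pnn_def)
  then have "(\<Sum>p\<in>bonds L. adj (spin_dot n (box L) (fst p) (snd p)) \<sigma> \<tau>)
    = (\<Sum>p\<in>bonds L. spin_dot n (box L) (fst p) (snd p) \<sigma> \<tau>)" for \<sigma> \<tau> :: "'a cfg"
    by (intro sum.cong) auto
  moreover have "adj (ham0 n L :: 'a op) = (\<lambda>\<sigma> \<tau>. 1/2 * (\<Sum>p\<in>bonds L. adj (spin_dot n (box L) (fst p) (snd p)) \<sigma> \<tau>))"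
    unfolding ham0_bonds by (simp add: adj_def)
  ultimately show ?thesis by (simp only: ham0_bonds)
qed

lemma adj_stag: "adj (stag n L) = stag n L"
proof -
  have "adj (stag n L) = (\<lambda>\<sigma> \<tau>. \<Sum>x\<in>box L. stsign x * adj (site_op n (box L) x (spin_mat n 3)) \<sigma> \<tau>)"
    unfolding stag_def adj_def by (intro ext) (auto simp: stsign_def intro!: sum.cong)
  then show ?thesis by (simp add: stag_def adj_site_op[OF spin_mat_hermitian])
qed

lemma adj_hamB: "adj (hamB n L B) = hamB n L B"
proof -
  have "adj (hamB n L B) = (\<lambda>\<sigma> \<tau>. adj (ham0 n L) \<sigma> \<tau> - complex_of_real B * adj (stag n L) \<sigma> \<tau>)"
    by (simp add: hamB_def adj_def)
  then show ?thesis by (simp add: adj_ham0 adj_stag hamB_def)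
qed

section \<open>Positive semidefinite kernels and the Rayleigh principle\<close>

definition qform :: "'c set \<Rightarrow> ('c \<Rightarrow> 'c \<Rightarrow> complex) \<Rightarrow> ('c \<Rightarrow> complex) \<Rightarrow> complex" where
  "qform I P v = (\<Sum>\<sigma>\<in>I. \<Sum>\<tau>\<in>I. cnj (v \<sigma>) * P \<sigma> \<tau> * v \<tau>)"

lemma qform_cong: "(\<And>\<sigma>. \<sigma> \<in> I \<Longrightarrow> v \<sigma> = w \<sigma>) \<Longrightarrow> qform I P v = qform I P w"
  unfolding qform_def by (intro sum.cong) auto

lemma qform_insert:
  assumes "finite I" "s \<notin> I"
  shows "qform (insert s I) P v = cnj (v s) * P s s * v s + cnj (v s) * (\<Sum>\<tau>\<in>I. P s \<tau> * v \<tau>)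
    + (\<Sum>\<sigma>\<in>I. cnj (v \<sigma>) * P \<sigma> s) * v s + qform I P v"
  using assms by (simp add: qform_def sum.distrib sum_distrib_left sum_distrib_right mult.assoc)

lemma Re_complex_of_real_mult: "Re (complex_of_real t * z) = t * Re z"
  by simp

text \<open>Hermiticity makes the two cross terms conjugate to each other, so their real parts
  coincide. The expansion in a real parameter \<open>t\<close> serves both the zero pivot in the
  factorization below and the stationarity of a minimizer.\<close>

lemma qform_add_scaled:
  assumes herm: "\<And>\<sigma> \<tau>. \<sigma> \<in> I \<Longrightarrow> \<tau> \<in> I \<Longrightarrow> P \<tau> \<sigma> = cnj (P \<sigma> \<tau>)"
  shows "Re (qform I P (\<lambda>\<sigma>. v \<sigma> + complex_of_real t * w \<sigma>)) =
    Re (qform I P v) + 2 * t * Re (\<Sum>\<sigma>\<in>I. cnj (w \<sigma>) * (\<Sum>\<tau>\<in>I. P \<sigma> \<tau> * v \<tau>)) + t\<^sup>2 * Re (qform I P w)"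
proof -
  have "cnj (\<Sum>\<sigma>\<in>I. \<Sum>\<tau>\<in>I. cnj (v \<sigma>) * P \<sigma> \<tau> * w \<tau>) = (\<Sum>\<sigma>\<in>I. \<Sum>\<tau>\<in>I. v \<sigma> * P \<tau> \<sigma> * cnj (w \<tau>))"
    unfolding cnj_sum by (intro sum.cong refl) (simp add: herm[symmetric])
  also have "\<dots> = (\<Sum>\<sigma>\<in>I. \<Sum>\<tau>\<in>I. cnj (w \<sigma>) * P \<sigma> \<tau> * v \<tau>)"
    by (subst sum.swap) (simp add: mult_ac)
  finally have *: "Re (\<Sum>\<sigma>\<in>I. \<Sum>\<tau>\<in>I. cnj (v \<sigma>) * P \<sigma> \<tau> * w \<tau>) = Re (\<Sum>\<sigma>\<in>I. \<Sum>\<tau>\<in>I. cnj (w \<sigma>) * P \<sigma> \<tau> * v \<tau>)"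
    by (subst cnj.simps(1)[symmetric]) (rule arg_cong)
  have "qform I P (\<lambda>\<sigma>. v \<sigma> + complex_of_real t * w \<sigma>) = (\<Sum>\<sigma>\<in>I. \<Sum>\<tau>\<in>I. cnj (v \<sigma>) * P \<sigma> \<tau> * v \<tau>
     + complex_of_real t * (cnj (v \<sigma>) * P \<sigma> \<tau> * w \<tau>) + complex_of_real t * (cnj (w \<sigma>) * P \<sigma> \<tau> * v \<tau>)
     + complex_of_real (t\<^sup>2) * (cnj (w \<sigma>) * P \<sigma> \<tau> * w \<tau>))"
    unfolding qform_def by (intro sum.cong refl) (simp add: algebra_simps power2_eq_square)
  also have "\<dots> = qform I P v
     + complex_of_real t * (\<Sum>\<sigma>\<in>I. \<Sum>\<tau>\<in>I. cnj (v \<sigma>) * P \<sigma> \<tau> * w \<tau>)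
     + complex_of_real t * (\<Sum>\<sigma>\<in>I. \<Sum>\<tau>\<in>I. cnj (w \<sigma>) * P \<sigma> \<tau> * v \<tau>) + complex_of_real (t\<^sup>2) * qform I P w"
    unfolding sum.distrib sum_distrib_left[symmetric] qform_def ..
  finally have "Re (qform I P (\<lambda>\<sigma>. v \<sigma> + complex_of_real t * w \<sigma>)) = Re (qform I P v)
     + 2 * t * Re (\<Sum>\<sigma>\<in>I. \<Sum>\<tau>\<in>I. cnj (w \<sigma>) * P \<sigma> \<tau> * v \<tau>) + t\<^sup>2 * Re (qform I P w)"
    using * by (simp only: plus_complex.sel Re_complex_of_real_mult)
  then show ?thesis unfolding sum_distrib_left mult.assoc .
qed

lemma hermitian_qform_real:
  assumes "\<And>\<sigma> \<tau>. \<sigma> \<in> I \<Longrightarrow> \<tau> \<in> I \<Longrightarrow> P \<tau> \<sigma> = cnj (P \<sigma> \<tau>)"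
  shows "Im (qform I P v) = 0"
proof -
  have "cnj (qform I P v) = (\<Sum>\<sigma>\<in>I. \<Sum>\<tau>\<in>I. v \<sigma> * P \<tau> \<sigma> * cnj (v \<tau>))"
    unfolding qform_def cnj_sum by (intro sum.cong refl) (simp add: assms[symmetric])
  also have "\<dots> = qform I P v"
    unfolding qform_def by (subst sum.swap) (simp add: mult_ac)
  finally show ?thesis by (metis Reals_cnj_iff complex_is_Real_iff)
qed

lemma nonneg_quadratic_linear_part_zero:
  fixes a b :: real
  assumes "\<And>t. 0 \<le> 2 * t * a + t\<^sup>2 * b" shows "a = 0"
proof (rule ccontr)
  assume "a \<noteq> 0"
  \<comment> \<open>\<open>c\<close> is positive and larger than \<open>b\<close>, so that at
    \<open>t = - a / c\<close> the linear term dominates and the value is negative unless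
    \<open>a = 0\<close>.\<close>
  define c where "c = \<bar>b\<bar> + 1"
  have c: "c > 0" "b < c" by (auto simp: c_def)
  have "0 \<le> 2 * (- a / c) * a + (- a / c)\<^sup>2 * b" by (rule assms)
  also have "\<dots> = (a\<^sup>2 / c) * (b / c - 2)" using c by (simp add: field_simps power2_eq_square)
  finally have "0 \<le> (a\<^sup>2 / c) * (b / c - 2)" .
  moreover have "a\<^sup>2 / c > 0" using \<open>a \<noteq> 0\<close> c by simp
  ultimately have "b / c - 2 \<ge> 0" by (simp only: zero_le_mult_iff) linarith
  moreover have "b / c < 1" using c by simp
  ultimately show False by simp
qed

text \<open>States are assumed nonnegative only on products of an operator with its adjoint; this
  factorization brings every Hermitian kernel with nonnegative form into that shape. The induction
  eliminates one index \<open>s\<close> by a Schur complement, with separate care for a zero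
  pivot.\<close>

lemma cholesky:
  assumes "finite I" "\<And>\<sigma> \<tau>. \<sigma> \<in> I \<Longrightarrow> \<tau> \<in> I \<Longrightarrow> P \<tau> \<sigma> = cnj (P \<sigma> \<tau>)"
    and "\<And>v. 0 \<le> Re (qform I P v)"
  shows "\<exists>B. (\<forall>\<sigma> \<tau>. \<sigma> \<notin> I \<or> \<tau> \<notin> I \<longrightarrow> B \<sigma> \<tau> = 0) \<and>
     (\<forall>\<sigma>\<in>I. \<forall>\<tau>\<in>I. P \<sigma> \<tau> = (\<Sum>\<rho>\<in>I. cnj (B \<rho> \<sigma>) * B \<rho> \<tau>))"
  using assms
proof (induction I arbitrary: P rule: finite_induct)
  case empty
  then show ?case by (auto intro!: exI[of _ "\<lambda>_ _. 0"])
next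
  case (insert s I)
  note herm = insert.prems(1) and pos = insert.prems(2) and ins = qform_insert[OF insert.hyps(1,2)]
  define p where "p = Re (P s s)"
  have Pss: "P s s = complex_of_real p"
    using herm[of s s] unfolding p_def by (metis Reals_cnj_iff insertI1 of_real_Re)
  have "qform (insert s I) P (\<lambda>x. if x = s then 1 else 0) = P s s"
  proof -
    have "(\<Sum>\<tau>\<in>I. P s \<tau> * (if \<tau> = s then 1 else 0)) = 0" "(\<Sum>\<sigma>\<in>I. cnj (if \<sigma> = s then 1 else 0) * P \<sigma> s) = 0"
      "qform I P (\<lambda>x. if x = s then 1 else 0) = 0"
      using insert.hyps unfolding qform_def by (auto intro!: sum.neutral)
    then show ?thesis by (simp add: ins)
  qed
  with pos[of "\<lambda>x. if x = s then 1 else 0"] have p0: "p \<ge> 0" by (simp add: p_def)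
  \<comment> \<open>A zero diagonal entry of a semidefinite matrix forces a zero row: the unit
    vector at \<tau> plus \<open>t\<close> times the vector with entry \<open>P s \<tau>\<close> at
    \<open>s\<close> has a form value affine in \<open>t\<close>, with slope twice the squared
    modulus of \<open>P s \<tau>\<close>.\<close>
  have row0: "P s \<tau> = 0" if "p = 0" "\<tau> \<in> I" for \<tau>
  proof -
    have "Re (\<Sum>\<sigma>\<in>insert s I. cnj (if \<sigma> = s then P s \<tau> else 0) *
         (\<Sum>\<tau>'\<in>insert s I. P \<sigma> \<tau>' * (if \<tau>' = \<tau> then 1 else 0))) = 0" (is "?R = 0")
    proof -
      let ?v = "\<lambda>x. if x = s then P s \<tau> else 0" and ?w = "\<lambda>x. if x = \<tau> then 1 else (0::complex)"
      have q0: "qform (insert s I) P ?v = 0"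
      proof -
        have "(\<Sum>\<tau>\<in>I. P s \<tau> * ?v \<tau>) = 0" "(\<Sum>\<sigma>\<in>I. cnj (?v \<sigma>) * P \<sigma> s) = 0" "qform I P ?v = 0"
          using insert.hyps unfolding qform_def by (auto intro!: sum.neutral)
        then show ?thesis using Pss that by (simp add: ins)
      qed
      show ?thesis
      proof (rule ccontr)
        assume nz: "?R \<noteq> 0"
        define b where "b = Re (qform (insert s I) P ?w)"
        define r where "r = ?R"
        have "0 \<le> b + 2 * t * r" for t
        proof -
          have "Re (qform (insert s I) P (\<lambda>\<sigma>. ?w \<sigma> + complex_of_real t * ?v \<sigma>))
              = b + 2 * t * r + t\<^sup>2 * Re (qform (insert s I) P ?v)"
            unfolding b_def r_def by (rule qform_add_scaled[OF herm])
          then show ?thesis using pos[of "\<lambda>\<sigma>. ?w \<sigma> + complex_of_real t * ?v \<sigma>"] by (simp only: q0) simp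
        qed
        \<comment> \<open>This \<open>t\<close> makes the affine expression equal to -1.\<close>
        from this[of "- (b + 1) / (2 * r)"] nz show False by (simp add: r_def[symmetric] field_simps del: Re_sum)
      qed
    qed
    moreover have "(\<Sum>\<tau>'\<in>insert s I. P \<sigma> \<tau>' * (if \<tau>' = \<tau> then 1 else 0)) = P \<sigma> \<tau>" for \<sigma>
    proof -
      have "(\<Sum>\<tau>'\<in>insert s I. P \<sigma> \<tau>' * (if \<tau>' = \<tau> then 1 else 0)) = (\<Sum>\<tau>'\<in>insert s I. if \<tau>' = \<tau> then P \<sigma> \<tau>' else 0)"
        by (intro sum.cong) auto
      then show ?thesis using that insert.hyps by simp
    qed
    moreover have "(\<Sum>\<sigma>\<in>insert s I. cnj (if \<sigma> = s then P s \<tau> else 0) * P \<sigma> \<tau>) = cnj (P s \<tau>) * P s \<tau>"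
      using insert.hyps by (subst sum.insert) (auto intro!: sum.neutral)
    ultimately have "Re (cnj (P s \<tau>) * P s \<tau>) = 0" by (simp only:)
    then show ?thesis by (metis Re_complex_of_real complex_norm_square mult.commute norm_eq_zero zero_eq_power2)
  qed
  \<comment> \<open>The Schur complement. If \<open>p = 0\<close>, division by zero gives 0 and
    \<open>P'\<close> is \<open>P\<close>, which is the right choice because the row
    vanishes.\<close>
  define P' where "P' = (\<lambda>\<sigma> \<tau>. P \<sigma> \<tau> - P \<sigma> s * P s \<tau> / p)"
  have herm': "P' \<tau> \<sigma> = cnj (P' \<sigma> \<tau>)" if "\<sigma> \<in> I" "\<tau> \<in> I" for \<sigma> \<tau>
    using herm[of \<sigma> \<tau>] herm[of s \<sigma>] herm[of s \<tau>] that by (simp add: P'_def mult.commute)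
  have pos': "0 \<le> Re (qform I P' v)" for v
  proof -
    define w where "w = (\<Sum>\<tau>\<in>I. P s \<tau> * v \<tau>)"
    have w0: "w = 0" if "p = 0" using row0[OF that] unfolding w_def by (simp add: sum.neutral)
    have cw: "(\<Sum>\<sigma>\<in>I. cnj (v \<sigma>) * P \<sigma> s) = cnj w"
      unfolding w_def cnj_sum by (intro sum.cong refl) (simp add: herm[symmetric] mult.commute)
    \<comment> \<open>The entry at \<open>s\<close> minimizes the quadratic form with the other
      entries fixed; completing the square leaves the form of \<open>P'\<close> at
      \<open>v\<close>.\<close>
    define u where "u = v(s := - w / p)"
    have uI: "\<And>\<sigma>. \<sigma> \<in> I \<Longrightarrow> u \<sigma> = v \<sigma>" using insert.hyps by (auto simp: u_def)
    have "qform (insert s I) P u = cnj (u s) * p * u s + cnj (u s) * w + cnj w * u s + qform I P v"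
      unfolding ins Pss using uI cw qform_cong[of I u v P]
      by (simp add: w_def cong: sum.cong)
    also have "\<dots> = qform I P v - cnj w * w / p"
      using w0 by (cases "p = 0") (auto simp: u_def field_simps)
    also have "cnj w * w / p = (\<Sum>\<sigma>\<in>I. \<Sum>\<tau>\<in>I. cnj (v \<sigma>) * (P \<sigma> s * P s \<tau> / p) * v \<tau>)"
      unfolding cw[symmetric] unfolding w_def sum_product sum_divide_distrib by (simp add: mult_ac)
    also have "qform I P v - \<dots> = qform I P' v"
      by (simp add: qform_def P'_def sum_subtractf algebra_simps)
    finally show ?thesis using pos[of u] by simp
  qed
  from insert.IH[OF herm' pos'] obtain B' where
    B': "\<And>\<sigma> \<tau>. \<sigma> \<notin> I \<or> \<tau> \<notin> I \<Longrightarrow> B' \<sigma> \<tau> = 0"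
      "\<And>\<sigma> \<tau>. \<sigma> \<in> I \<Longrightarrow> \<tau> \<in> I \<Longrightarrow> P' \<sigma> \<tau> = (\<Sum>\<rho>\<in>I. cnj (B' \<rho> \<sigma>) * B' \<rho> \<tau>)" by blast
  \<comment> \<open>Row \<open>s\<close> carries the rank-one part split off above; it is zero when
    \<open>p = 0\<close>, again by division by zero.\<close>
  define B where "B = (\<lambda>\<rho> \<tau>. if \<rho> = s then (if \<tau> \<in> insert s I then P s \<tau> / complex_of_real (sqrt p) else 0) else B' \<rho> \<tau>)"
  have sq: "complex_of_real (sqrt p) * complex_of_real (sqrt p) = complex_of_real p"
    using p0 by (simp flip: of_real_mult)
  have "P \<sigma> \<tau> = (\<Sum>\<rho>\<in>insert s I. cnj (B \<rho> \<sigma>) * B \<rho> \<tau>)" if st: "\<sigma> \<in> insert s I" "\<tau> \<in> insert s I" for \<sigma> \<tau>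
  proof -
    have "(\<Sum>\<rho>\<in>insert s I. cnj (B \<rho> \<sigma>) * B \<rho> \<tau>) = cnj (P s \<sigma>) * P s \<tau> / p + (\<Sum>\<rho>\<in>I. cnj (B' \<rho> \<sigma>) * B' \<rho> \<tau>)"
      using insert.hyps st sq by (auto simp: B_def intro!: sum.cong)
    also have "(\<Sum>\<rho>\<in>I. cnj (B' \<rho> \<sigma>) * B' \<rho> \<tau>) = (if \<sigma> \<in> I \<and> \<tau> \<in> I then P' \<sigma> \<tau> else 0)"
      using B' by (auto intro!: sum.neutral)
    also have "cnj (P s \<sigma>) * P s \<tau> / p + \<dots> = P \<sigma> \<tau>"
    proof (cases "\<sigma> \<in> I \<and> \<tau> \<in> I")
      case True
      then show ?thesis using herm[of s \<sigma>] by (simp add: P'_def)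
    next
      case False
      then consider "\<sigma> = s" | "\<tau> = s" using st by auto
      then show ?thesis
      proof cases
        case 1
        then show ?thesis using Pss False row0 st insert.hyps by (cases "p = 0"; cases "\<tau> = s") auto
      next
        case 2
        then show ?thesis using Pss False row0 st insert.hyps herm[of s \<sigma>] by (cases "p = 0"; cases "\<sigma> = s") auto
      qed
    qed
    finally show ?thesis ..
  qed
  moreover have "B \<sigma> \<tau> = 0" if "\<sigma> \<notin> insert s I \<or> \<tau> \<notin> insert s I" for \<sigma> \<tau>
    using that B'(1)[of \<sigma> \<tau>] by (auto simp: B_def)
  ultimately show ?case by blast
qed

section \<open>Minimizing a Hermitian form over unit vectors\<close>

lemma compact_product:
  fixes K :: "'a \<Rightarrow> 'b::topological_space set"
  assumes "\<And>i. compact (K i)" shows "compact {f. \<forall>i. f i \<in> K i}"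
proof -
  have "compactin (product_topology (\<lambda>i::'a. euclidean :: 'b topology) UNIV) (PiE UNIV K)"
    unfolding compactin_PiE using assms by simp
  then show ?thesis by (simp add: euclidean_product_topology PiE_def Pi_def)
qed

lemma norm_sum_squares_pos:
  assumes "finite I" "\<not> (\<forall>\<sigma>\<in>I. v \<sigma> = (0::complex))"
  shows "0 < (\<Sum>\<sigma>\<in>I. (cmod (v \<sigma>))\<^sup>2)"
proof -
  from assms obtain \<sigma> where "\<sigma> \<in> I" "v \<sigma> \<noteq> 0" by auto
  then show ?thesis using assms(1) by (intro sum_pos2[of _ \<sigma>]) auto
qed

text \<open>The form attains its minimum on the compact unit sphere, and stationarity there is the
  eigenvalue equation. Both outputs are needed: \<open>ground_vec\<close> compares its energy with
  eigenvalues only, and a lower bound on all vectors follows once the minimum is known to be an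
  eigenvalue.\<close>

lemma rayleigh:
  assumes "finite I" "I \<noteq> {}" "\<And>\<sigma> \<tau>. \<sigma> \<in> I \<Longrightarrow> \<tau> \<in> I \<Longrightarrow> H \<tau> \<sigma> = cnj (H \<sigma> \<tau>)"
  obtains \<psi> \<mu> where "\<And>\<sigma>. \<sigma> \<notin> I \<Longrightarrow> \<psi> \<sigma> = 0" "(\<Sum>\<sigma>\<in>I. (cmod (\<psi> \<sigma>))\<^sup>2) = 1"
    "\<And>\<sigma>. \<sigma> \<in> I \<Longrightarrow> (\<Sum>\<tau>\<in>I. H \<sigma> \<tau> * \<psi> \<tau>) = complex_of_real \<mu> * \<psi> \<sigma>"
    "\<And>v. \<mu> * (\<Sum>\<sigma>\<in>I. (cmod (v \<sigma>))\<^sup>2) \<le> Re (qform I H v)"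
proof -
  \<comment> \<open>Coordinates off \<open>I\<close> are pinned to 0, so that the sphere is a closed
    subset of a product of compact sets even if the function type has infinitely many
    coordinates.\<close>
  define S :: "('a \<Rightarrow> complex) set" where
    "S = {v. \<forall>\<sigma>. v \<sigma> \<in> (if \<sigma> \<in> I then cball 0 1 else {0})} \<inter> {v. (\<Sum>\<sigma>\<in>I. (cmod (v \<sigma>))\<^sup>2) = 1}"
  have cc: "continuous_on UNIV (\<lambda>v::'a \<Rightarrow> complex. v \<sigma>)" for \<sigma>
    by simp
  have "closed {v::'a \<Rightarrow> complex. (\<Sum>\<sigma>\<in>I. (cmod (v \<sigma>))\<^sup>2) = 1}"
    by (intro closed_Collect_eq continuous_intros cc)
  moreover have "compact {v::'a \<Rightarrow> complex. \<forall>\<sigma>. v \<sigma> \<in> (if \<sigma> \<in> I then cball 0 1 else {0})}"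
    by (rule compact_product) auto
  ultimately have "compact S" unfolding S_def by (rule compact_Int_closed[rotated])
  moreover have "S \<noteq> {}"
  proof -
    from assms(2) obtain s where "s \<in> I" by auto
    have "(\<Sum>\<sigma>\<in>I. (cmod (if \<sigma> = s then 1 else 0))\<^sup>2) = (\<Sum>\<sigma>\<in>I. if \<sigma> = s then 1 else 0)"
      by (intro sum.cong) auto
    also have "\<dots> = 1" using \<open>s \<in> I\<close> assms(1) by simp
    finally have "(\<lambda>\<sigma>. if \<sigma> = s then 1 else 0) \<in> S"
      unfolding S_def using \<open>s \<in> I\<close> by auto
    then show ?thesis by auto
  qed
  moreover have "continuous_on S (\<lambda>v. Re (qform I H v))"
    unfolding qform_def
    by (intro continuous_intros continuous_on_subset[OF cc]) auto
  ultimately obtain \<psi> where \<psi>: "\<psi> \<in> S" "\<And>v. v \<in> S \<Longrightarrow> Re (qform I H \<psi>) \<le> Re (qform I H v)"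
    using continuous_attains_inf[of S "\<lambda>v. Re (qform I H v)"] by auto
  define \<mu> where "\<mu> = Re (qform I H \<psi>)"
  have \<psi>1: "(\<Sum>\<sigma>\<in>I. (cmod (\<psi> \<sigma>))\<^sup>2) = 1" "\<And>\<sigma>. \<sigma> \<notin> I \<Longrightarrow> \<psi> \<sigma> = 0"
    using \<psi>(1) unfolding S_def by (auto split: if_splits)
  have scale: "qform I H (\<lambda>\<sigma>. complex_of_real c * v \<sigma>) = complex_of_real (c\<^sup>2) * qform I H v" for c v
    by (simp add: qform_def sum_distrib_left power2_eq_square mult_ac)
  have min: "\<mu> * (\<Sum>\<sigma>\<in>I. (cmod (v \<sigma>))\<^sup>2) \<le> Re (qform I H v)" for v
  proof (cases "\<forall>\<sigma>\<in>I. v \<sigma> = 0")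
    case True
    then show ?thesis by (simp add: qform_def)
  next
    case False
    define N where "N = (\<Sum>\<sigma>\<in>I. (cmod (v \<sigma>))\<^sup>2)"
    have "N > 0" unfolding N_def by (rule norm_sum_squares_pos[OF assms(1) False])
    define w where "w = (\<lambda>\<sigma>. complex_of_real (1 / sqrt N) * (if \<sigma> \<in> I then v \<sigma> else 0))"
    have c: "(cmod (w \<sigma>))\<^sup>2 = (cmod (v \<sigma>))\<^sup>2 / N" if "\<sigma> \<in> I" for \<sigma>
      using \<open>N > 0\<close> that by (simp add: w_def norm_mult norm_divide power_mult_distrib power_divide)
    have s1: "(\<Sum>\<sigma>\<in>I. (cmod (w \<sigma>))\<^sup>2) = 1"
      using \<open>N > 0\<close> by (simp add: c N_def[symmetric] sum_divide_distrib[symmetric])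
    have "w \<in> S"
    proof -
      have "cmod (w \<sigma>) \<le> 1" if "\<sigma> \<in> I" for \<sigma>
      proof -
        have "(cmod (w \<sigma>))\<^sup>2 \<le> (\<Sum>\<sigma>\<in>I. (cmod (w \<sigma>))\<^sup>2)"
          using that assms(1) by (intro member_le_sum) auto
        then show ?thesis unfolding s1 by (metis abs_norm_cancel abs_square_le_1)
      qed
      then show ?thesis using s1 by (auto simp: S_def) (auto simp: w_def)
    qed
    then have "\<mu> \<le> Re (qform I H w)" unfolding \<mu>_def by (rule \<psi>(2))
    also have "qform I H w = complex_of_real (1 / N) * qform I H v"
      unfolding w_def scale using \<open>N > 0\<close>
      by (auto simp: power_divide intro: qform_cong)
    finally show ?thesis using \<open>N > 0\<close> by (simp add: N_def[symmetric] field_simps)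
  qed
  \<comment> \<open>\<open>K\<close> is \<open>H\<close> minus \<mu>: its form is nonnegative and
    vanishes at \<psi>. Varying \<psi> in the direction of its image \<open>w\<close> under
    \<open>K\<close> gives a linear term proportional to the squared norm of \<open>w\<close>, which
    must therefore vanish.\<close>
  define K where "K = (\<lambda>\<sigma> \<tau>. H \<sigma> \<tau> - (if \<sigma> = \<tau> then complex_of_real \<mu> else 0))"
  have Kap: "(\<Sum>\<tau>\<in>I. K \<sigma> \<tau> * v \<tau>) = (\<Sum>\<tau>\<in>I. H \<sigma> \<tau> * v \<tau>) - complex_of_real \<mu> * v \<sigma>" if "\<sigma> \<in> I" for \<sigma> v
  proof -
    have "(\<Sum>\<tau>\<in>I. K \<sigma> \<tau> * v \<tau>) = (\<Sum>\<tau>\<in>I. H \<sigma> \<tau> * v \<tau> - (if \<sigma> = \<tau> then complex_of_real \<mu> * v \<tau> else 0))"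
      by (intro sum.cong) (auto simp: K_def algebra_simps)
    then show ?thesis using that assms(1) by (simp add: sum_subtractf)
  qed
  have qK: "Re (qform I K v) = Re (qform I H v) - \<mu> * (\<Sum>\<sigma>\<in>I. (cmod (v \<sigma>))\<^sup>2)" for v
  proof -
    have "qform I K v = (\<Sum>\<sigma>\<in>I. cnj (v \<sigma>) * (\<Sum>\<tau>\<in>I. K \<sigma> \<tau> * v \<tau>))"
      by (simp add: qform_def sum_distrib_left mult.assoc)
    also have "\<dots> = (\<Sum>\<sigma>\<in>I. cnj (v \<sigma>) * (\<Sum>\<tau>\<in>I. H \<sigma> \<tau> * v \<tau>) - complex_of_real (\<mu> * (cmod (v \<sigma>))\<^sup>2))"
      by (intro sum.cong refl, subst Kap) (auto simp: complex_norm_square right_diff_distrib mult_ac simp del: of_real_power)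
    also have "\<dots> = qform I H v - complex_of_real (\<mu> * (\<Sum>\<sigma>\<in>I. (cmod (v \<sigma>))\<^sup>2))"
      by (simp add: sum_subtractf qform_def sum_distrib_left mult.assoc)
    finally show ?thesis by simp
  qed
  have "(\<Sum>\<tau>\<in>I. H \<sigma> \<tau> * \<psi> \<tau>) = complex_of_real \<mu> * \<psi> \<sigma>" if "\<sigma> \<in> I" for \<sigma>
  proof -
    define w where "w = (\<lambda>\<sigma>. \<Sum>\<tau>\<in>I. K \<sigma> \<tau> * \<psi> \<tau>)"
    have Kherm: "K \<tau> \<sigma> = cnj (K \<sigma> \<tau>)" if "\<sigma> \<in> I" "\<tau> \<in> I" for \<sigma> \<tau>
      using assms(3)[OF that] by (auto simp: K_def)
    have "0 \<le> 2 * t * Re (\<Sum>\<sigma>\<in>I. cnj (w \<sigma>) * w \<sigma>) + t\<^sup>2 * Re (qform I K w)" for t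
    proof -
      have "0 \<le> Re (qform I K (\<lambda>\<sigma>. \<psi> \<sigma> + complex_of_real t * w \<sigma>))"
        unfolding qK using min by simp
      also have "\<dots> = Re (qform I K \<psi>) + 2 * t * Re (\<Sum>\<sigma>\<in>I. cnj (w \<sigma>) * w \<sigma>) + t\<^sup>2 * Re (qform I K w)"
        unfolding w_def by (rule qform_add_scaled[OF Kherm])
      also have "Re (qform I K \<psi>) = 0"
        using qK[of \<psi>] \<psi>1 by (simp add: \<mu>_def)
      finally show ?thesis by (simp only: add_0)
    qed
    then have "Re (\<Sum>\<sigma>\<in>I. cnj (w \<sigma>) * w \<sigma>) = 0"
      by (rule nonneg_quadratic_linear_part_zero)
    moreover have "Re (\<Sum>\<sigma>\<in>I. cnj (w \<sigma>) * w \<sigma>) = (\<Sum>\<sigma>\<in>I. (cmod (w \<sigma>))\<^sup>2)"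
      unfolding Re_sum by (intro sum.cong refl) (simp add: cmod_power2 flip: power2_eq_square)
    ultimately have "(\<Sum>\<sigma>\<in>I. (cmod (w \<sigma>))\<^sup>2) = 0" by simp
    then have "w \<sigma> = 0" using that assms(1) by (simp add: sum_nonneg_eq_0_iff)
    then show ?thesis using Kap[OF that, of \<psi>] by (simp add: w_def)
  qed
  then show thesis using that[of \<psi> \<mu>] \<psi>1 min by blast
qed

section \<open>States on finite regions\<close>

text \<open>A state on the algebra of a single region. Restrictions of infinite-volume states,
  vector states and locally modified states all fit it, so bounds are proved once.\<close>

definition state_on :: "nat \<Rightarrow> 'd site set \<Rightarrow> ('d op \<Rightarrow> complex) \<Rightarrow> bool" where
  "state_on n G f \<longleftrightarrow> finite G \<and>
    (\<forall>A B c. A \<in> alg n G \<and> B \<in> alg n G \<longrightarrow> f (\<lambda>\<sigma> \<tau>. c * A \<sigma> \<tau> + B \<sigma> \<tau>) = c * f A + f B) \<and>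
    (\<forall>A. A \<in> alg n G \<longrightarrow> f (opmult n G (adj A) A) \<in> \<real>\<^sub>\<ge>\<^sub>0) \<and> f (ident n G) = 1"

lemma state_on_loc_state:
  assumes \<omega>: "loc_state n \<omega>" and fin: "finite G"
  shows "state_on n G (\<omega> G)"
  unfolding state_on_def
proof (intro conjI allI impI)
  note c = \<omega>[unfolded loc_state_def]
  show "\<omega> G (\<lambda>\<sigma> \<tau>. c * A \<sigma> \<tau> + B \<sigma> \<tau>) = c * \<omega> G A + \<omega> G B"
    if "A \<in> alg n G \<and> B \<in> alg n G" for A B c
    using c[THEN conjunct1, rule_format, of G A B c] fin that by simp
  show "\<omega> G (opmult n G (adj A) A) \<in> \<real>\<^sub>\<ge>\<^sub>0" if "A \<in> alg n G" for A
    using c[THEN conjunct2, THEN conjunct1, rule_format, of G A] fin that by (auto simp: nonneg_Reals_def)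
  show "\<omega> G (ident n G) = 1"
    using c[THEN conjunct2, THEN conjunct2, THEN conjunct1, rule_format, OF fin] .
qed (rule fin)

lemma loc_state_emb:
  assumes "loc_state n \<omega>" "finite G'" "G \<subseteq> G'" "A \<in> alg n G"
  shows "\<omega> G' (emb n G G' A) = \<omega> G A"
  using assms(1)[unfolded loc_state_def, THEN conjunct2, THEN conjunct2, THEN conjunct2, rule_format, of G' G A]
    assms(2-) by simp

context
  fixes n :: nat and G :: "'d site set" and f :: "'d op \<Rightarrow> complex"
  assumes f: "state_on n G f"
begin

lemma state_on_finite: "finite G"
  using f unfolding state_on_def by blast

lemma state_on_linear:
  "A \<in> alg n G \<Longrightarrow> B \<in> alg n G \<Longrightarrow> f (\<lambda>\<sigma> \<tau>. c * A \<sigma> \<tau> + B \<sigma> \<tau>) = c * f A + f B"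
  using f unfolding state_on_def by blast

lemma state_on_pos: "A \<in> alg n G \<Longrightarrow> f (opmult n G (adj A) A) \<in> \<real>\<^sub>\<ge>\<^sub>0"
  using f unfolding state_on_def by blast

lemma state_on_ident: "f (ident n G) = 1"
  using f unfolding state_on_def by blast

lemma state_on_add: "A \<in> alg n G \<Longrightarrow> B \<in> alg n G \<Longrightarrow> f (\<lambda>\<sigma> \<tau>. A \<sigma> \<tau> + B \<sigma> \<tau>) = f A + f B"
  using state_on_linear[of A B 1] by simp

lemma state_on_zero: "f (\<lambda>\<sigma> \<tau>. 0) = 0"
  using state_on_add[OF alg_zero alg_zero] by simp

lemma state_on_scale: "A \<in> alg n G \<Longrightarrow> f (\<lambda>\<sigma> \<tau>. c * A \<sigma> \<tau>) = c * f A"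
  using state_on_linear[of A "\<lambda>\<sigma> \<tau>. 0" c] by (simp add: alg_zero state_on_zero)

lemma state_on_diff: "A \<in> alg n G \<Longrightarrow> B \<in> alg n G \<Longrightarrow> f (\<lambda>\<sigma> \<tau>. A \<sigma> \<tau> - B \<sigma> \<tau>) = f A - f B"
  using state_on_linear[of B A "-1"] by simp

lemma state_on_sum:
  assumes "\<And>i. i \<in> I \<Longrightarrow> A i \<in> alg n G"
  shows "f (\<lambda>\<sigma> \<tau>. \<Sum>i\<in>I. A i \<sigma> \<tau>) = (\<Sum>i\<in>I. f (A i))"
  using assms
proof (induction I rule: infinite_finite_induct)
  case (insert i I)
  then show ?case
    using state_on_add[of "A i" "\<lambda>\<sigma> \<tau>. \<Sum>i\<in>I. A i \<sigma> \<tau>"] alg_sum[of I A n G] by simp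
qed (simp_all add: state_on_zero)

lemma state_on_psd:
  assumes "P \<in> alg n G" "adj P = P" "\<And>v. 0 \<le> Re (qform (conf n G) P v)"
  shows "f P \<in> \<real>\<^sub>\<ge>\<^sub>0"
proof -
  have "P \<tau> \<sigma> = cnj (P \<sigma> \<tau>)" for \<sigma> \<tau>
    using fun_cong[OF fun_cong[OF assms(2), of \<tau>], of \<sigma>] by (simp add: adj_def)
  from cholesky[of _ P, OF finite_conf[OF state_on_finite] this assms(3)] obtain B where
    B: "\<And>\<sigma> \<tau>. \<sigma> \<notin> conf n G \<or> \<tau> \<notin> conf n G \<Longrightarrow> B \<sigma> \<tau> = 0"
      "\<And>\<sigma> \<tau>. \<sigma> \<in> conf n G \<Longrightarrow> \<tau> \<in> conf n G \<Longrightarrow> P \<sigma> \<tau> = (\<Sum>\<rho>\<in>conf n G. cnj (B \<rho> \<sigma>) * B \<rho> \<tau>)"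
    by blast
  have "P = opmult n G (adj B) B"
  proof (intro ext)
    fix \<sigma> \<tau> show "P \<sigma> \<tau> = opmult n G (adj B) B \<sigma> \<tau>"
      using B algD[OF assms(1), of \<sigma> \<tau>]
      by (cases "\<sigma> \<in> conf n G \<and> \<tau> \<in> conf n G") (auto simp: opmult_def adj_def)
  qed
  moreover have "B \<in> alg n G" using B(1) by (simp add: alg_def)
  ultimately show ?thesis using state_on_pos by metis
qed

end

text \<open>The entrywise l1 norm, a crude substitute for the operator norm that bounds expectations
  independently of the state.\<close>

definition opsum :: "nat \<Rightarrow> 'd site set \<Rightarrow> 'd op \<Rightarrow> real" where
  "opsum n G A = (\<Sum>\<sigma>\<in>conf n G. \<Sum>\<tau>\<in>conf n G. cmod (A \<sigma> \<tau>))"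

lemma qform_ident:
  assumes "finite G"
  shows "qform (conf n G) (ident n G) v = complex_of_real (\<Sum>\<sigma>\<in>conf n G. (cmod (v \<sigma>))\<^sup>2)"
proof -
  have "qform (conf n G) (ident n G) v
    = (\<Sum>\<sigma>\<in>conf n G. \<Sum>\<tau>\<in>conf n G. if \<sigma> = \<tau> then cnj (v \<sigma>) * v \<tau> else 0)"
    unfolding qform_def by (intro sum.cong refl) (auto simp: ident_def)
  also have "\<dots> = (\<Sum>\<sigma>\<in>conf n G. cnj (v \<sigma>) * v \<sigma>)"
    using finite_conf[OF assms, of n] by (intro sum.cong refl) simp
  also have "\<dots> = (\<Sum>\<sigma>\<in>conf n G. complex_of_real ((cmod (v \<sigma>))\<^sup>2))"
    by (intro sum.cong refl) (simp add: complex_norm_square mult.commute del: of_real_power)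
  finally show ?thesis by simp
qed

lemma qform_linear:
  "qform I (\<lambda>\<sigma> \<tau>. c * A \<sigma> \<tau> + B \<sigma> \<tau>) v = c * qform I A v + qform I B v"
proof -
  have "qform I (\<lambda>\<sigma> \<tau>. c * A \<sigma> \<tau> + B \<sigma> \<tau>) v =
    (\<Sum>\<sigma>\<in>I. \<Sum>\<tau>\<in>I. c * (cnj (v \<sigma>) * A \<sigma> \<tau> * v \<tau>) + cnj (v \<sigma>) * B \<sigma> \<tau> * v \<tau>)"
    unfolding qform_def by (intro sum.cong refl) (simp add: algebra_simps)
  then show ?thesis unfolding sum.distrib sum_distrib_left[symmetric] qform_def .
qed

lemma norm_qform_le:
  assumes "finite G"
  shows "cmod (qform (conf n G) A v) \<le> opsum n G A * (\<Sum>\<sigma>\<in>conf n G. (cmod (v \<sigma>))\<^sup>2)"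
proof -
  define N where "N = (\<Sum>\<sigma>\<in>conf n G. (cmod (v \<sigma>))\<^sup>2)"
  have fin: "finite (conf n G)" by (rule finite_conf[OF assms])
  have N: "(cmod (v \<sigma>))\<^sup>2 \<le> N" if "\<sigma> \<in> conf n G" for \<sigma>
    unfolding N_def using that fin by (intro member_le_sum) auto
  have "cmod (qform (conf n G) A v) \<le> (\<Sum>\<sigma>\<in>conf n G. \<Sum>\<tau>\<in>conf n G. cmod (A \<sigma> \<tau>) * N)"
    unfolding qform_def
  proof (intro order_trans[OF norm_sum] sum_mono)
    fix \<sigma> \<tau> assume st: "\<sigma> \<in> conf n G" "\<tau> \<in> conf n G"
    have "2 * (cmod (v \<sigma>) * cmod (v \<tau>)) \<le> (cmod (v \<sigma>))\<^sup>2 + (cmod (v \<tau>))\<^sup>2"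
      using sum_squares_bound[of "cmod (v \<sigma>)" "cmod (v \<tau>)"] by (simp add: mult.assoc)
    then have "cmod (v \<sigma>) * cmod (v \<tau>) \<le> N" using N[OF st(1)] N[OF st(2)] by linarith
    then have "cmod (A \<sigma> \<tau>) * (cmod (v \<sigma>) * cmod (v \<tau>)) \<le> cmod (A \<sigma> \<tau>) * N"
      by (intro mult_left_mono) auto
    then show "cmod (cnj (v \<sigma>) * A \<sigma> \<tau> * v \<tau>) \<le> cmod (A \<sigma> \<tau>) * N"
      by (simp add: norm_mult mult_ac)
  qed
  then show ?thesis by (simp add: opsum_def N_def sum_distrib_right)
qed

lemma adj_ident [simp]: "adj (ident n G) = ident n G"
  by (intro ext) (auto simp: adj_def ident_def)

text \<open>Both \<open>c + A\<close> and \<open>c - A\<close> have nonnegative form when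
  \<open>c\<close> is the entrywise norm, so the state is nonnegative on them. Membership in the
  nonnegative reals also makes the imaginary part vanish.\<close>

lemma state_on_bound_hermitian:
  assumes f: "state_on n G f" and A: "A \<in> alg n G" "adj A = A"
  shows "\<bar>Re (f A)\<bar> \<le> opsum n G A" "Im (f A) = 0"
proof -
  note fin = state_on_finite[OF f]
  define c where "c = opsum n G A"
  have pos: "f (\<lambda>\<sigma> \<tau>. complex_of_real s * A \<sigma> \<tau> + complex_of_real c * ident n G \<sigma> \<tau>) \<in> \<real>\<^sub>\<ge>\<^sub>0"
    if s: "s = 1 \<or> s = -1" for s
  proof (rule state_on_psd[OF f])
    show "(\<lambda>\<sigma> \<tau>. complex_of_real s * A \<sigma> \<tau> + complex_of_real c * ident n G \<sigma> \<tau>) \<in> alg n G"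
      by (intro alg_intros A)
    have "adj (\<lambda>\<sigma> \<tau>. complex_of_real s * A \<sigma> \<tau> + complex_of_real c * ident n G \<sigma> \<tau>)
       = (\<lambda>\<sigma> \<tau>. complex_of_real s * adj A \<sigma> \<tau> + complex_of_real c * adj (ident n G) \<sigma> \<tau>)"
      by (simp add: adj_def)
    then show "adj (\<lambda>\<sigma> \<tau>. complex_of_real s * A \<sigma> \<tau> + complex_of_real c * ident n G \<sigma> \<tau>)
       = (\<lambda>\<sigma> \<tau>. complex_of_real s * A \<sigma> \<tau> + complex_of_real c * ident n G \<sigma> \<tau>)"
      by (simp add: A(2))
  next
    fix v
    define N where "N = (\<Sum>\<sigma>\<in>conf n G. (cmod (v \<sigma>))\<^sup>2)"
    have "\<bar>Re (qform (conf n G) A v)\<bar> \<le> c * N"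
      using norm_qform_le[OF fin, of n A v] abs_Re_le_cmod[of "qform (conf n G) A v"]
      by (simp add: N_def c_def)
    moreover have "Re (qform (conf n G) (\<lambda>\<sigma> \<tau>. complex_of_real s * A \<sigma> \<tau> + complex_of_real c * ident n G \<sigma> \<tau>) v)
      = s * Re (qform (conf n G) A v) + c * N"
      using qform_linear[of "conf n G" "complex_of_real c" "ident n G" "\<lambda>_ _. 0" v]
      by (simp add: qform_linear qform_ident[OF fin] N_def qform_def[of _ "\<lambda>_ _. 0"])
    ultimately show "0 \<le> Re (qform (conf n G) (\<lambda>\<sigma> \<tau>. complex_of_real s * A \<sigma> \<tau> + complex_of_real c * ident n G \<sigma> \<tau>) v)"
      using s by auto
  qed
  have lin: "f (\<lambda>\<sigma> \<tau>. complex_of_real s * A \<sigma> \<tau> + complex_of_real c * ident n G \<sigma> \<tau>) = complex_of_real s * f A + complex_of_real c" for s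
    by (subst state_on_linear[OF f]) (auto intro!: alg_intros A simp: state_on_scale[OF f alg_ident] state_on_ident[OF f])
  have "complex_of_real s * f A + complex_of_real c \<in> \<real>\<^sub>\<ge>\<^sub>0" if "s = 1 \<or> s = -1" for s
    using pos[OF that] by (simp only: lin)
  from this[of 1] this[of "-1"] show "\<bar>Re (f A)\<bar> \<le> opsum n G A" "Im (f A) = 0"
    by (auto simp: complex_nonneg_Reals_iff c_def)
qed

lemma opsum_adj: "opsum n G (adj A) = opsum n G A"
  unfolding opsum_def by (subst sum.swap) (simp add: adj_def)

lemma opsum_linear_le:
  "opsum n G (\<lambda>\<sigma> \<tau>. a * A \<sigma> \<tau> + b * B \<sigma> \<tau>) \<le> cmod a * opsum n G A + cmod b * opsum n G B"
proof -
  have "opsum n G (\<lambda>\<sigma> \<tau>. a * A \<sigma> \<tau> + b * B \<sigma> \<tau>) \<le>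
    (\<Sum>\<sigma>\<in>conf n G. \<Sum>\<tau>\<in>conf n G. cmod a * cmod (A \<sigma> \<tau>) + cmod b * cmod (B \<sigma> \<tau>))"
    unfolding opsum_def by (intro sum_mono order_trans[OF norm_triangle_ineq]) (simp add: norm_mult)
  then show ?thesis by (simp add: opsum_def sum.distrib sum_distrib_left)
qed

text \<open>The factor 2 comes from the splitting \<open>A = R + \<i> J\<close> into Hermitian
  parts, each with entrywise norm at most that of \<open>A\<close>. These bounds provide the compact
  discs for the cluster point argument.\<close>

lemma state_on_bound:
  assumes f: "state_on n G f" and A: "A \<in> alg n G"
  shows "cmod (f A) \<le> 2 * opsum n G A"
proof -
  define R where "R = (\<lambda>\<sigma> \<tau>. (1/2) * A \<sigma> \<tau> + (1/2) * adj A \<sigma> \<tau>)"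
  define J where "J = (\<lambda>\<sigma> \<tau>. (-\<i>/2) * A \<sigma> \<tau> + (\<i>/2) * adj A \<sigma> \<tau>)"
  have R: "R \<in> alg n G" and J: "J \<in> alg n G"
    unfolding R_def J_def by (intro alg_intros A)+
  have "adj R = R" "adj J = J"
    by (auto simp: R_def J_def adj_def fun_eq_iff)
  note bR = state_on_bound_hermitian[OF f R this(1)] and bJ = state_on_bound_hermitian[OF f J this(2)]
  have "opsum n G R \<le> opsum n G A" "opsum n G J \<le> opsum n G A"
    using opsum_linear_le[of n G "1/2" A "1/2" "adj A"] opsum_linear_le[of n G "-\<i>/2" A "\<i>/2" "adj A"]
    by (auto simp: R_def J_def opsum_adj norm_divide)
  moreover have "f A = \<i> * f J + f R"
  proof -
    have "A = (\<lambda>\<sigma> \<tau>. \<i> * J \<sigma> \<tau> + R \<sigma> \<tau>)"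
      by (auto simp: R_def J_def fun_eq_iff algebra_simps)
    then show ?thesis using state_on_linear[OF f J R, of \<i>] by simp
  qed
  moreover have "cmod (f R) = \<bar>Re (f R)\<bar>" "cmod (f J) = \<bar>Re (f J)\<bar>"
    using bR(2) bJ(2) by (simp_all add: cmod_eq_Re)
  moreover have "cmod (\<i> * f J + f R) \<le> cmod (f J) + cmod (f R)"
    by (rule order_trans[OF norm_triangle_ineq]) (simp add: norm_mult)
  ultimately show ?thesis using bR(1) bJ(1) by simp
qed

lemma state_on_emb:
  assumes "state_on n G' f" "G \<subseteq> G'"
  shows "state_on n G (\<lambda>A. f (emb n G G' A))"
proof -
  note fin = state_on_finite[OF assms(1)]
  have "f (emb n G G' (\<lambda>\<sigma> \<tau>. c * A \<sigma> \<tau> + B \<sigma> \<tau>)) = c * f (emb n G G' A) + f (emb n G G' B)" for A B c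
    using state_on_linear[OF assms(1) alg_emb alg_emb, of c G A G B]
    by (simp add: emb_add emb_scale)
  then show ?thesis
    using state_on_pos[OF assms(1) alg_emb] assms fin
    by (auto simp: state_on_def emb_opmult adj_emb emb_ident finite_subset)
qed

text \<open>A completely positive unital map in Kraus form, composed with a state. Positivity holds
  term by term, since conjugating the product of \<open>A\<close> and its adjoint by
  \<open>a t\<close> gives the same kind of product for \<open>A\<close> times
  \<open>a t\<close>.\<close>

lemma state_on_transform:
  assumes f: "state_on n G f" and a: "\<And>t. t \<in> T \<Longrightarrow> a t \<in> alg n G"
    and one: "(\<lambda>\<sigma> \<tau>. \<Sum>t\<in>T. opmult n G (adj (a t)) (a t) \<sigma> \<tau>) = ident n G"
  shows "state_on n G (\<lambda>X. \<Sum>t\<in>T. f (opmult n G (adj (a t)) (opmult n G X (a t))))"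
proof -
  note fin = state_on_finite[OF f]
  have lin: "f (opmult n G (adj (a t)) (opmult n G (\<lambda>\<sigma> \<tau>. c * A \<sigma> \<tau> + B \<sigma> \<tau>) (a t)))
    = c * f (opmult n G (adj (a t)) (opmult n G A (a t))) + f (opmult n G (adj (a t)) (opmult n G B (a t)))"
    if "t \<in> T" "A \<in> alg n G" "B \<in> alg n G" for t A B c
    unfolding opmult_add_left opmult_scale_left opmult_add_right opmult_scale_right
    using that a by (intro state_on_linear[OF f] alg_intros)
  have pos: "f (opmult n G (adj (a t)) (opmult n G (opmult n G (adj A) A) (a t))) \<in> \<real>\<^sub>\<ge>\<^sub>0"
    if "t \<in> T" "A \<in> alg n G" for t A
    using state_on_pos[OF f alg_opmult[OF that(2) a[OF that(1)]]]
    by (simp add: adj_opmult opmult_assoc)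
  have "(\<Sum>t\<in>T. f (opmult n G (adj (a t)) (opmult n G (ident n G) (a t)))) =
     (\<Sum>t\<in>T. f (opmult n G (adj (a t)) (a t)))"
    using a by (intro sum.cong refl) (simp add: opmult_ident_left[OF fin])
  also have "\<dots> = 1"
    using state_on_sum[OF f, of T "\<lambda>t. opmult n G (adj (a t)) (a t)"] a one state_on_ident[OF f]
    by (simp add: alg_intros)
  finally have one': "(\<Sum>t\<in>T. f (opmult n G (adj (a t)) (opmult n G (ident n G) (a t)))) = 1" .
  have nn: "sum g T \<in> \<real>\<^sub>\<ge>\<^sub>0" if "\<And>t. t \<in> T \<Longrightarrow> g t \<in> \<real>\<^sub>\<ge>\<^sub>0" for g :: "_ \<Rightarrow> complex"
    using that by (induction T rule: infinite_finite_induct) auto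
  show ?thesis
    unfolding state_on_def
    using fin one' nn[OF pos] by (auto simp: lin sum.distrib sum_distrib_left cong: sum.cong)
qed

section \<open>Vector states and finite-volume ground vectors\<close>

lemma expect_qform: "expect n G \<Phi> A = qform (conf n G) A \<Phi>"
  by (simp add: expect_def opapply_def qform_def sum_distrib_left mult.assoc)

lemma opapply_opmult: "opapply n G (opmult n G A B) \<Phi> = opapply n G A (opapply n G B \<Phi>)"
  unfolding opapply_def opmult_def sum_distrib_left sum_distrib_right
  by (intro ext, subst sum.swap) (simp add: mult.assoc)

lemma expect_adj_opmult:
  "expect n G \<Phi> (opmult n G (adj A) B) = (\<Sum>\<sigma>\<in>conf n G. cnj (opapply n G A \<Phi> \<sigma>) * opapply n G B \<Phi> \<sigma>)"
proof -
  have "expect n G \<Phi> (opmult n G (adj A) B)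
     = (\<Sum>\<sigma>\<in>conf n G. \<Sum>\<rho>\<in>conf n G. cnj (\<Phi> \<sigma>) * cnj (A \<rho> \<sigma>) * opapply n G B \<Phi> \<rho>)"
    unfolding expect_def opapply_opmult opapply_def[of n G "adj A"] sum_distrib_left
    by (simp add: adj_def mult.assoc)
  also have "\<dots> = (\<Sum>\<rho>\<in>conf n G. cnj (opapply n G A \<Phi> \<rho>) * opapply n G B \<Phi> \<rho>)"
    unfolding opapply_def[of n G A] cnj_sum sum_distrib_right by (subst sum.swap) (simp add: mult_ac)
  finally show ?thesis .
qed

lemma state_on_expect:
  assumes "finite G" "(\<Sum>\<sigma>\<in>conf n G. (cmod (\<Phi> \<sigma>))\<^sup>2) = 1"
  shows "state_on n G (expect n G \<Phi>)"
proof -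
  have "expect n G \<Phi> (opmult n G (adj A) A) = complex_of_real (\<Sum>\<sigma>\<in>conf n G. (cmod (opapply n G A \<Phi> \<sigma>))\<^sup>2)" for A
    unfolding expect_adj_opmult of_real_sum
    by (intro sum.cong refl) (simp add: complex_norm_square mult.commute del: of_real_power)
  then have "expect n G \<Phi> (opmult n G (adj A) A) \<in> \<real>\<^sub>\<ge>\<^sub>0" for A
    by (simp add: sum_nonneg del: of_real_sum)
  moreover have "expect n G \<Phi> (\<lambda>\<sigma> \<tau>. c * A \<sigma> \<tau> + B \<sigma> \<tau>) = c * expect n G \<Phi> A + expect n G \<Phi> B" for c A B
    by (simp add: expect_qform qform_linear)
  moreover have "expect n G \<Phi> (ident n G) = 1"
    using assms(2) by (simp add: expect_qform qform_ident[OF assms(1)] del: of_real_sum)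
  ultimately show ?thesis
    using assms(1) by (simp add: state_on_def)
qed

text \<open>\<open>ground_vec\<close> makes \<open>E\<close> minimal among eigenvalues only. The
  minimum of the quadratic form over unit vectors is itself an eigenvalue, so \<open>E\<close> is at
  most this minimum and bounds the form at every vector.\<close>

lemma ground_vec_variational:
  assumes g: "ground_vec n G H \<Phi>" and H: "adj H = H" and fin: "finite G"
  obtains E where "\<forall>\<sigma>\<in>conf n G. opapply n G H \<Phi> \<sigma> = complex_of_real E * \<Phi> \<sigma>"
    "\<forall>v. E * (\<Sum>\<sigma>\<in>conf n G. (cmod (v \<sigma>))\<^sup>2) \<le> Re (qform (conf n G) H v)"
    "Re (expect n G \<Phi> H) = E"
proof -
  from g obtain E where E: "\<And>\<sigma>. \<sigma> \<in> conf n G \<Longrightarrow> opapply n G H \<Phi> \<sigma> = complex_of_real E * \<Phi> \<sigma>"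
    and least: "\<And>\<Psi> E'. is_vec n G \<Psi> \<Longrightarrow> (\<exists>\<sigma>\<in>conf n G. \<Psi> \<sigma> \<noteq> 0) \<Longrightarrow>
         (\<forall>\<sigma>\<in>conf n G. opapply n G H \<Psi> \<sigma> = E' * \<Psi> \<sigma>) \<Longrightarrow> E \<le> Re E'"
    and nrm: "(\<Sum>\<sigma>\<in>conf n G. (cmod (\<Phi> \<sigma>))\<^sup>2) = 1"
    unfolding ground_vec_def by blast
  have herm: "H \<tau> \<sigma> = cnj (H \<sigma> \<tau>)" for \<sigma> \<tau>
    using fun_cong[OF fun_cong[OF H, of \<tau>], of \<sigma>] by (simp add: adj_def)
  have "conf n G \<noteq> {}" using zero_in_conf by blast
  from rayleigh[of _ H, OF finite_conf[OF fin] this herm] obtain \<psi> \<mu> where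
    \<psi>: "\<And>\<sigma>. \<sigma> \<notin> conf n G \<Longrightarrow> \<psi> \<sigma> = 0" "(\<Sum>\<sigma>\<in>conf n G. (cmod (\<psi> \<sigma>))\<^sup>2) = 1"
    "\<And>\<sigma>. \<sigma> \<in> conf n G \<Longrightarrow> (\<Sum>\<tau>\<in>conf n G. H \<sigma> \<tau> * \<psi> \<tau>) = complex_of_real \<mu> * \<psi> \<sigma>"
    "\<And>v. \<mu> * (\<Sum>\<sigma>\<in>conf n G. (cmod (v \<sigma>))\<^sup>2) \<le> Re (qform (conf n G) H v)"
    by blast
  have "E \<le> Re (complex_of_real \<mu>)"
  proof (rule least)
    show "is_vec n G \<psi>" using \<psi>(1) by (simp add: is_vec_def)
    show "\<exists>\<sigma>\<in>conf n G. \<psi> \<sigma> \<noteq> 0"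
    proof (rule ccontr)
      assume "\<not> ?thesis"
      then have "(\<Sum>\<sigma>\<in>conf n G. (cmod (\<psi> \<sigma>))\<^sup>2) = 0" by (intro sum.neutral) auto
      then show False using \<psi>(2) by simp
    qed
    show "\<forall>\<sigma>\<in>conf n G. opapply n G H \<psi> \<sigma> = complex_of_real \<mu> * \<psi> \<sigma>"
      using \<psi>(3) by (simp add: opapply_def)
  qed
  then have "E \<le> \<mu>" by simp
  have var: "E * (\<Sum>\<sigma>\<in>conf n G. (cmod (v \<sigma>))\<^sup>2) \<le> Re (qform (conf n G) H v)" for v
    using \<psi>(4)[of v] mult_right_mono[OF \<open>E \<le> \<mu>\<close>, of "\<Sum>\<sigma>\<in>conf n G. (cmod (v \<sigma>))\<^sup>2"]
    by (simp add: sum_nonneg)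
  have "expect n G \<Phi> H = (\<Sum>\<sigma>\<in>conf n G. complex_of_real (E * (cmod (\<Phi> \<sigma>))\<^sup>2))"
    unfolding expect_def using E
    by (intro sum.cong refl) (simp add: complex_norm_square mult_ac del: of_real_power)
  also have "\<dots> = complex_of_real E"
    using nrm by (simp only: of_real_sum[symmetric] sum_distrib_left[symmetric]) simp
  finally have "Re (expect n G \<Phi> H) = E" by simp
  with E var show thesis by (intro that) auto
qed

text \<open>With \<open>u\<close> the image of \<Phi> under \<open>A\<close>, the expectation is the
  form of \<open>H - E\<close> at \<open>u\<close>. This is the finite-volume counterpart of
  \<open>inf_gs\<close>.\<close>

lemma ground_vec_commutator_nonneg:
  assumes g: "ground_vec n G H \<Phi>" and H: "adj H = H" and fin: "finite G"
  shows "expect n G \<Phi> (opmult n G (adj A) (comm n G H A)) \<in> \<real>\<^sub>\<ge>\<^sub>0"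
proof -
  obtain E where
    E: "\<forall>\<sigma>\<in>conf n G. opapply n G H \<Phi> \<sigma> = complex_of_real E * \<Phi> \<sigma>"
    "\<forall>v. E * (\<Sum>\<sigma>\<in>conf n G. (cmod (v \<sigma>))\<^sup>2) \<le> Re (qform (conf n G) H v)"
    by (rule ground_vec_variational[OF g H fin]) (rule that)
  have herm: "H \<tau> \<sigma> = cnj (H \<sigma> \<tau>)" for \<sigma> \<tau>
    using fun_cong[OF fun_cong[OF H, of \<tau>], of \<sigma>] by (simp add: adj_def)
  define u where "u = opapply n G A \<Phi>"
  have AH: "opapply n G A (opapply n G H \<Phi>) \<sigma> = complex_of_real E * u \<sigma>" for \<sigma>
    unfolding u_def opapply_def[of n G A] sum_distrib_left using E(1)
    by (intro sum.cong refl) (simp add: mult_ac)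
  have "opapply n G (comm n G H A) \<Phi> \<sigma> = opapply n G H u \<sigma> - complex_of_real E * u \<sigma>" for \<sigma>
  proof -
    have "opapply n G (comm n G H A) \<Phi> \<sigma> = opapply n G (opmult n G H A) \<Phi> \<sigma> - opapply n G (opmult n G A H) \<Phi> \<sigma>"
      by (simp add: comm_def opapply_def left_diff_distrib sum_subtractf)
    then show ?thesis by (simp add: opapply_opmult AH u_def)
  qed
  then have "expect n G \<Phi> (opmult n G (adj A) (comm n G H A))
    = (\<Sum>\<sigma>\<in>conf n G. cnj (u \<sigma>) * opapply n G H u \<sigma> - complex_of_real (E * (cmod (u \<sigma>))\<^sup>2))"
    unfolding expect_adj_opmult u_def[symmetric]
    by (intro sum.cong refl) (simp add: right_diff_distrib complex_norm_square mult_ac del: of_real_power)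
  also have "\<dots> = qform (conf n G) H u - complex_of_real (E * (\<Sum>\<sigma>\<in>conf n G. (cmod (u \<sigma>))\<^sup>2))"
    unfolding sum_subtractf expect_qform[symmetric] expect_def sum_distrib_left of_real_sum ..
  finally show ?thesis
    using E(2)[rule_format, of u] hermitian_qform_real[of "conf n G" H u, OF herm]
    by (simp add: complex_nonneg_Reals_iff del: of_real_sum)
qed

section \<open>Bonds and box geometry\<close>

lemma spin_mat_bounded: "\<exists>K. \<forall>i\<in>{1, 2, 3}. \<forall>j k. j \<le> n \<longrightarrow> k \<le> n \<longrightarrow> cmod (spin_mat n i j k) \<le> K"
proof (intro exI ballI allI impI)
  fix i j k assume a: "i \<in> {1, 2, 3 :: nat}" "j \<le> n" "k \<le> n"
  have "cmod (spin_mat n i j k) \<le> (\<Sum>k\<in>{..n}. cmod (spin_mat n i j k))"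
    by (rule member_le_sum) (use a in auto)
  also have "\<dots> \<le> (\<Sum>j\<in>{..n}. \<Sum>k\<in>{..n}. cmod (spin_mat n i j k))"
    by (rule member_le_sum) (use a in \<open>auto intro: sum_nonneg\<close>)
  also have "\<dots> \<le> (\<Sum>i\<in>{1, 2, 3}. \<Sum>j\<in>{..n}. \<Sum>k\<in>{..n}. cmod (spin_mat n i j k))"
    by (rule member_le_sum) (use a in \<open>auto intro!: sum_nonneg\<close>)
  finally show "cmod (spin_mat n i j k) \<le> (\<Sum>i\<in>{1, 2, 3}. \<Sum>j\<in>{..n}. \<Sum>k\<in>{..n}. cmod (spin_mat n i j k))" .
qed

lemma site_op_bounded:
  assumes "\<And>j k. j \<le> n \<Longrightarrow> k \<le> n \<Longrightarrow> cmod (M j k) \<le> K" "x \<in> G" "0 \<le> K"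
  shows "cmod (site_op n G x M \<sigma> \<tau>) \<le> K"
  using assms by (auto simp: site_op_def conf_def)

text \<open>At most two sites are involved, so the number of configurations and the size of the
  entries are bounded independently of the positions.\<close>

lemma opsum_spin_dot_bounded: "\<exists>C. \<forall>x y :: 'd site. opsum n {x, y} (spin_dot n {x, y} x y) \<le> C"
proof -
  obtain K0 where K0: "\<And>i j k. i \<in> {1, 2, 3} \<Longrightarrow> j \<le> n \<Longrightarrow> k \<le> n \<Longrightarrow> cmod (spin_mat n i j k) \<le> K0"
    using spin_mat_bounded[of n] by blast
  define K where "K = \<bar>K0\<bar>"
  have K: "cmod (spin_mat n i j k) \<le> K" if "i \<in> {1, 2, 3}" "j \<le> n" "k \<le> n" for i j k
    using K0[OF that] by (simp add: K_def)
  have K_nonneg: "0 \<le> K" by (simp add: K_def)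
  define N where "N = real ((n + 1) ^ 2)"
  show ?thesis
  proof (intro exI allI)
    fix x y :: "'d site"
    let ?c = "real (card (conf n {x, y}))"
    have "card (conf n {x, y}) \<le> (n + 1) ^ card {x, y}" by (rule card_conf_le) simp
    also have "\<dots> \<le> (n + 1) ^ 2" by (intro power_increasing) (auto simp: card_insert_if)
    finally have c: "?c \<le> N" unfolding N_def by (rule of_nat_mono)
    have e: "cmod (spin_dot n {x, y} x y \<sigma> \<tau>) \<le> 3 * (N * (K * K))" for \<sigma> \<tau>
    proof -
      have "cmod (opmult n {x, y} (site_op n {x, y} x (spin_mat n i)) (site_op n {x, y} y (spin_mat n i)) \<sigma> \<tau>)
        \<le> N * (K * K)" if "i \<in> {1, 2, 3}" for i
      proof -
        have "cmod (opmult n {x, y} (site_op n {x, y} x (spin_mat n i)) (site_op n {x, y} y (spin_mat n i)) \<sigma> \<tau>)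
          \<le> (\<Sum>\<rho>\<in>conf n {x, y}. K * K)"
          unfolding opmult_def
          by (intro order_trans[OF norm_sum] sum_mono)
            (auto simp: norm_mult intro!: mult_mono site_op_bounded K that K_nonneg)
        also have "\<dots> \<le> N * (K * K)" using c by (simp add: mult_right_mono)
        finally show ?thesis .
      qed
      then have "cmod (spin_dot n {x, y} x y \<sigma> \<tau>) \<le> (\<Sum>i\<in>{1, 2, 3::nat}. N * (K * K))"
        unfolding spin_dot_def by (intro order_trans[OF norm_sum] sum_mono) auto
      then show ?thesis by simp
    qed
    have "opsum n {x, y} (spin_dot n {x, y} x y) \<le> (\<Sum>\<sigma>\<in>conf n {x, y}. \<Sum>\<tau>\<in>conf n {x, y}. 3 * (N * (K * K)))"
      unfolding opsum_def by (intro sum_mono e)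
    also have "\<dots> = ?c * (?c * (3 * (N * (K * K))))" by simp
    also have "\<dots> \<le> N * (N * (3 * (N * (K * K))))"
      using c K_nonneg by (intro mult_mono) (auto simp: N_def)
    finally show "opsum n {x, y} (spin_dot n {x, y} x y) \<le> N * (N * (3 * (N * (K * K))))" .
  qed
qed

text \<open>Restricting the state to the two sites removes the region from the bound. With
  \<open>C\<close> uniform in region and state, an energy difference is controlled by the number of
  bonds that contribute to it.\<close>

lemma state_on_spin_dot_bounded:
  "\<exists>C\<ge>0. \<forall>G f. \<forall>x\<in>G. \<forall>y\<in>G. x \<noteq> y \<longrightarrow> state_on n G f \<longrightarrow> \<bar>Re (f (spin_dot n G x y :: 'd op))\<bar> \<le> C"
proof -
  obtain C where C: "\<And>x y :: 'd site. opsum n {x, y} (spin_dot n {x, y} x y) \<le> C"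
    using opsum_spin_dot_bounded by blast
  show ?thesis
  proof (intro exI conjI allI ballI impI)
    show "0 \<le> \<bar>C\<bar>" by simp
    fix G and f :: "'d op \<Rightarrow> complex" and x y :: "'d site"
    assume a: "x \<in> G" "y \<in> G" "x \<noteq> y" "state_on n G f"
    have "\<bar>Re (f (emb n {x, y} G (spin_dot n {x, y} x y)))\<bar> \<le> opsum n {x, y} (spin_dot n {x, y} x y)"
      by (rule state_on_bound_hermitian(1)[OF state_on_emb[OF a(4)]])
        (use a in \<open>auto intro!: alg_intros adj_spin_dot\<close>)
    also have "\<dots> \<le> \<bar>C\<bar>" using C[of x y] by simp
    finally show "\<bar>Re (f (spin_dot n G x y))\<bar> \<le> \<bar>C\<bar>"
      using a by (simp add: emb_spin_dot state_on_finite[OF a(4)])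
  qed
qed

section \<open>Periodic bonds versus bonds of the infinite lattice\<close>

definition lattice_nn :: "('d \<Rightarrow> int) \<Rightarrow> ('d \<Rightarrow> int) \<Rightarrow> bool" where
  "lattice_nn x y \<longleftrightarrow> (\<exists>i. (y i - x i = 1 \<or> y i - x i = -1) \<and> (\<forall>j. j \<noteq> i \<longrightarrow> x j = y j))"

lemma mod_eq_1D:
  fixes d m :: int
  assumes "d mod m = 1" shows "m dvd d - 1"
proof -
  have "d - 1 = m * (d div m)" using assms mult_div_mod_eq[of m d] by linarith
  then show ?thesis by simp
qed

lemma mod_eq_minus_1D:
  fixes d m :: int
  assumes "d mod m = m - 1" shows "m dvd d + 1"
proof -
  have "d + 1 = m * (d div m) + m" using assms mult_div_mod_eq[of m d] by linarith
  then show ?thesis by simp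
qed

lemma dvd_abs_less_imp_zero:
  assumes "m dvd d" "\<bar>d\<bar> < m" shows "d = (0::int)"
proof (rule ccontr)
  assume "d \<noteq> 0"
  then have "\<bar>m\<bar> \<le> \<bar>d\<bar>" using assms(1) by (rule dvd_imp_le_int)
  then show False using assms(2) by linarith
qed

lemma dvd_between:
  fixes m d :: int
  assumes "m dvd d" "m > 0" "- m \<le> d" "d < m" shows "d = 0 \<or> d = - m"
proof (cases "d = - m")
  case False
  then have "\<bar>d\<bar> < m" using assms by linarith
  then show ?thesis using dvd_abs_less_imp_zero[OF assms(1)] by simp
qed simp

lemma lattice_nn_imp_pnn:
  assumes "lattice_nn x y" "L \<ge> 1" shows "pnn L x y"
proof -
  from assms(1) obtain i where i: "y i - x i = 1 \<or> y i - x i = -1" "\<And>j. j \<noteq> i \<Longrightarrow> x j = y j"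
    unfolding lattice_nn_def by blast
  have "x \<noteq> y" using i(1) by auto
  moreover have "(y i - x i) mod (2 * int L) = 1 \<or> (y i - x i) mod (2 * int L) = 2 * int L - 1"
    using i(1) assms(2) by (auto simp: zmod_minus1)
  ultimately show ?thesis unfolding pnn_def using i(2) by blast
qed

text \<open>A bond that needs the periodicity joins two opposite faces. If one endpoint lies in a
  strictly smaller box, the offset is too short to wrap around.\<close>

lemma pnn_imp_lattice_nn:
  assumes "L0 < L" "x \<in> box L" "y \<in> box L" "x \<in> box L0 \<or> y \<in> box L0" "pnn L x y"
  shows "lattice_nn x y"
proof -
  from assms(5) obtain i where i: "(y i - x i) mod (2 * int L) = 1 \<or> (y i - x i) mod (2 * int L) = 2 * int L - 1"
     "\<And>j. j \<noteq> i \<Longrightarrow> x j = y j" unfolding pnn_def by blast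
  have b: "- int L + 1 \<le> x i" "x i \<le> int L" "- int L + 1 \<le> y i" "y i \<le> int L"
    using assms(2,3) by (auto simp: box_def)
  have b0: "(- int L0 + 1 \<le> x i \<and> x i \<le> int L0) \<or> (- int L0 + 1 \<le> y i \<and> y i \<le> int L0)"
    using assms(4) by (auto simp: box_def)
  from i(1) have "y i - x i = 1 \<or> y i - x i = -1"
  proof
    assume "(y i - x i) mod (2 * int L) = 1"
    from mod_eq_1D[OF this] have "y i - x i - 1 = 0"
      by (rule dvd_abs_less_imp_zero) (use b b0 assms(1) in linarith)
    then show ?thesis by simp
  next
    assume "(y i - x i) mod (2 * int L) = 2 * int L - 1"
    from mod_eq_minus_1D[OF this] have "y i - x i + 1 = 0"
      by (rule dvd_abs_less_imp_zero) (use b b0 assms(1) in linarith)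
    then show ?thesis by simp
  qed
  then show ?thesis unfolding lattice_nn_def using i(2) by blast
qed

text \<open>The lattice bonds, as ordered pairs, that can fail to commute with an operator on the
  box. The restriction to \<open>box (L + 1)\<close> loses none of them and makes the set visibly
  finite.\<close>

definition touching :: "nat \<Rightarrow> (('d::finite) site \<times> 'd site) set" where
  "touching L = {(x, y). x \<in> box (L + 1) \<and> y \<in> box (L + 1) \<and> lattice_nn x y \<and> (x \<in> box L \<or> y \<in> box L)}"

lemma lattice_nn_box:
  assumes "lattice_nn x y" shows "x \<in> box L \<Longrightarrow> y \<in> box (L + 1)" "y \<in> box L \<Longrightarrow> x \<in> box (L + 1)"
proof -
  have "\<bar>y i - x i\<bar> \<le> 1" for i using assms unfolding lattice_nn_def by (metis abs_0_eq abs_minus abs_one diff_self order_refl zero_le_one)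
  then have *: "y i \<le> x i + 1 \<and> x i \<le> y i + 1" for i by (smt (verit))
  show "y \<in> box (L + 1)" if "x \<in> box L"
    unfolding box_def
  proof (intro CollectI allI)
    fix i have "- int L + 1 \<le> x i \<and> x i \<le> int L" using that by (auto simp: box_def)
    then show "- int (L + 1) + 1 \<le> y i \<and> y i \<le> int (L + 1)" using *[of i] by linarith
  qed
  show "x \<in> box (L + 1)" if "y \<in> box L"
    unfolding box_def
  proof (intro CollectI allI)
    fix i have "- int L + 1 \<le> y i \<and> y i \<le> int L" using that by (auto simp: box_def)
    then show "- int (L + 1) + 1 \<le> x i \<and> x i \<le> int (L + 1)" using *[of i] by linarith
  qed
qed

text \<open>The right-hand side does not involve \<open>L\<close>: seen from a fixed inner box, all
  larger periodic boxes have the same bonds.\<close>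

lemma bonds_touching:
  assumes "L0 < L"
  shows "{p \<in> bonds L. fst p \<in> box L0 \<or> snd p \<in> box L0} = (touching L0 :: (('d::finite) site \<times> 'd site) set)"
proof (intro set_eqI iffI)
  fix p :: "'d site \<times> 'd site"
  obtain x y where p: "p = (x, y)" by force
  { assume a: "p \<in> {p \<in> bonds L. fst p \<in> box L0 \<or> snd p \<in> box L0}"
    then have "lattice_nn x y" using pnn_imp_lattice_nn[OF assms] unfolding p bonds_def by auto
    then show "p \<in> touching L0"
      using a lattice_nn_box[of x y L0] box_mono[of L0 "L0 + 1"] unfolding p touching_def by auto }
  { assume a: "p \<in> touching L0"
    have "box (L0 + 1) \<subseteq> (box L :: 'd site set)" using assms by (intro box_mono) simp
    then show "p \<in> {p \<in> bonds L. fst p \<in> box L0 \<or> snd p \<in> box L0}"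
      using a assms lattice_nn_imp_pnn[of x y L] unfolding p bonds_def touching_def by auto }
qed

section \<open>Counting bonds near the faces\<close>

definition bdry :: "nat \<Rightarrow> ('d::finite) site set" where
  "bdry L = {x \<in> box L. \<exists>i. x i = int L \<or> x i = - int L + 1}"

lemma box_PiE: "box L = PiE (UNIV :: ('d::finite) set) (\<lambda>_. {- int L + 1..int L})"
  by (auto simp: box_def PiE_def)

lemma card_box: "card (box L :: ('d::finite) site set) = (2 * L) ^ CARD('d)"
proof -
  have "card {- int L + 1..int L} = 2 * L" by simp
  then show ?thesis unfolding box_PiE by (subst card_PiE) (simp_all only: finite prod_constant)
qed

lemma card_slice: "card {x \<in> (box L :: ('d::finite) site set). x i = c} \<le> (2 * L) ^ (CARD('d) - 1)"
proof -
  have "{x \<in> (box L :: 'd site set). x i = c} \<subseteq> PiE UNIV (\<lambda>j. if j = i then {c} else {- int L + 1..int L})"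
    by (auto simp: box_PiE PiE_def Pi_def)
  then have "card {x \<in> (box L :: 'd site set). x i = c} \<le> card (PiE (UNIV :: 'd set) (\<lambda>j. if j = i then {c} else {- int L + 1..int L}))"
    by (intro card_mono finite_PiE) auto
  also have "\<dots> = (\<Prod>j\<in>(UNIV :: 'd set). if j = i then 1 else 2 * L)"
    by (subst card_PiE) (auto intro!: prod.cong)
  also have "\<dots> = (\<Prod>j\<in>(UNIV :: 'd set) - {i}. 2 * L)"
    by (subst prod.remove[of UNIV i]) (auto intro!: prod.cong)
  also have "\<dots> = (2 * L) ^ (CARD('d) - 1)" by simp
  finally show ?thesis .
qed

text \<open>There are 2d faces with at most \<open>(2 * L) ^ (d - 1)\<close> points each. This ratio
  of surface to volume is the origin of the factor 1/L in the error term.\<close>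

lemma card_bdry: "card (bdry L :: ('d::finite) site set) * L \<le> CARD('d) * card (box L :: 'd site set)"
proof -
  have "bdry L = (\<Union>i. {x \<in> (box L :: 'd site set). x i = int L} \<union> {x \<in> box L. x i = - int L + 1})"
    by (auto simp: bdry_def)
  then have "card (bdry L :: 'd site set) \<le> (\<Sum>i\<in>UNIV. card ({x \<in> (box L :: 'd site set). x i = int L} \<union> {x \<in> box L. x i = - int L + 1}))"
    by (simp only: card_UN_le finite)
  also have "\<dots> \<le> (\<Sum>i\<in>(UNIV::'d set). (2 * L) ^ (CARD('d) - 1) + (2 * L) ^ (CARD('d) - 1))"
    by (intro sum_mono order_trans[OF card_Un_le] add_mono card_slice)
  finally have "card (bdry L :: 'd site set) \<le> CARD('d) * (2 * (2 * L) ^ (CARD('d) - 1))" by (simp add: mult_2)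
  then have "card (bdry L :: 'd site set) * L \<le> CARD('d) * (2 * (2 * L) ^ (CARD('d) - 1)) * L"
    by (rule mult_right_mono) simp
  also have "\<dots> = CARD('d) * ((2 * L) * (2 * L) ^ (CARD('d) - 1))" by simp
  also have "(2 * L) * (2 * L) ^ (CARD('d) - 1) = (2 * L) ^ CARD('d)"
    by (metis One_nat_def Suc_pred power_Suc zero_less_card_finite)
  finally show ?thesis by (simp add: card_box)
qed

lemma box_update:
  assumes "x \<in> box L" "\<And>j. j \<noteq> i \<Longrightarrow> x j = y j" "- int L + 1 \<le> y i \<and> y i \<le> int L"
  shows "y \<in> box L"
  unfolding box_def
proof (intro CollectI allI)
  fix j show "- int L + 1 \<le> y j \<and> y j \<le> int L"
  proof (cases "j = i")
    case False
    then have "y j = x j" using assms(2) by simp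
    then show ?thesis using assms(1) by (simp add: box_def)
  qed (use assms(3) in simp)
qed

text \<open>A pair in only one of the sets either crosses a face of the box or wraps around. In both
  cases an endpoint lies on the boundary and the other arises by resetting one coordinate to one of
  four values; \<open>prod.swap\<close> covers a boundary endpoint in second place.\<close>

lemma sym_diff_pairs:
  assumes L: "L \<ge> 1"
  defines "N \<equiv> \<lambda>x::('d::finite) site. (\<lambda>(i, v). x(i := v)) ` Sigma UNIV (\<lambda>i. {x i + 1, x i - 1, int L, - int L + 1})"
  shows "(touching L - bonds L) \<union> (bonds L - touching L) \<subseteq> Sigma (bdry L) N \<union> prod.swap ` Sigma (bdry L) N"
proof
  fix p :: "'d site \<times> 'd site"
  assume p_in: "p \<in> (touching L - bonds L) \<union> (bonds L - touching L)"
  obtain x y where p: "p = (x, y)" by force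
  have N: "x'(i := v) \<in> N x'" if "v \<in> {x' i + 1, x' i - 1, int L, - int L + 1}" for x' i v
    using that unfolding N_def by force
  from p_in show "p \<in> Sigma (bdry L) N \<union> prod.swap ` Sigma (bdry L) N"
  proof
    assume a: "p \<in> touching L - bonds L"
    then have nn: "lattice_nn x y" and t: "x \<in> box L \<or> y \<in> box L" unfolding p touching_def by auto
    have out: "\<not> (x \<in> box L \<and> y \<in> box L)"
      using a lattice_nn_imp_pnn[OF nn L] unfolding p bonds_def by auto
    from nn obtain i where i: "y i - x i = 1 \<or> y i - x i = -1" "\<And>j. j \<noteq> i \<Longrightarrow> x j = y j"
      unfolding lattice_nn_def by blast
    have y: "y = x(i := y i)" and x: "x = y(i := x i)" using i(2) by (auto simp: fun_eq_iff)
    show ?thesis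
    proof (cases "x \<in> box L")
      case True
      then have "\<not> (- int L + 1 \<le> y i \<and> y i \<le> int L)" using out box_update[of x L i y] i(2) by blast
      moreover have "- int L + 1 \<le> x i \<and> x i \<le> int L" using True by (auto simp: box_def)
      ultimately have "x i = int L \<or> x i = - int L + 1" using i(1) by linarith
      then have "x \<in> bdry L" using True by (auto simp: bdry_def)
      moreover have "y \<in> N x" by (subst y, rule N) (use i(1) in auto)
      ultimately show ?thesis unfolding p by auto
    next
      case False
      then have yb: "y \<in> box L" using t by simp
      then have "\<not> (- int L + 1 \<le> x i \<and> x i \<le> int L)" using False box_update[of y L i x] i(2) yb by metis
      moreover have "- int L + 1 \<le> y i \<and> y i \<le> int L" using yb by (auto simp: box_def)
      ultimately have "y i = int L \<or> y i = - int L + 1" using i(1) by linarith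
      then have "y \<in> bdry L" using yb by (auto simp: bdry_def)
      moreover have "x \<in> N y" by (subst x, rule N) (use i(1) in auto)
      ultimately have "(y, x) \<in> Sigma (bdry L) N" by simp
      then show ?thesis unfolding p by force
    qed
  next
    assume a: "p \<in> bonds L - touching L"
    then have xy: "x \<in> box L" "y \<in> box L" and pnn: "pnn L x y" unfolding p bonds_def by auto
    have not_nn: "\<not> lattice_nn x y"
      using a xy box_mono[of L "L + 1"] unfolding p touching_def by auto
    from pnn obtain i where i: "(y i - x i) mod (2 * int L) = 1 \<or> (y i - x i) mod (2 * int L) = 2 * int L - 1"
       "\<And>j. j \<noteq> i \<Longrightarrow> x j = y j" unfolding pnn_def by blast
    have b: "- int L + 1 \<le> x i" "x i \<le> int L" "- int L + 1 \<le> y i" "y i \<le> int L"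
      using xy by (auto simp: box_def)
    have n1: "y i - x i \<noteq> 1" "y i - x i \<noteq> -1" using not_nn i(2) unfolding lattice_nn_def by blast+
    from i(1) have "(x i = int L \<and> y i = - int L + 1) \<or> (x i = - int L + 1 \<and> y i = int L)"
    proof
      assume "(y i - x i) mod (2 * int L) = 1"
      from dvd_between[OF mod_eq_1D[OF this]] b L have "y i - x i - 1 = 0 \<or> y i - x i - 1 = - (2 * int L)"
        by linarith
      then show ?thesis using n1 b by linarith
    next
      assume "(y i - x i) mod (2 * int L) = 2 * int L - 1"
      then have "2 * int L dvd - (y i - x i + 1)" using mod_eq_minus_1D dvd_minus_iff by blast
      from dvd_between[OF this] b L have "- (y i - x i + 1) = 0 \<or> - (y i - x i + 1) = - (2 * int L)"
        by linarith
      then show ?thesis using n1 b by linarith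
    qed
    then have "x \<in> bdry L" "y i \<in> {int L, - int L + 1}" using xy by (auto simp: bdry_def)
    moreover have "y = x(i := y i)" using i(2) by (auto simp: fun_eq_iff)
    then have "y \<in> N x" using N[of "y i" x i] calculation(2) by auto
    ultimately show ?thesis unfolding p by auto
  qed
qed

text \<open>The constant is 2 for the orientation, 4 for the new value of the coordinate and d for
  the direction.\<close>

lemma card_sym_diff_pairs:
  assumes L: "L \<ge> 1"
  shows "card ((touching L - bonds L) \<union> (bonds L - touching L) :: (('d::finite) site \<times> 'd site) set)
    \<le> 8 * CARD('d) * card (bdry L :: 'd site set)"
proof -
  define N where "N = (\<lambda>x::'d site. (\<lambda>(i, v). x(i := v)) ` Sigma UNIV (\<lambda>i. {x i + 1, x i - 1, int L, - int L + 1}))"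
  have fb: "finite (bdry L :: 'd site set)" by (simp add: bdry_def)
  have fN: "finite (N x)" for x unfolding N_def by auto
  have cN: "card (N x) \<le> CARD('d) * 4" for x
  proof -
    have "card (N x) \<le> card (Sigma (UNIV :: 'd set) (\<lambda>i. {x i + 1, x i - 1, int L, - int L + 1}))"
      unfolding N_def by (intro card_image_le) auto
    also have "\<dots> = (\<Sum>i\<in>(UNIV :: 'd set). card {x i + 1, x i - 1, int L, - int L + 1})"
      by (intro card_SigmaI) auto
    also have "\<dots> \<le> (\<Sum>i\<in>(UNIV :: 'd set). 4)"
    proof (intro sum_mono)
      fix i show "card {x i + 1, x i - 1, int L, - int L + 1} \<le> 4"
        using card_length[of "[x i + 1, x i - 1, int L, - int L + 1]"] by simp
    qed
    finally show ?thesis by simp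
  qed
  have cS: "card (Sigma (bdry L) N) \<le> card (bdry L :: 'd site set) * (CARD('d) * 4)"
  proof -
    have "card (Sigma (bdry L) N) = (\<Sum>x\<in>bdry L. card (N x))" using fb fN by (intro card_SigmaI) auto
    also have "\<dots> \<le> (\<Sum>x\<in>(bdry L :: 'd site set). CARD('d) * 4)" by (intro sum_mono cN)
    finally show ?thesis by simp
  qed
  have fS: "finite (Sigma (bdry L) N)" using fb fN by auto
  have "card ((touching L - bonds L) \<union> (bonds L - touching L) :: ('d site \<times> 'd site) set) \<le> card (Sigma (bdry L) N \<union> prod.swap ` Sigma (bdry L) N)"
    using sym_diff_pairs[OF L] fS unfolding N_def by (intro card_mono) auto
  also have "\<dots> \<le> card (Sigma (bdry L) N) + card (prod.swap ` Sigma (bdry L) N)" by (rule card_Un_le)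
  also have "\<dots> \<le> card (Sigma (bdry L) N) + card (Sigma (bdry L) N)"
    using card_image_le[OF fS] by (intro add_left_mono)
  also have "\<dots> \<le> 8 * CARD('d) * card (bdry L :: 'd site set)" using cS by (simp add: mult_ac)
  finally show ?thesis .
qed

lemma finite_subset_box:
  assumes "finite (G :: ('d::finite) site set)" obtains L0 where "G \<subseteq> box L0"
proof -
  have "\<exists>L0. G \<subseteq> box L0" using assms
  proof (induction G rule: finite_induct)
    case (insert x G)
    then obtain L0 where L0: "G \<subseteq> box L0" by blast
    define m where "m = L0 + nat (\<Sum>i\<in>UNIV. \<bar>x i\<bar>) + 1"
    have "x \<in> box m"
      unfolding box_def
    proof (intro CollectI allI)
      fix i have "\<bar>x i\<bar> \<le> (\<Sum>i\<in>UNIV. \<bar>x i\<bar>)" by (rule member_le_sum) auto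
      then show "- int m + 1 \<le> x i \<and> x i \<le> int m" unfolding m_def by linarith
    qed
    moreover have "box L0 \<subseteq> (box m :: 'd site set)" by (intro box_mono) (simp add: m_def)
    ultimately show ?case using L0 by (intro exI[of _ m]) blast
  qed simp
  then show thesis using that by blast
qed

section \<open>Local energy and infinite-volume ground states\<close>

lemma comm_sum_left: "comm n G (\<lambda>\<sigma> \<tau>. \<Sum>i\<in>I. A i \<sigma> \<tau>) B = (\<lambda>\<sigma> \<tau>. \<Sum>i\<in>I. comm n G (A i) B \<sigma> \<tau>)"
  by (simp add: comm_def opmult_sum_left opmult_sum_right sum_subtractf)

lemma comm_scale_left: "comm n G (\<lambda>\<sigma> \<tau>. c * A \<sigma> \<tau>) B = (\<lambda>\<sigma> \<tau>. c * comm n G A B \<sigma> \<tau>)"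
  by (simp add: comm_def opmult_scale_left opmult_scale_right right_diff_distrib)

lemma comm_diff_left: "comm n G (\<lambda>\<sigma> \<tau>. A \<sigma> \<tau> - A' \<sigma> \<tau>) B = (\<lambda>\<sigma> \<tau>. comm n G A B \<sigma> \<tau> - comm n G A' B \<sigma> \<tau>)"
  by (simp add: comm_def opmult_diff_left opmult_diff_right algebra_simps)

lemma comm_spin_dot_emb:
  assumes "x \<in> G'" "y \<in> G'" "x \<notin> G" "y \<notin> G" "G \<subseteq> G'" "finite G'"
  shows "comm n G' (spin_dot n G' x y) (emb n G G' a) = (\<lambda>\<sigma> \<tau>. 0)"
  using comm_emb_disjoint[of "{x, y}" G' G n "spin_dot n {x, y} x y" a] assms
  by (simp add: emb_spin_dot)

lemma comm_site_op_emb: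
  assumes "x \<in> G'" "x \<notin> G" "G \<subseteq> G'" "finite G'"
  shows "comm n G' (site_op n G' x M) (emb n G G' a) = (\<lambda>\<sigma> \<tau>. 0)"
  using comm_emb_disjoint[of "{x}" G' G n "site_op n {x} x M" a] assms
  by (simp add: emb_site_op)

lemma comm_ham0_touching:
  assumes "L0 < L"
  shows "comm n (box L) (ham0 n L :: ('a::finite) op) (emb n (box L0) (box L) a) =
    (\<lambda>\<sigma> \<tau>. 1/2 * (\<Sum>p\<in>touching L0. comm n (box L) (spin_dot n (box L) (fst p) (snd p)) (emb n (box L0) (box L) a) \<sigma> \<tau>))"
proof -
  have "(\<Sum>p\<in>bonds L. comm n (box L) (spin_dot n (box L) (fst p) (snd p)) (emb n (box L0) (box L) a) \<sigma> \<tau>)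
     = (\<Sum>p\<in>touching L0. comm n (box L) (spin_dot n (box L) (fst p) (snd p)) (emb n (box L0) (box L) a) \<sigma> \<tau>)" for \<sigma> \<tau> :: "'a cfg"
    unfolding bonds_touching[OF assms, symmetric]
  proof (rule sum.mono_neutral_right)
    show "\<forall>p\<in>bonds L - {p \<in> bonds L. fst p \<in> box L0 \<or> snd p \<in> box L0}.
        comm n (box L) (spin_dot n (box L) (fst p) (snd p)) (emb n (box L0) (box L) a) \<sigma> \<tau> = 0"
    proof
      fix p :: "'a site \<times> 'a site"
      assume "p \<in> bonds L - {p \<in> bonds L. fst p \<in> box L0 \<or> snd p \<in> box L0}"
      then have "fst p \<in> box L" "snd p \<in> box L" "fst p \<notin> box L0" "snd p \<notin> box L0" by (auto simp: bonds_def)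
      from comm_spin_dot_emb[OF this box_mono finite_box] assms
      show "comm n (box L) (spin_dot n (box L) (fst p) (snd p)) (emb n (box L0) (box L) a) \<sigma> \<tau> = 0" by simp
    qed
  qed auto
  then show ?thesis
    unfolding ham0_bonds comm_scale_left comm_sum_left by simp
qed

lemma touching_box:
  assumes "p \<in> touching L" shows "fst p \<in> box (L + 1)" "snd p \<in> box (L + 1)" "fst p \<noteq> snd p"
  using assms by (auto simp: touching_def lattice_nn_def)

text \<open>Bonds that miss the inner box commute with the embedded operator, and the remaining ones
  are the same for every larger box. So the commutator has stabilized as soon as the box is larger
  by one.\<close>

lemma comm_ham0_emb:
  assumes "L0 < L"
  shows "comm n (box L) (ham0 n L :: ('a::finite) op) (emb n (box L0) (box L) a) =
    emb n (box (L0 + 1)) (box L) (comm n (box (L0 + 1)) (ham0 n (L0 + 1)) (emb n (box L0) (box (L0 + 1)) a))"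
proof -
  have b: "box L0 \<subseteq> (box (L0 + 1) :: 'a site set)" "box (L0 + 1) \<subseteq> (box L :: 'a site set)"
    using assms by (intro box_mono; simp)+
  have "emb n (box (L0 + 1)) (box L) (comm n (box (L0 + 1)) (ham0 n (L0 + 1)) (emb n (box L0) (box (L0 + 1)) a)) =
    (\<lambda>\<sigma> \<tau>. 1/2 * (\<Sum>p\<in>touching L0. emb n (box (L0 + 1)) (box L)
       (comm n (box (L0 + 1)) (spin_dot n (box (L0 + 1)) (fst p) (snd p)) (emb n (box L0) (box (L0 + 1)) a)) \<sigma> \<tau>))"
    by (subst comm_ham0_touching) (simp_all only: emb_scale emb_sum less_add_one)
  also have "\<dots> = comm n (box L) (ham0 n L) (emb n (box L0) (box L) a)"
    unfolding comm_ham0_touching[OF assms]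
    by (simp only: emb_comm[OF b(2) finite_box] emb_emb[OF b] emb_spin_dot[OF touching_box(1,2) b(2) finite_box] cong: sum.cong)
  finally show ?thesis ..
qed

lemma emb_stag_sum:
  assumes "L0 \<le> L"
  shows "emb n (box L0) (box L) (stag n L0) = (\<lambda>\<sigma> \<tau>. \<Sum>x\<in>box L0. stsign x * site_op n (box L) x (spin_mat n 3) \<sigma> \<tau>)"
  unfolding stag_def emb_sum emb_scale
  by (intro ext sum.cong refl) (simp add: emb_site_op box_mono[OF assms])

lemma comm_stag_emb:
  assumes "L0 \<le> L"
  shows "comm n (box L) (stag n L :: ('a::finite) op) (emb n (box L0) (box L) a) = emb n (box L0) (box L) (comm n (box L0) (stag n L0) a)"
proof -
  have b: "box L0 \<subseteq> (box L :: 'a site set)" by (rule box_mono[OF assms])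
  have "(\<Sum>x\<in>box L. stsign x * comm n (box L) (site_op n (box L) x (spin_mat n 3)) (emb n (box L0) (box L) a) \<sigma> \<tau>)
     = (\<Sum>x\<in>box L0. stsign x * comm n (box L) (site_op n (box L) x (spin_mat n 3)) (emb n (box L0) (box L) a) \<sigma> \<tau>)" for \<sigma> \<tau>
    using b by (intro sum.mono_neutral_right) (auto simp: comm_site_op_emb[OF _ _ b finite_box])
  then have "comm n (box L) (stag n L) (emb n (box L0) (box L) a) = comm n (box L) (emb n (box L0) (box L) (stag n L0)) (emb n (box L0) (box L) a)"
    unfolding emb_stag_sum[OF assms] by (simp add: stag_def comm_sum_left comm_scale_left)
  then show ?thesis by (simp only: emb_comm[OF b finite_box])
qed

text \<open>The product of the adjoint of \<open>a\<close> with the commutator \<open>[H, a]\<close>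
  from the ground state condition, written in the first box beyond that of \<open>a\<close>, where
  the commutator has already stabilized.\<close>

definition local_energy :: "nat \<Rightarrow> nat \<Rightarrow> ('d::finite) op \<Rightarrow> 'd op" where
  "local_energy n L a = (let G = box (L + 1); b = emb n (box L) G a
     in opmult n G (adj b) (comm n G (ham0 n (L + 1)) b))"

lemma alg_local_energy: "local_energy n L a \<in> alg n (box (L + 1))"
  unfolding local_energy_def Let_def by (intro alg_intros)

lemma emb_local_energy:
  assumes "L0 < L"
  shows "opmult n (box L) (adj (emb n (box L0) (box L) (a :: ('a::finite) op))) (comm n (box L) (ham0 n L) (emb n (box L0) (box L) a))
    = emb n (box (L0 + 1)) (box L) (local_energy n L0 a)"
proof -
  have b: "box L0 \<subseteq> (box (L0 + 1) :: 'a site set)" "box (L0 + 1) \<subseteq> (box L :: 'a site set)"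
    using assms by (intro box_mono; simp)+
  show ?thesis
    unfolding comm_ham0_emb[OF assms] local_energy_def Let_def adj_emb
    by (simp only: emb_opmult[OF b(2) finite_box] emb_emb[OF b])
qed

lemma loc_state_local_energy:
  assumes "loc_state n \<omega>" "L0 < L"
  shows "\<omega> (box L) (opmult n (box L) (adj (emb n (box L0) (box L) a)) (comm n (box L) (ham0 n L) (emb n (box L0) (box L) a)))
    = \<omega> (box (L0 + 1)) (local_energy n L0 a)"
  unfolding emb_local_energy[OF assms(2)]
  using assms by (intro loc_state_emb alg_local_energy box_mono) auto

text \<open>The sequence in \<open>inf_gs\<close> is eventually constant by
  \<open>loc_state_local_energy\<close>. The condition thereby becomes a family of closed
  conditions, each on one local observable, and such conditions pass to weak-* limits.\<close>

lemma inf_gs_iff: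
  fixes \<omega> :: "('d::finite) site set \<Rightarrow> 'd op \<Rightarrow> complex"
  assumes \<omega>: "loc_state n \<omega>"
  shows "inf_gs n \<omega> \<longleftrightarrow> (\<forall>L a. a \<in> alg n (box L) \<longrightarrow> \<omega> (box (L + 1)) (local_energy n L a) \<in> \<real>\<^sub>\<ge>\<^sub>0)"
proof
  assume gs: "inf_gs n \<omega>"
  show "\<forall>L a. a \<in> alg n (box L) \<longrightarrow> \<omega> (box (L + 1)) (local_energy n L a) \<in> \<real>\<^sub>\<ge>\<^sub>0"
  proof (intro allI impI)
    fix L0 and a :: "'d op" assume a: "a \<in> alg n (box L0)"
    let ?s = "\<lambda>L. \<omega> (box L) (opmult n (box L) (adj (emb n (box L0) (box L) a)) (comm n (box L) (ham0 n L) (emb n (box L0) (box L) a)))"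
    from gs[unfolded inf_gs_def, rule_format, of "box L0" a] a
    obtain l where l: "l \<ge> 0" "?s \<longlonglongrightarrow> complex_of_real l"
      by (auto simp: Let_def comm_def)
    have "eventually (\<lambda>L. ?s L = \<omega> (box (L0 + 1)) (local_energy n L0 a)) sequentially"
      using eventually_gt_at_top[of L0] by eventually_elim (rule loc_state_local_energy[OF \<omega>])
    then have "?s \<longlonglongrightarrow> \<omega> (box (L0 + 1)) (local_energy n L0 a)" by (rule tendsto_eventually)
    from LIMSEQ_unique[OF this l(2)] l(1) show "\<omega> (box (L0 + 1)) (local_energy n L0 a) \<in> \<real>\<^sub>\<ge>\<^sub>0" by simp
  qed
next
  assume r: "\<forall>L a. a \<in> alg n (box L) \<longrightarrow> \<omega> (box (L + 1)) (local_energy n L a) \<in> \<real>\<^sub>\<ge>\<^sub>0"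
  show "inf_gs n \<omega>"
    unfolding inf_gs_def
  proof (intro allI impI)
    fix G and A :: "'d op" assume GA: "finite G \<and> A \<in> alg n G"
    then obtain L0 where L0: "G \<subseteq> box L0" using finite_subset_box by blast
    define a where "a = emb n G (box L0) A"
    have "a \<in> alg n (box L0)" unfolding a_def by (rule alg_emb)
    with r have "\<omega> (box (L0 + 1)) (local_energy n L0 a) \<in> \<real>\<^sub>\<ge>\<^sub>0" by blast
    then obtain l where l: "\<omega> (box (L0 + 1)) (local_energy n L0 a) = complex_of_real l" "l \<ge> 0"
      by (rule nonneg_Reals_cases)
    let ?s = "\<lambda>L. \<omega> (box L) (opmult n (box L) (adj (emb n G (box L) A)) (comm n (box L) (ham0 n L) (emb n G (box L) A)))"
    have "eventually (\<lambda>L. ?s L = complex_of_real l) sequentially"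
      using eventually_gt_at_top[of L0]
    proof eventually_elim
      case (elim L)
      then have "emb n G (box L) A = emb n (box L0) (box L) a"
        unfolding a_def using L0 by (simp add: emb_emb box_mono)
      then show ?case using loc_state_local_energy[OF \<omega> elim, of a] l(1) by simp
    qed
    then have "?s \<longlonglongrightarrow> complex_of_real l" by (rule tendsto_eventually)
    then show "\<exists>l::real. l \<ge> 0 \<and>
          (\<lambda>L. let a = emb n G (box L) A; H = ham0 n L :: 'd op
               in \<omega> (box L) (opmult n (box L) (adj a)
                      (\<lambda>\<sigma> \<tau>. opmult n (box L) H a \<sigma> \<tau> - opmult n (box L) a H \<sigma> \<tau>)))
          \<longlonglongrightarrow> complex_of_real l"
      using l(2) by (auto simp: Let_def comm_def)
  qed
qed

text \<open>Conjugating by the rank-one operators \<open>|\<phi>\<rangle>\<langle>t|\<close> replaces a state inside a region by \<open>\<phi>\<close>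
  and leaves it unchanged outside.\<close>

definition ket_bra :: "('d cfg \<Rightarrow> complex) \<Rightarrow> 'd cfg \<Rightarrow> 'd op" where
  "ket_bra \<phi> t = (\<lambda>\<sigma> \<tau>. if \<tau> = t then \<phi> \<sigma> else 0)"

lemma alg_ket_bra: "is_vec n G \<phi> \<Longrightarrow> t \<in> conf n G \<Longrightarrow> ket_bra \<phi> t \<in> alg n G"
  by (auto simp: ket_bra_def is_vec_def alg_def)

text \<open>Each term is the expectation of \<open>X\<close> times the projection onto the basis
  vector \<open>t\<close>, and these projections add up to the identity. Taking the identity for
  \<open>X\<close> gives the normalization required by \<open>state_on_transform\<close>.\<close>

lemma sum_ket_bra:
  assumes fin: "finite G"
  shows "(\<lambda>\<sigma> \<tau>. \<Sum>t\<in>conf n G. opmult n G (adj (ket_bra \<phi> t)) (opmult n G X (ket_bra \<phi> t)) \<sigma> \<tau>)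
    = (\<lambda>\<sigma> \<tau>. expect n G \<phi> X * ident n G \<sigma> \<tau>)"
proof (intro ext)
  fix \<sigma> \<tau>
  have "opmult n G (adj (ket_bra \<phi> t)) (opmult n G X (ket_bra \<phi> t)) \<sigma> \<tau> = (if t = \<sigma> then (if \<sigma> = \<tau> then expect n G \<phi> X else 0) else 0)" for t
    by (simp add: opmult_def adj_def ket_bra_def expect_def opapply_def)
  then show "(\<Sum>t\<in>conf n G. opmult n G (adj (ket_bra \<phi> t)) (opmult n G X (ket_bra \<phi> t)) \<sigma> \<tau>) = expect n G \<phi> X * ident n G \<sigma> \<tau>"
    using finite_conf[OF fin, of n] by (simp add: ident_def)
qed

lemma state_on_mono_energy:
  assumes f: "state_on n G f" and P: "P \<in> alg n G" "adj P = P"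
    and E: "\<And>v. E * (\<Sum>\<sigma>\<in>conf n G. (cmod (v \<sigma>))\<^sup>2) \<le> Re (qform (conf n G) P v)"
  shows "E \<le> Re (f P)"
proof -
  note fin = state_on_finite[OF f]
  let ?Q = "\<lambda>\<sigma> \<tau>. complex_of_real (- E) * ident n G \<sigma> \<tau> + P \<sigma> \<tau>"
  have "f ?Q \<in> \<real>\<^sub>\<ge>\<^sub>0"
  proof (rule state_on_psd[OF f])
    show "?Q \<in> alg n G" by (intro alg_intros P)
    have "adj ?Q = (\<lambda>\<sigma> \<tau>. complex_of_real (- E) * adj (ident n G) \<sigma> \<tau> + adj P \<sigma> \<tau>)"
      by (simp add: adj_def)
    then show "adj ?Q = ?Q" by (simp add: P(2))
    fix v show "0 \<le> Re (qform (conf n G) ?Q v)"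
      unfolding qform_linear using E[of v] by (simp add: qform_ident[OF fin] del: of_real_sum)
  qed
  moreover have "f ?Q = complex_of_real (- E) * 1 + f P"
    using state_on_linear[OF f alg_ident P(1), of "complex_of_real (- E)"] state_on_ident[OF f] by simp
  ultimately show ?thesis by (simp add: complex_nonneg_Reals_iff)
qed

lemma expect_linear: "expect n G \<Phi> (\<lambda>\<sigma> \<tau>. c * A \<sigma> \<tau> + B \<sigma> \<tau>) = c * expect n G \<Phi> A + expect n G \<Phi> B"
  by (simp add: expect_qform qform_linear)

lemma hamB_linear: "hamB n L B = (\<lambda>\<sigma> \<tau>. complex_of_real (- B) * stag n L \<sigma> \<tau> + ham0 n L \<sigma> \<tau>)"
  by (simp add: hamB_def)

text \<open>Replacing an infinite-volume ground state by \<open>\<phi>\<close> inside a box cannot lower the energy, and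
  only bonds crossing the boundary distinguish this from the periodic energy of the box.\<close>

lemma inf_gs_energy_upper:
  fixes \<omega> :: "('d::finite) site set \<Rightarrow> 'd op \<Rightarrow> complex" and \<phi> :: "'d cfg \<Rightarrow> complex"
  assumes C: "\<forall>G (f :: 'd op \<Rightarrow> complex). \<forall>x\<in>G. \<forall>y\<in>G. x \<noteq> y \<longrightarrow> state_on n G f \<longrightarrow> \<bar>Re (f (spin_dot n G x y))\<bar> \<le> C"
    and C0: "0 \<le> C" and \<omega>: "loc_state n \<omega>" "inf_gs n \<omega>" and L: "L \<ge> 1"
    and \<phi>: "is_vec n (box L) \<phi>" "(\<Sum>\<sigma>\<in>conf n (box L). (cmod (\<phi> \<sigma>))\<^sup>2) = 1"
  shows "Re (\<omega> (box L) (ham0 n L)) \<le> Re (expect n (box L) \<phi> (ham0 n L))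
    + C * (8 * CARD('d) * card (bdry L :: 'd site set))"
proof -
  \<comment> \<open>One layer more than \<open>L\<close>: the periodic Hamiltonian of this box
    contains every lattice bond that touches the inner box.\<close>
  define M where "M = L + 1"
  define a where "a = (\<lambda>t. emb n (box L) (box M) (ket_bra \<phi> t))"
  define f where "f = \<omega> (box M)"
  define f' where "f' = (\<lambda>X. \<Sum>t\<in>conf n (box L). f (opmult n (box M) (adj (a t)) (opmult n (box M) X (a t))))"
  have b: "box L \<subseteq> (box M :: 'd site set)" unfolding M_def by (rule box_mono) simp
  have LM: "L < M" by (simp add: M_def)
  have fin: "finite (box L :: 'd site set)" "finite (box M :: 'd site set)" by simp_all
  have f: "state_on n (box M) f" unfolding f_def by (rule state_on_loc_state[OF \<omega>(1) finite_box])
  have a_alg: "a t \<in> alg n (box M)" for t unfolding a_def by (rule alg_emb)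
  have expect_ident: "expect n (box L) \<phi> (ident n (box L)) = 1"
    using \<phi>(2) by (simp add: expect_qform qform_ident del: of_real_sum)
  have ket_alg: "ket_bra \<phi> t \<in> alg n (box L)" if "t \<in> conf n (box L)" for t
    using \<phi>(1) that by (rule alg_ket_bra)
  have one: "(\<lambda>\<sigma> \<tau>. \<Sum>t\<in>conf n (box L). opmult n (box M) (adj (a t)) (a t) \<sigma> \<tau>) = ident n (box M)"
  proof -
    have "(\<lambda>\<sigma> \<tau>. \<Sum>t\<in>conf n (box L). opmult n (box M) (adj (a t)) (a t) \<sigma> \<tau>)
      = emb n (box L) (box M) (\<lambda>\<sigma> \<tau>. \<Sum>t\<in>conf n (box L). opmult n (box L) (adj (ket_bra \<phi> t)) (opmult n (box L) (ident n (box L)) (ket_bra \<phi> t)) \<sigma> \<tau>)"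
      unfolding a_def adj_emb emb_sum emb_opmult[OF b fin(2)]
      by (intro ext sum.cong refl) (simp add: emb_opmult[OF b fin(2), symmetric] opmult_ident_left[OF fin(1) ket_alg])
    also have "\<dots> = emb n (box L) (box M) (ident n (box L))"
      unfolding sum_ket_bra[OF fin(1)] expect_ident by simp
    finally show ?thesis by (simp only: emb_ident[OF b])
  qed
  have f': "state_on n (box M) f'"
    unfolding f'_def by (rule state_on_transform[OF f a_alg one])
  have f'_emb: "f' (emb n (box L) (box M) X) = expect n (box L) \<phi> X" if X: "X \<in> alg n (box L)" for X
  proof -
    have "f' (emb n (box L) (box M) X) = (\<Sum>t\<in>conf n (box L). f (emb n (box L) (box M)
        (opmult n (box L) (adj (ket_bra \<phi> t)) (opmult n (box L) X (ket_bra \<phi> t)))))"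
      unfolding f'_def a_def adj_emb emb_opmult[OF b fin(2)] ..
    also have "\<dots> = f (emb n (box L) (box M) (\<lambda>\<sigma> \<tau>. \<Sum>t\<in>conf n (box L).
        opmult n (box L) (adj (ket_bra \<phi> t)) (opmult n (box L) X (ket_bra \<phi> t)) \<sigma> \<tau>))"
      unfolding emb_sum by (rule state_on_sum[OF f, symmetric]) (rule alg_emb)
    also have "\<dots> = expect n (box L) \<phi> X"
      unfolding sum_ket_bra[OF fin(1)] emb_scale emb_ident[OF b]
      using state_on_scale[OF f alg_ident] state_on_ident[OF f] by simp
    finally show ?thesis .
  qed
  define D where "D = (\<lambda>X. f' X - f X)"
  \<comment> \<open>Since the products of \<open>a t\<close> with its adjoint sum to the identity,
    the change of any expectation is a sum of expectations of commutators. For the Hamiltonian of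
    \<open>box M\<close> these are the quantities that the ground state condition makes
    nonnegative.\<close>
  have D_comm: "D X = (\<Sum>t\<in>conf n (box L). f (opmult n (box M) (adj (a t)) (comm n (box M) X (a t))))"
    if X: "X \<in> alg n (box M)" for X
  proof -
    have "f (opmult n (box M) (adj (a t)) (comm n (box M) X (a t))) =
      f (opmult n (box M) (adj (a t)) (opmult n (box M) X (a t))) - f (opmult n (box M) (opmult n (box M) (adj (a t)) (a t)) X)" for t
      unfolding comm_def opmult_diff_right opmult_assoc
      by (intro state_on_diff[OF f] alg_intros a_alg X)
    moreover have "(\<Sum>t\<in>conf n (box L). f (opmult n (box M) (opmult n (box M) (adj (a t)) (a t)) X)) = f X"
    proof -
      have "(\<Sum>t\<in>conf n (box L). f (opmult n (box M) (opmult n (box M) (adj (a t)) (a t)) X))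
        = f (opmult n (box M) (\<lambda>\<sigma> \<tau>. \<Sum>t\<in>conf n (box L). opmult n (box M) (adj (a t)) (a t) \<sigma> \<tau>) X)"
        unfolding opmult_sum_left by (intro state_on_sum[OF f, symmetric] alg_intros a_alg X)
      then show ?thesis unfolding one by (simp add: opmult_ident_left[OF fin(2) X])
    qed
    ultimately show ?thesis by (simp add: D_def f'_def sum_subtractf)
  qed
  have D_H: "0 \<le> Re (D (ham0 n M))"
  proof -
    have "f (opmult n (box M) (adj (a t)) (comm n (box M) (ham0 n M) (a t))) \<in> \<real>\<^sub>\<ge>\<^sub>0" if "t \<in> conf n (box L)" for t
    proof -
      have "\<omega> (box (L + 1)) (local_energy n L (ket_bra \<phi> t)) \<in> \<real>\<^sub>\<ge>\<^sub>0"
        using inf_gs_iff[OF \<omega>(1)] \<omega>(2) ket_alg[OF that] by blast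
      then show ?thesis unfolding local_energy_def Let_def f_def a_def M_def .
    qed
    then show ?thesis
      unfolding D_comm[OF alg_ham0] Re_sum by (intro sum_nonneg) (auto simp: complex_nonneg_Reals_iff)
  qed
  define h where "h = (\<lambda>p. spin_dot n (box M) (fst p) (snd p :: 'd site))"
  have h_alg: "h p \<in> alg n (box M)" for p unfolding h_def by (rule alg_spin_dot)
  have D_sum: "D (\<lambda>\<sigma> \<tau>. 1/2 * (\<Sum>p\<in>P. h p \<sigma> \<tau>)) = 1/2 * (\<Sum>p\<in>P. D (h p))" for P
    unfolding D_def sum_subtractf right_diff_distrib
    by (subst state_on_scale[OF f], intro alg_intros h_alg, subst state_on_scale[OF f'], intro alg_intros h_alg,
        subst state_on_sum[OF f], rule h_alg, subst state_on_sum[OF f'], rule h_alg) (rule refl)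
  \<comment> \<open>Bonds outside the inner box commute with each \<open>a t\<close>, so the
    modification is invisible to them.\<close>
  have D_out: "D (h p) = 0" if "p \<in> bonds M - touching L" for p
  proof -
    from that have p: "p \<in> bonds M" "fst p \<in> box M" "snd p \<in> box M" by (auto simp: bonds_def)
    have "p \<notin> {p \<in> bonds M. fst p \<in> box L \<or> snd p \<in> box L}"
      unfolding bonds_touching[OF LM] using that by simp
    then have "fst p \<notin> box L" "snd p \<notin> box L" using p(1) by auto
    then have "comm n (box M) (h p) (a t) = (\<lambda>\<sigma> \<tau>. 0)" for t
      unfolding h_def a_def using p by (intro comm_spin_dot_emb b fin)
    then show ?thesis
      unfolding D_comm[OF h_alg] by (simp add: opmult_zero_right state_on_zero[OF f])
  qed
  have t_sub: "touching L \<subseteq> (bonds M :: ('d site \<times> 'd site) set)"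
    unfolding bonds_touching[OF LM, symmetric] by auto
  have fin_t: "finite (touching L :: ('d site \<times> 'd site) set)" using t_sub by (rule finite_subset) simp
  have D1: "D (ham0 n M) = 1/2 * (\<Sum>p\<in>touching L. D (h p))"
  proof -
    have "D (ham0 n M) = 1/2 * (\<Sum>p\<in>bonds M. D (h p))"
      using D_sum[of "bonds M"] unfolding ham0_bonds h_def .
    also have "(\<Sum>p\<in>bonds M. D (h p)) = (\<Sum>p\<in>touching L. D (h p))"
      using D_out t_sub by (intro sum.mono_neutral_right) auto
    finally show ?thesis .
  qed
  have D2: "D (emb n (box L) (box M) (ham0 n L)) = 1/2 * (\<Sum>p\<in>bonds L. D (h p))"
  proof -
    have "emb n (box L) (box M) (spin_dot n (box L) (fst p) (snd p)) = h p" if "p \<in> bonds L" for p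
      using that unfolding h_def by (intro emb_spin_dot b fin) (auto simp: bonds_def)
    then have "emb n (box L) (box M) (ham0 n L) = (\<lambda>\<sigma> \<tau>. 1/2 * (\<Sum>p\<in>bonds L. h p \<sigma> \<tau>))"
      unfolding ham0_bonds emb_scale emb_sum by (intro ext) simp
    then show ?thesis by (simp only: D_sum)
  qed
  have D_bound: "\<bar>Re (D (h p))\<bar> \<le> 2 * C" if "p \<in> touching L \<union> bonds L" for p
  proof -
    have "fst p \<in> box M" "snd p \<in> box M" "fst p \<noteq> snd p"
      using that b touching_box[of p L] by (auto simp: M_def bonds_def pnn_def)
    from C[rule_format, OF this f] C[rule_format, OF this f'] show ?thesis unfolding D_def h_def by simp
  qed
  let ?S = "touching L :: ('d site \<times> 'd site) set" and ?T = "bonds L :: ('d site \<times> 'd site) set"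
  \<comment> \<open>The two half-sums run over \<open>touching L\<close> and \<open>bonds L\<close>,
    so all common bonds cancel. Each remaining ordered pair contributes at most
    \<open>2 * C\<close>, and the factor 1/2 leaves \<open>C\<close> times the number of
    pairs.\<close>
  have "Re (D (ham0 n M)) - Re (D (emb n (box L) (box M) (ham0 n L)))
     = 1/2 * ((\<Sum>p\<in>?S. Re (D (h p))) - (\<Sum>p\<in>?T. Re (D (h p))))"
    unfolding D1 D2 by simp
  also have "(\<Sum>p\<in>?S. Re (D (h p))) - (\<Sum>p\<in>?T. Re (D (h p))) =
     (\<Sum>p\<in>?S - ?T. Re (D (h p))) - (\<Sum>p\<in>?T - ?S. Re (D (h p)))"
    using sum.Int_Diff[OF fin_t, of "\<lambda>p. Re (D (h p))" ?T] sum.Int_Diff[OF finite_bonds, of "\<lambda>p. Re (D (h p))" L ?S]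
    by (simp add: Int_commute)
  also have "\<dots> \<le> (\<Sum>p\<in>?S - ?T. 2 * C) + (\<Sum>p\<in>?T - ?S. 2 * C)"
  proof -
    have "(\<Sum>p\<in>?S - ?T. Re (D (h p))) \<le> (\<Sum>p\<in>?S - ?T. 2 * C)"
      using D_bound by (intro sum_mono) (auto simp: abs_le_iff)
    moreover have "(\<Sum>p\<in>?T - ?S. - Re (D (h p))) \<le> (\<Sum>p\<in>?T - ?S. 2 * C)"
      using D_bound by (intro sum_mono) (auto simp: abs_le_iff)
    ultimately show ?thesis by (simp add: sum_negf)
  qed
  also have "\<dots> = 2 * C * real (card ((?S - ?T) \<union> (?T - ?S)))"
    using fin_t by (subst card_Un_disjoint) (auto simp: algebra_simps)
  also have "\<dots> \<le> 2 * C * real (8 * CARD('d) * card (bdry L :: 'd site set))"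
    using C0 card_sym_diff_pairs[OF L, where 'd = 'd] by (intro mult_left_mono of_nat_mono) auto
  finally have "0 \<le> Re (D (emb n (box L) (box M) (ham0 n L))) + C * real (8 * CARD('d) * card (bdry L :: 'd site set))"
    using D_H by simp
  moreover have "D (emb n (box L) (box M) (ham0 n L)) = expect n (box L) \<phi> (ham0 n L) - \<omega> (box L) (ham0 n L)"
    unfolding D_def f'_emb[OF alg_ham0] f_def loc_state_emb[OF \<omega>(1) fin(2) b alg_ham0] ..
  ultimately show ?thesis by simp
qed

text \<open>In both states the energy at field \<open>B\<close> is the zero-field energy minus
  \<open>B\<close> times the magnetization. Minimality of \<phi> bounds \<open>B\<close> times the
  difference of the magnetizations by the difference of the zero-field energies, a surface term.
  Later arguments rely on \<open>K\<close> being uniform in the box, the field and the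
  states.\<close>

lemma staggered_magnetization_upper:
  "\<exists>K. \<forall>L\<ge>1. \<forall>B>0. \<forall>\<omega> \<phi>. loc_state n \<omega> \<longrightarrow> inf_gs n \<omega> \<longrightarrow> ground_vec n (box L) (hamB n L B) \<phi> \<longrightarrow>
     Re (\<omega> (box L) (stag n L :: 'd op)) / real (card (box L :: ('d::finite) site set)) \<le> mag_density n L (\<phi> :: 'd cfg \<Rightarrow> complex) + K / (B * real L)"
proof -
  obtain C where C: "C \<ge> 0" and C': "\<forall>G (f :: 'd op \<Rightarrow> complex). \<forall>x\<in>G. \<forall>y\<in>G. x \<noteq> y \<longrightarrow> state_on n G f \<longrightarrow> \<bar>Re (f (spin_dot n G x y))\<bar> \<le> C"
    using state_on_spin_dot_bounded[where ?'d = 'd, of n] by (elim exE conjE) (rule that)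
  \<comment> \<open>One factor d comes from the count of surface pairs, the other from the ratio of
    surface to volume.\<close>
  define K where "K = C * 8 * CARD('d) * CARD('d)"
  show ?thesis
  proof (intro exI allI impI)
    fix L and B :: real and \<omega> :: "'d site set \<Rightarrow> 'd op \<Rightarrow> complex" and \<phi> :: "'d cfg \<Rightarrow> complex"
    assume L: "1 \<le> L" and B: "0 < B" and \<omega>: "loc_state n \<omega>" "inf_gs n \<omega>" and g: "ground_vec n (box L) (hamB n L B) \<phi>"
    obtain E where
      E: "\<forall>v :: 'd cfg \<Rightarrow> complex. E * (\<Sum>\<sigma>\<in>conf n (box L). (cmod (v \<sigma>))\<^sup>2) \<le> Re (qform (conf n (box L)) (hamB n L B) v)"
      "Re (expect n (box L) \<phi> (hamB n L B)) = E"
      by (rule ground_vec_variational[OF g adj_hamB finite_box]) (rule that)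
    from g have \<phi>: "is_vec n (box L) \<phi>" "(\<Sum>\<sigma>\<in>conf n (box L). (cmod (\<phi> \<sigma>))\<^sup>2) = 1"
      unfolding ground_vec_def by simp_all
    define N where "N = real (card (box L :: 'd site set))"
    have N0: "N > 0" using L by (simp add: N_def card_box)
    have st: "state_on n (box L) (\<omega> (box L))" by (rule state_on_loc_state[OF \<omega>(1) finite_box])
    have "E \<le> Re (\<omega> (box L) (hamB n L B))"
      by (rule state_on_mono_energy[OF st alg_hamB adj_hamB E(1)[rule_format]])
    also have "\<dots> = Re (\<omega> (box L) (ham0 n L)) - B * Re (\<omega> (box L) (stag n L))"
      unfolding hamB_linear state_on_linear[OF st alg_stag alg_ham0] by simp
    finally have 1: "B * Re (\<omega> (box L) (stag n L)) \<le> Re (\<omega> (box L) (ham0 n L)) - E" by simp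
    have 2: "E = Re (expect n (box L) \<phi> (ham0 n L)) - B * Re (expect n (box L) \<phi> (stag n L))"
      using E(2) unfolding hamB_linear expect_linear by simp
    have 3: "Re (\<omega> (box L) (ham0 n L)) \<le> Re (expect n (box L) \<phi> (ham0 n L)) + C * (8 * CARD('d) * card (bdry L :: 'd site set))"
      by (rule inf_gs_energy_upper[OF C' C \<omega> L \<phi>])
    have "real (card (bdry L :: 'd site set)) * real L \<le> real CARD('d) * N"
      unfolding N_def of_nat_mult[symmetric] of_nat_le_iff by (rule card_bdry)
    then have "real (card (bdry L :: 'd site set)) \<le> real CARD('d) * N / real L"
      using L by (simp add: field_simps)
    then have "C * (8 * CARD('d)) * real (card (bdry L :: 'd site set)) \<le> C * (8 * CARD('d)) * (real CARD('d) * N / real L)"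
      using C by (intro mult_left_mono) auto
    then have 4: "C * (8 * CARD('d) * card (bdry L :: 'd site set)) \<le> K * N / real L"
      by (simp add: K_def mult_ac)
    have "B * Re (\<omega> (box L) (stag n L)) \<le> B * Re (expect n (box L) \<phi> (stag n L)) + K * N / real L"
      using 1 2 3 4 by linarith
    then have "Re (\<omega> (box L) (stag n L)) \<le> Re (expect n (box L) \<phi> (stag n L)) + K * N / (B * real L)"
      using B L by (simp add: field_simps)
    then have "Re (\<omega> (box L) (stag n L)) / N \<le> (Re (expect n (box L) \<phi> (stag n L)) + K * N / (B * real L)) / N"
      using N0 by (intro divide_right_mono) auto
    also have "\<dots> = mag_density n L \<phi> + K / (B * real L)"
      using N0 by (simp add: mag_density_def N_def[symmetric] add_divide_distrib)
    finally show "Re (\<omega> (box L) (stag n L)) / real (card (box L :: 'd site set)) \<le> mag_density n L \<phi> + K / (B * real L)"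
      by (simp add: N_def)
  qed
qed

section \<open>Translation invariance\<close>

text \<open>The expectation of the third spin component, which is diagonal in the configuration
  basis with eigenvalue S - k, where S = n/2.\<close>

definition site_mag :: "nat \<Rightarrow> nat \<Rightarrow> (('d::finite) cfg \<Rightarrow> complex) \<Rightarrow> 'd site \<Rightarrow> real" where
  "site_mag n L \<Phi> x = (\<Sum>\<sigma>\<in>conf n (box L). (cmod (\<Phi> \<sigma>))\<^sup>2 * (real n / 2 - real (\<sigma> x)))"

lemma expect_spin3:
  assumes "x \<in> box L"
  shows "expect n (box L) \<Phi> (site_op n (box L) x (spin_mat n 3)) = complex_of_real (site_mag n L \<Phi> x)"
proof -
  have *: "site_op n (box L) x (spin_mat n 3) \<sigma> \<tau> = (if \<tau> = \<sigma> then complex_of_real (real n / 2 - real (\<sigma> x)) else 0)"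
    if "\<sigma> \<in> conf n (box L)" "\<tau> \<in> conf n (box L)" for \<sigma> \<tau>
  proof (cases "\<tau> = \<sigma>")
    case True
    moreover have "\<sigma> x \<le> n" using that assms by (simp add: conf_def)
    ultimately show ?thesis using that by (simp add: site_op_def spin_mat_def)
  next
    case False
    have "\<sigma> x \<noteq> \<tau> x" if "\<forall>y. y \<noteq> x \<longrightarrow> \<sigma> y = \<tau> y"
    proof
      assume "\<sigma> x = \<tau> x"
      with that have "\<sigma> = \<tau>" by (intro ext) metis
      with False show False by simp
    qed
    then show ?thesis using False by (auto simp: site_op_def spin_mat_def)
  qed
  have "opapply n (box L) (site_op n (box L) x (spin_mat n 3)) \<Phi> \<sigma> = complex_of_real (real n / 2 - real (\<sigma> x)) * \<Phi> \<sigma>"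
    if "\<sigma> \<in> conf n (box L)" for \<sigma>
  proof -
    have "opapply n (box L) (site_op n (box L) x (spin_mat n 3)) \<Phi> \<sigma> =
      (\<Sum>\<tau>\<in>conf n (box L). if \<tau> = \<sigma> then complex_of_real (real n / 2 - real (\<sigma> x)) * \<Phi> \<tau> else 0)"
      unfolding opapply_def by (intro sum.cong refl) (simp add: *[OF that])
    also have "\<dots> = complex_of_real (real n / 2 - real (\<sigma> x)) * \<Phi> \<sigma>"
      using that by (subst sum.delta[OF finite_conf[OF finite_box]]) (simp only: if_True)
    finally show ?thesis .
  qed
  then have "expect n (box L) \<Phi> (site_op n (box L) x (spin_mat n 3)) =
    (\<Sum>\<sigma>\<in>conf n (box L). complex_of_real ((cmod (\<Phi> \<sigma>))\<^sup>2 * (real n / 2 - real (\<sigma> x))))"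
    unfolding expect_def
    by (intro sum.cong refl) (simp add: complex_norm_square mult_ac del: of_real_power of_real_diff)
  then show ?thesis by (simp add: site_mag_def)
qed

lemma vstate_stag:
  assumes "L' \<le> L"
  shows "vstate n L \<Phi> (box L') (stag n L') = (\<Sum>x\<in>box L'. stsign x * complex_of_real (site_mag n L \<Phi> x))"
proof -
  have lin: "qform I (\<lambda>\<sigma> \<tau>. \<Sum>x\<in>X. c x * A x \<sigma> \<tau>) v = (\<Sum>x\<in>X. c x * qform I (A x) v)"
    for I X c v and A :: "_ \<Rightarrow> _ \<Rightarrow> _ \<Rightarrow> complex"
  proof (induction X rule: infinite_finite_induct)
    case (insert x X)
    then show ?case using qform_linear[of I "c x" "A x" "\<lambda>\<sigma> \<tau>. \<Sum>x\<in>X. c x * A x \<sigma> \<tau>" v] by simp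
  qed (simp_all add: qform_def)
  have "vstate n L \<Phi> (box L') (stag n L') = (\<Sum>x\<in>box L'. stsign x * expect n (box L) \<Phi> (site_op n (box L) x (spin_mat n 3)))"
    unfolding vstate_def emb_stag_sum[OF assms] expect_qform lin ..
  also have "\<dots> = (\<Sum>x\<in>box L'. stsign x * complex_of_real (site_mag n L \<Phi> x))"
    using box_mono[OF assms] by (intro sum.cong refl) (auto simp: expect_spin3)
  finally show ?thesis .
qed

section \<open>Periodic translations by two sites\<close>

lemma wrap_id: "- int L + 1 \<le> z \<Longrightarrow> z \<le> int L \<Longrightarrow> wrap L z = z"
  by (simp add: wrap_def)

lemma wrap_range: "L \<ge> 1 \<Longrightarrow> - int L + 1 \<le> wrap L z \<and> wrap L z \<le> int L"
proof -
  assume "L \<ge> 1"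
  then have "0 \<le> (z + int L - 1) mod (2 * int L)" "(z + int L - 1) mod (2 * int L) < 2 * int L"
    by (simp_all add: pos_mod_bound)
  then show ?thesis unfolding wrap_def by linarith
qed

lemma wrap_wrap: "wrap L (wrap L (z - a) + a) = wrap L z"
proof -
  have "((z - a + int L - 1) mod (2 * int L) - int L + 1 + a + int L - 1) mod (2 * int L)
    = ((z - a + int L - 1) mod (2 * int L) + a) mod (2 * int L)" by (simp add: algebra_simps)
  also have "\<dots> = (z - a + int L - 1 + a) mod (2 * int L)" by (rule mod_add_left_eq)
  also have "\<dots> = (z + int L - 1) mod (2 * int L)" by (simp add: algebra_simps)
  finally show ?thesis by (simp add: wrap_def)
qed

text \<open>\<open>wrap_wrap\<close> recovers each value of a configuration from its translate,
  which gives injectivity; surjectivity follows by finiteness.\<close>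

lemma bij_translate:
  assumes L: "L \<ge> 1"
  shows "bij_betw (translate L a) (conf n (box L)) (conf n (box L))"
proof -
  have maps: "translate L a \<sigma> \<in> conf n (box L)" if "\<sigma> \<in> conf n (box L)" for \<sigma>
  proof -
    have "\<sigma> y \<le> n" for y using that by (cases "y \<in> box L") (auto simp: conf_def)
    then show ?thesis by (simp add: conf_def translate_def)
  qed
  have inj: "inj_on (translate L a) (conf n (box L))"
  proof (rule inj_onI)
    fix \<sigma> \<tau> assume st: "\<sigma> \<in> conf n (box L)" "\<tau> \<in> conf n (box L)" and eq: "translate L a \<sigma> = translate L a \<tau>"
    show "\<sigma> = \<tau>"
    proof
      fix y show "\<sigma> y = \<tau> y"
      proof (cases "y \<in> box L")
        case False
        then show ?thesis using st by (simp add: conf_def)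
      next
        case True
        define x where "x = (\<lambda>i. wrap L (y i - a i))"
        have x: "x \<in> box L" using wrap_range[OF L] by (simp add: x_def box_def)
        have "(\<lambda>i. wrap L (x i + a i)) = y"
          using True by (intro ext) (simp add: x_def wrap_wrap wrap_id box_def)
        with fun_cong[OF eq, of x] x show ?thesis by (simp add: translate_def)
      qed
    qed
  qed
  have fin: "finite (conf n (box L))" by (rule finite_conf) simp
  have "translate L a ` conf n (box L) = conf n (box L)"
    by (rule endo_inj_surj[OF fin _ inj]) (use maps in auto)
  with inj show ?thesis by (simp add: bij_betw_def)
qed

lemma site_mag_shift:
  fixes \<Phi> :: "('d::finite) cfg \<Rightarrow> complex"
  assumes L: "L \<ge> 1" and t: "trans_inv2 n L \<Phi>" and x: "x \<in> box L" "x(i := x i + 2) \<in> box L"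
  shows "site_mag n L \<Phi> x = site_mag n L \<Phi> (x(i := x i + 2))"
proof -
  let ?T = "translate L (\<lambda>j::'d. if j = i then 2 else 0)"
  have w: "(\<lambda>j. wrap L (x j + (if j = i then 2 else 0))) = x(i := x i + 2)"
  proof
    fix j
    have "- int L + 1 \<le> (x(i := x i + 2)) j \<and> (x(i := x i + 2)) j \<le> int L" using x(2) unfolding box_def by blast
    then show "wrap L (x j + (if j = i then 2 else 0)) = (x(i := x i + 2)) j"
      by (cases "j = i") (simp_all add: wrap_id)
  qed
  have "site_mag n L \<Phi> x = (\<Sum>\<sigma>\<in>conf n (box L). (cmod (\<Phi> (?T \<sigma>)))\<^sup>2 * (real n / 2 - real (?T \<sigma> x)))"
    unfolding site_mag_def
    by (rule sum.reindex_bij_betw[OF bij_translate[OF L], symmetric])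
  also have "\<dots> = site_mag n L \<Phi> (x(i := x i + 2))"
    unfolding site_mag_def
  proof (intro sum.cong refl)
    fix \<sigma> :: "'d cfg" assume "\<sigma> \<in> conf n (box L)"
    then have "\<Phi> (?T \<sigma>) = \<Phi> \<sigma>" using t unfolding trans_inv2_def by blast
    moreover have "?T \<sigma> x = \<sigma> (x(i := x i + 2))" unfolding translate_def w using x(1) by simp
    ultimately show "(cmod (\<Phi> (?T \<sigma>)))\<^sup>2 * (real n / 2 - real (?T \<sigma> x)) = (cmod (\<Phi> \<sigma>))\<^sup>2 * (real n / 2 - real (\<sigma> (x(i := x i + 2))))"
      by simp
  qed
  finally show ?thesis .
qed

text \<open>The representative of a site modulo 2 in each coordinate. \<open>box 1\<close> is
  exactly the set of sites with all coordinates 0 or 1.\<close>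

definition cell :: "('d \<Rightarrow> int) \<Rightarrow> 'd \<Rightarrow> int" where
  "cell x = (\<lambda>i. x i mod 2)"

lemma cell_box: "cell x \<in> box 1"
proof -
  have "0 \<le> x i mod 2" "x i mod 2 < 2" for i by simp_all
  then have "- int 1 + 1 \<le> x i mod 2 \<and> x i mod 2 \<le> int 1" for i by (smt (verit) of_nat_1)
  then show ?thesis unfolding cell_def box_def by blast
qed

lemma cell_update: "cell (x(i := x i + 2)) = cell x"
  by (auto simp: cell_def fun_eq_iff)

lemma site_mag_cell:
  assumes L: "L \<ge> 1" and t: "trans_inv2 n L \<Phi>" and x: "x \<in> box L"
  shows "site_mag n L \<Phi> x = site_mag n L \<Phi> (cell x)"
  using x
\<comment> \<open>The measure is symmetric about 1/2 and minimal exactly when all coordinates are 0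
  or 1. Steps of length two towards these values decrease it and never leave the box, so
  \<open>site_mag_shift\<close> applies without wrapping around.\<close>
proof (induction "\<Sum>i\<in>UNIV. nat \<bar>2 * x i - 1\<bar>" arbitrary: x rule: less_induct)
  case less
  have xb: "- int L + 1 \<le> x i \<and> x i \<le> int L" for i using less.prems by (simp add: box_def)
  have dec: "(\<Sum>j\<in>UNIV. nat \<bar>2 * (x(i := v)) j - 1\<bar>) < (\<Sum>j\<in>UNIV. nat \<bar>2 * x j - 1\<bar>)"
    if "\<bar>2 * v - 1\<bar> < \<bar>2 * x i - 1\<bar>" for i v
  proof (rule sum_strict_mono_ex1)
    show "\<forall>j\<in>UNIV. nat \<bar>2 * (x(i := v)) j - 1\<bar> \<le> nat \<bar>2 * x j - 1\<bar>" using that by auto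
    show "\<exists>j\<in>UNIV. nat \<bar>2 * (x(i := v)) j - 1\<bar> < nat \<bar>2 * x j - 1\<bar>" using that by (intro bexI[of _ i]) auto
  qed simp
  have upd: "x(i := v) \<in> box L" if "- int L + 1 \<le> v" "v \<le> int L" for i v
    using xb that by (simp add: box_def)
  consider "\<forall>i. x i = 0 \<or> x i = 1" | i where "x i \<ge> 2" | i where "x i \<le> -1"
  proof -
    have "x i \<ge> 2 \<or> x i \<le> -1 \<or> x i = 0 \<or> x i = 1" for i by linarith
    with that show thesis by blast
  qed
  then show ?case
  proof cases
    case 1
    have "x i mod 2 = x i" for i using 1[rule_format, of i] by (elim disjE) simp_all
    then have "cell x = x" by (simp add: cell_def)
    then show ?thesis by simp
  next
    case (2 i)
    define y where "y = x(i := x i - 2)"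
    have yb: "y \<in> box L" unfolding y_def by (rule upd) (use 2 xb[of i] L in linarith)+
    have xy: "y(i := y i + 2) = x" by (simp add: y_def)
    have "site_mag n L \<Phi> y = site_mag n L \<Phi> x"
      using site_mag_shift[OF L t yb, of i] less.prems by (simp add: xy)
    moreover have "site_mag n L \<Phi> y = site_mag n L \<Phi> (cell y)"
      by (rule less.hyps[OF _ yb]) (use dec[of "x i - 2" i] 2 in \<open>simp add: y_def\<close>)
    ultimately show ?thesis using cell_update[of y i] by (simp add: xy)
  next
    case (3 i)
    define y where "y = x(i := x i + 2)"
    have yb: "y \<in> box L" unfolding y_def by (rule upd) (use 3 xb[of i] L in linarith)+
    have "site_mag n L \<Phi> x = site_mag n L \<Phi> y"
      using site_mag_shift[OF L t less.prems, of i] yb by (simp add: y_def)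
    moreover have "site_mag n L \<Phi> y = site_mag n L \<Phi> (cell y)"
      by (rule less.hyps[OF _ yb]) (use dec[of "x i + 2" i] 3 in \<open>simp add: y_def\<close>)
    ultimately show ?thesis using cell_update[of x i] by (simp add: y_def)
  qed
qed

lemma stsign_cell: "stsign (cell x) = stsign x"
proof -
  have "(\<Sum>i\<in>UNIV. x i) = (\<Sum>i\<in>UNIV. cell x i) + 2 * (\<Sum>i\<in>UNIV. x i div 2)"
    unfolding sum_distrib_left sum.distrib[symmetric] cell_def by (intro sum.cong refl) simp
  then show ?thesis by (simp add: stsign_def)
qed

lemma card_parity_class:
  fixes e :: int
  assumes "e = 0 \<or> e = 1"
  shows "card {z \<in> {- int L + 1..int L}. z mod 2 = e} = L"
proof (induction L)
  case 0
  then show ?case by simp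
next
  case (Suc L)
  \<comment> \<open>The larger interval gains \<open>- int L\<close> and \<open>int L + 1\<close>.
    Their sum is odd, so exactly one of them has parity \<open>e\<close>.\<close>
  define w where "w = (if (int L) mod 2 = e then - int L else int L + 1)"
  have m: "(- int L) mod 2 = (int L) mod 2" "(int L + 1) mod 2 = 1 - (int L) mod 2" by presburger+
  have par: "int L mod 2 = 0 \<or> int L mod 2 = 1" by presburger
  have "{z \<in> {- int (Suc L) + 1..int (Suc L)}. z mod 2 = e} = insert w {z \<in> {- int L + 1..int L}. z mod 2 = e}"
  proof (intro set_eqI)
    fix z
    have "z \<in> {- int (Suc L) + 1..int (Suc L)} \<longleftrightarrow> z = - int L \<or> z = int L + 1 \<or> z \<in> {- int L + 1..int L}" by auto
    moreover have "(z = - int L \<or> z = int L + 1) \<and> z mod 2 = e \<longleftrightarrow> z = w"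
      using assms m par by (cases "int L mod 2 = e") (auto simp: w_def)
    ultimately show "z \<in> {z \<in> {- int (Suc L) + 1..int (Suc L)}. z mod 2 = e} \<longleftrightarrow> z \<in> insert w {z \<in> {- int L + 1..int L}. z mod 2 = e}"
      by blast
  qed
  moreover have "w \<notin> {z \<in> {- int L + 1..int L}. z mod 2 = e}" by (auto simp: w_def split: if_splits)
  moreover have "finite {z \<in> {- int L + 1..int L}. z mod 2 = e}"
    by (rule finite_subset[of _ "{- int L + 1..int L}"]) auto
  ultimately show ?case
    using card_insert_disjoint[of "{z \<in> {- int L + 1..int L}. z mod 2 = e}" w] Suc.IH by presburger
qed

lemma card_cell:
  assumes "c \<in> box 1"
  shows "card {x \<in> (box L :: ('d::finite) site set). cell x = c} = L ^ CARD('d)"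
proof -
  have c: "c i = 0 \<or> c i = 1" for i
  proof -
    have "0 \<le> c i \<and> c i \<le> 1" using assms by (simp add: box_def)
    then show ?thesis by linarith
  qed
  have "{x \<in> (box L :: 'd site set). cell x = c} = PiE UNIV (\<lambda>i. {z \<in> {- int L + 1..int L}. z mod 2 = c i})"
    by (auto simp: box_def cell_def PiE_def Pi_def fun_eq_iff)
  then show ?thesis by (simp only: card_PiE finite card_parity_class[OF c] prod_constant)
qed

text \<open>Boxes have even side length, so each parity class fills the same fraction of every box.
  Hence the right-hand side does not involve \<open>L'\<close>.\<close>

lemma vstate_stag_cell:
  assumes L: "1 \<le> L'" "L' \<le> L" and t: "trans_inv2 n L (\<Phi> :: ('d::finite) cfg \<Rightarrow> complex)"
  shows "vstate n L \<Phi> (box L') (stag n L') / of_nat (card (box L' :: 'd site set))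
    = (\<Sum>c\<in>box 1. stsign c * complex_of_real (site_mag n L \<Phi> c)) / 2 ^ CARD('d)"
proof -
  let ?g = "\<lambda>c. stsign c * complex_of_real (site_mag n L \<Phi> c)"
  have "vstate n L \<Phi> (box L') (stag n L') = (\<Sum>x\<in>box L'. ?g (cell x))"
    unfolding vstate_stag[OF L(2)] using box_mono[OF L(2)] L
    by (intro sum.cong refl) (auto simp: stsign_cell site_mag_cell[OF _ t])
  also have "\<dots> = (\<Sum>c\<in>box 1. \<Sum>x\<in>{x \<in> box L'. cell x = c}. ?g (cell x))"
    by (rule sum.group[symmetric]) (auto simp: cell_box[unfolded One_nat_def])
  also have "\<dots> = (\<Sum>c\<in>(box 1 :: 'd site set). of_nat (L' ^ CARD('d)) * ?g c)"
    by (intro sum.cong refl) (simp add: card_cell)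
  also have "\<dots> = of_nat (L' ^ CARD('d)) * (\<Sum>c\<in>box 1. ?g c)" by (rule sum_distrib_left[symmetric])
  finally show ?thesis
    using L(1) by (simp add: card_box power_mult_distrib)
qed

text \<open>Weak-* limits see only fixed boxes, while the density is taken over a box that grows.
  This identity reads the density off a fixed box.\<close>

lemma mag_density_vstate:
  assumes L: "1 \<le> L'" "L' \<le> L" and t: "trans_inv2 n L (\<Phi> :: ('d::finite) cfg \<Rightarrow> complex)"
  shows "mag_density n L \<Phi> = Re (vstate n L \<Phi> (box L') (stag n L')) / real (card (box L' :: 'd site set))"
proof -
  have "vstate n L \<Phi> (box L) (stag n L) / of_nat (card (box L :: 'd site set))
    = vstate n L \<Phi> (box L') (stag n L') / of_nat (card (box L' :: 'd site set))"
    using vstate_stag_cell[OF L t] vstate_stag_cell[of L L, OF _ _ t] L by simp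
  then have "Re (vstate n L \<Phi> (box L) (stag n L) / of_nat (card (box L :: 'd site set)))
    = Re (vstate n L \<Phi> (box L') (stag n L') / of_nat (card (box L' :: 'd site set)))" by simp
  moreover have "vstate n L \<Phi> (box L) (stag n L) = expect n (box L) \<Phi> (stag n L)"
    unfolding vstate_def by (simp add: emb_id alg_stag)
  ultimately show ?thesis by (simp add: mag_density_def Re_divide_of_nat)
qed

lemma mag_density_bounded:
  assumes "1 \<le> L" "(\<Sum>\<sigma>\<in>conf n (box L). (cmod (\<Phi> \<sigma>))\<^sup>2) = 1"
  shows "\<bar>mag_density n L (\<Phi> :: ('d::finite) cfg \<Rightarrow> complex)\<bar> \<le> real n"
proof -
  have s: "\<bar>site_mag n L \<Phi> x\<bar> \<le> real n" if "x \<in> box L" for x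
  proof -
    have "\<bar>site_mag n L \<Phi> x\<bar> \<le> (\<Sum>\<sigma>\<in>conf n (box L). (cmod (\<Phi> \<sigma>))\<^sup>2 * real n)"
      unfolding site_mag_def
    proof (rule order_trans[OF sum_abs], rule sum_mono)
      fix \<sigma> :: "'d cfg" assume "\<sigma> \<in> conf n (box L)"
      then have "\<sigma> x \<le> n" using that by (simp add: conf_def)
      then have "\<bar>real n / 2 - real (\<sigma> x)\<bar> \<le> real n" by auto
      then show "\<bar>(cmod (\<Phi> \<sigma>))\<^sup>2 * (real n / 2 - real (\<sigma> x))\<bar> \<le> (cmod (\<Phi> \<sigma>))\<^sup>2 * real n"
        by (simp add: abs_mult mult_left_mono)
    qed
    also have "\<dots> = real n" using assms(2) by (simp flip: sum_distrib_right)
    finally show ?thesis .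
  qed
  have "\<bar>Re (vstate n L \<Phi> (box L) (stag n L))\<bar> \<le> (\<Sum>x\<in>(box L :: 'd site set). real n)"
    unfolding vstate_stag[OF order_refl] Re_sum
    by (rule order_trans[OF sum_abs], rule sum_mono) (use s in \<open>auto simp: stsign_def\<close>)
  then have "\<bar>Re (expect n (box L) \<Phi> (stag n L))\<bar> \<le> real (card (box L :: 'd site set)) * real n"
    unfolding vstate_def by (simp add: emb_id alg_stag)
  then show ?thesis
    using assms(1) by (simp add: mag_density_def card_box field_simps)
qed

section \<open>Cluster points of ground states\<close>

text \<open>The states live in a product over uncountably many local operators, which need not be
  sequentially compact. A filter finer than \<open>sequentially\<close> replaces the subsequence;
  limits along it are still unique in Hausdorff spaces and preserve inequalities.\<close>

lemma cluster_filter: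
  fixes f :: "nat \<Rightarrow> 'a::topological_space"
  assumes "compact K" "\<And>k. f k \<in> K"
  obtains F g where "F \<noteq> bot" "F \<le> sequentially" "(f \<longlongrightarrow> g) F"
proof -
  have "filtermap f sequentially \<noteq> bot" "eventually (\<lambda>x. x \<in> K) (filtermap f sequentially)"
    using assms(2) by (auto simp: filtermap_bot_iff eventually_filtermap)
  with assms(1) obtain g where g: "inf (nhds g) (filtermap f sequentially) \<noteq> bot"
    unfolding compact_filter by blast
  define F where "F = inf sequentially (filtercomap f (nhds g))"
  have "F \<noteq> bot"
  proof
    assume "F = bot"
    then have "eventually (\<lambda>_. False) (inf sequentially (filtercomap f (nhds g)))" by (simp add: F_def)
    then obtain P Q where PQ: "eventually P sequentially" "eventually Q (filtercomap f (nhds g))" "\<And>k. P k \<and> Q k \<Longrightarrow> False"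
      unfolding eventually_inf by blast
    from PQ(2) obtain R where R: "eventually R (nhds g)" "\<And>k. R (f k) \<Longrightarrow> Q k"
      unfolding eventually_filtercomap by blast
    have "eventually (\<lambda>x. \<not> R x) (filtermap f sequentially)"
      unfolding eventually_filtermap using PQ(1) by eventually_elim (use PQ(3) R(2) in blast)
    with R(1) have "eventually (\<lambda>_. False) (inf (nhds g) (filtermap f sequentially))"
      unfolding eventually_inf by (intro exI[of _ R] exI[of _ "\<lambda>x. \<not> R x"]) auto
    with g show False by (simp add: trivial_limit_def)
  qed
  moreover have "F \<le> sequentially" by (simp add: F_def)
  moreover have "(f \<longlongrightarrow> g) F"
    unfolding filterlim_iff_le_filtercomap F_def by simp
  ultimately show thesis using that by blast
qed

lemma vstate_linear:
  "vstate n L \<Phi> G (\<lambda>\<sigma> \<tau>. c * A \<sigma> \<tau> + B \<sigma> \<tau>) = c * vstate n L \<Phi> G A + vstate n L \<Phi> G B"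
  by (simp add: vstate_def emb_add emb_scale expect_linear)

lemma state_on_vstate:
  assumes "G \<subseteq> box L" "(\<Sum>\<sigma>\<in>conf n (box L). (cmod (\<Phi> \<sigma>))\<^sup>2) = 1"
  shows "state_on n G (vstate n L \<Phi> G)"
  using state_on_emb[OF state_on_expect[OF finite_box assms(2)] assms(1)] unfolding vstate_def .

lemma vstate_emb: "G \<subseteq> G' \<Longrightarrow> G' \<subseteq> box L \<Longrightarrow> vstate n L \<Phi> G' (emb n G G' A) = vstate n L \<Phi> G A"
  by (simp add: vstate_def emb_emb)

text \<open>The lower bounds \<open>cs\<close> may vary with \<open>k\<close>: constant bounds give
  the upper estimate near zero field, and bounds converging to the supremum show that it is
  attained.\<close>

lemma cluster_ground_state:
  fixes \<Phi> :: "nat \<Rightarrow> ('d::finite) cfg \<Rightarrow> complex"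
  assumes Ls: "filterlim Ls at_top sequentially" and Bs: "Bs \<longlonglongrightarrow> 0"
    and g: "\<And>k. ground_vec n (box (Ls k)) (hamB n (Ls k) (Bs k)) (\<Phi> k)"
    and t: "\<And>k. trans_inv2 n (Ls k) (\<Phi> k)"
    and cs: "cs \<longlonglongrightarrow> c" "\<And>k. cs k \<le> mag_density n (Ls k) (\<Phi> k)"
  obtains \<omega> :: "'d site set \<Rightarrow> 'd op \<Rightarrow> complex" and s where "loc_state n \<omega>" "inf_gs n \<omega>" "c \<le> s"
    "\<forall>L\<ge>1. Re (\<omega> (box L) (stag n L)) / real (card (box L :: 'd site set)) = s"
proof -
  have nrm: "(\<Sum>\<sigma>\<in>conf n (box (Ls k)). (cmod (\<Phi> k \<sigma>))\<^sup>2) = 1" for k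
    using g[of k] unfolding ground_vec_def by simp
  \<comment> \<open>The value 0 while the box does not yet contain \<open>G\<close> keeps every
    coordinate in its compact disc. It leaves limits along \<open>F\<close> unaffected, since the
    boxes eventually contain any finite \<open>G\<close>.\<close>
  define f :: "nat \<Rightarrow> 'd site set \<times> 'd op \<Rightarrow> complex" where
    "f = (\<lambda>k (G, A). if A \<in> alg n G \<and> G \<subseteq> box (Ls k) then vstate n (Ls k) (\<Phi> k) G A else 0)"
  define K where "K = (\<lambda>(G, A). cball (0::complex) (2 * opsum n G (A :: 'd op)))"
  have "f k p \<in> K p" for k p
  proof -
    obtain G A where p: "p = (G, A)" by force
    have "0 \<le> opsum n G A" by (simp add: opsum_def sum_nonneg)
    then show ?thesis
      using state_on_bound[OF state_on_vstate[OF _ nrm[of k]], of G A] by (auto simp: f_def K_def p)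
  qed
  then have fK: "f k \<in> {h. \<forall>p. h p \<in> K p}" for k by simp
  have "compact {h. \<forall>p. h p \<in> K p}"
    by (rule compact_product) (auto simp: K_def split: prod.splits)
  then obtain F h where F: "F \<noteq> bot" "F \<le> sequentially" "(f \<longlongrightarrow> h) F"
    by (rule cluster_filter[OF _ fK]) (rule that)
  define \<omega> where "\<omega> = (\<lambda>G A. h (G, A))"
  have sub: "eventually (\<lambda>k. G \<subseteq> box (Ls k)) F" if "finite G" for G :: "'d site set"
  proof -
    from that obtain L0 where L0: "G \<subseteq> box L0" by (rule finite_subset_box)
    have "eventually (\<lambda>k. L0 \<le> Ls k) F"
      using Ls F(2) unfolding filterlim_at_top by (auto dest: filter_leD)
    then show ?thesis by eventually_elim (use L0 box_mono in blast)
  qed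
  have large: "eventually (\<lambda>k. L < Ls k) F" for L
  proof -
    have "eventually (\<lambda>k. Suc L \<le> Ls k) F"
      using Ls F(2) unfolding filterlim_at_top by (auto dest: filter_leD)
    then show ?thesis by (rule eventually_mono) simp
  qed
  have conv: "((\<lambda>k. vstate n (Ls k) (\<Phi> k) G A) \<longlongrightarrow> \<omega> G A) F" if "finite G" "A \<in> alg n G" for G A
  proof -
    have "((\<lambda>k. f k (G, A)) \<longlongrightarrow> h (G, A)) F"
      by (rule continuous_on_tendsto_compose[OF continuous_on_product_coordinates[of "(G, A)"] F(3)]) simp_all
    then have "((\<lambda>k. f k (G, A)) \<longlongrightarrow> \<omega> G A) F" by (simp add: \<omega>_def)
    then show ?thesis
      by (rule Lim_transform_eventually)
        (use sub[OF that(1)] in eventually_elim, use that in \<open>simp add: f_def\<close>)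
  qed
  have loc: "loc_state n \<omega>"
    unfolding loc_state_def
  proof (intro conjI allI impI)
    fix G and A B :: "'d op" and c assume a: "finite G \<and> A \<in> alg n G \<and> B \<in> alg n G"
    have "((\<lambda>k. vstate n (Ls k) (\<Phi> k) G (\<lambda>\<sigma> \<tau>. c * A \<sigma> \<tau> + B \<sigma> \<tau>)) \<longlongrightarrow> \<omega> G (\<lambda>\<sigma> \<tau>. c * A \<sigma> \<tau> + B \<sigma> \<tau>)) F"
      using a by (intro conv alg_intros) auto
    moreover have "((\<lambda>k. vstate n (Ls k) (\<Phi> k) G (\<lambda>\<sigma> \<tau>. c * A \<sigma> \<tau> + B \<sigma> \<tau>)) \<longlongrightarrow> c * \<omega> G A + \<omega> G B) F"
      unfolding vstate_linear using a by (intro tendsto_intros conv) auto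
    ultimately show "\<omega> G (\<lambda>\<sigma> \<tau>. c * A \<sigma> \<tau> + B \<sigma> \<tau>) = c * \<omega> G A + \<omega> G B"
      by (rule tendsto_unique[OF F(1)])
  next
    fix G and A :: "'d op" assume a: "finite G \<and> A \<in> alg n G"
    have "eventually (\<lambda>k. vstate n (Ls k) (\<Phi> k) G (opmult n G (adj A) A) \<in> \<real>\<^sub>\<ge>\<^sub>0) F"
      using sub[of G] a by (auto elim!: eventually_mono intro: state_on_pos[OF state_on_vstate[OF _ nrm]])
    then have "\<omega> G (opmult n G (adj A) A) \<in> \<real>\<^sub>\<ge>\<^sub>0"
      by (rule Lim_in_closed_set[OF closed_nonneg_Reals_complex _ F(1)]) (use a in \<open>intro conv alg_intros; simp\<close>)
    then show "\<exists>r::real. r \<ge> 0 \<and> \<omega> G (opmult n G (adj A) A) = complex_of_real r"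
      by (elim nonneg_Reals_cases) blast
  next
    fix G :: "'d site set" assume a: "finite G"
    have "eventually (\<lambda>k. vstate n (Ls k) (\<Phi> k) G (ident n G) = 1) F"
      using sub[OF a] by (rule eventually_mono) (rule state_on_ident[OF state_on_vstate[OF _ nrm]])
    then have "((\<lambda>k. vstate n (Ls k) (\<Phi> k) G (ident n G)) \<longlongrightarrow> 1) F" by (rule tendsto_eventually)
    then show "\<omega> G (ident n G) = 1" by (rule tendsto_unique[OF F(1) conv[OF a alg_ident]])
  next
    fix G G' and A :: "'d op" assume a: "finite G' \<and> G \<subseteq> G' \<and> A \<in> alg n G"
    then have fin: "finite G" "finite G'" using finite_subset by auto
    have "eventually (\<lambda>k. vstate n (Ls k) (\<Phi> k) G' (emb n G G' A) = vstate n (Ls k) (\<Phi> k) G A) F"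
      using sub[OF fin(2)] by (rule eventually_mono) (use a in \<open>simp add: vstate_emb\<close>)
    with conv[OF fin(2) alg_emb] have "((\<lambda>k. vstate n (Ls k) (\<Phi> k) G A) \<longlongrightarrow> \<omega> G' (emb n G G' A)) F"
      by (rule Lim_transform_eventually)
    then show "\<omega> G' (emb n G G' A) = \<omega> G A"
      by (rule tendsto_unique[OF F(1)]) (use a fin in \<open>intro conv; simp\<close>)
  qed
  \<comment> \<open>The finite-volume condition for the Hamiltonian with field splits into the local
    energy and \<open>Bs k\<close> times the expectation of a fixed local operator. The second part
    tends to zero because these expectations converge along \<open>F\<close>.\<close>
  have gs: "inf_gs n \<omega>"
    unfolding inf_gs_iff[OF loc]
  proof (intro allI impI)
    fix L and a :: "'d op" assume a: "a \<in> alg n (box L)"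
    let ?Y = "opmult n (box L) (adj a) (comm n (box L) (stag n L) a)"
    have Y: "?Y \<in> alg n (box L)" by (intro alg_intros a)
    have "eventually (\<lambda>k. vstate n (Ls k) (\<Phi> k) (box (L + 1)) (local_energy n L a) - complex_of_real (Bs k) * vstate n (Ls k) (\<Phi> k) (box L) ?Y \<in> \<real>\<^sub>\<ge>\<^sub>0) F"
      using large[of L]
    proof eventually_elim
      case (elim k)
      let ?G = "box (Ls k) :: 'd site set"
      let ?a = "emb n (box L) ?G a"
      have b: "box L \<subseteq> ?G" using elim by (intro box_mono) simp
      have eY: "emb n (box L) ?G ?Y = opmult n ?G (adj ?a) (comm n ?G (stag n (Ls k)) ?a)"
        using elim by (simp add: emb_opmult[OF b finite_box] comm_stag_emb adj_emb)
      have eH: "opmult n ?G (adj ?a) (comm n ?G (hamB n (Ls k) (Bs k)) ?a) =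
        (\<lambda>\<sigma> \<tau>. complex_of_real (- Bs k) * emb n (box L) ?G ?Y \<sigma> \<tau> + emb n (box (L + 1)) ?G (local_energy n L a) \<sigma> \<tau>)"
        unfolding eY emb_local_energy[OF elim, symmetric] hamB_def comm_diff_left comm_scale_left opmult_diff_right opmult_scale_right
        by simp
      have "expect n ?G (\<Phi> k) (opmult n ?G (adj ?a) (comm n ?G (hamB n (Ls k) (Bs k)) ?a)) =
        vstate n (Ls k) (\<Phi> k) (box (L + 1)) (local_energy n L a) - complex_of_real (Bs k) * vstate n (Ls k) (\<Phi> k) (box L) ?Y"
        unfolding vstate_def eH expect_linear by simp
      with ground_vec_commutator_nonneg[OF g[of k] adj_hamB finite_box, of ?a] show ?case by simp
    qed
    moreover have "((\<lambda>k. vstate n (Ls k) (\<Phi> k) (box (L + 1)) (local_energy n L a) - complex_of_real (Bs k) * vstate n (Ls k) (\<Phi> k) (box L) ?Y)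
       \<longlongrightarrow> \<omega> (box (L + 1)) (local_energy n L a) - complex_of_real 0 * \<omega> (box L) ?Y) F"
      using tendsto_mono[OF F(2) Bs] by (intro tendsto_intros conv finite_box Y alg_local_energy)
    ultimately have "\<omega> (box (L + 1)) (local_energy n L a) - complex_of_real 0 * \<omega> (box L) ?Y \<in> \<real>\<^sub>\<ge>\<^sub>0"
      by (rule Lim_in_closed_set[OF closed_nonneg_Reals_complex _ F(1)])
    then show "\<omega> (box (L + 1)) (local_energy n L a) \<in> \<real>\<^sub>\<ge>\<^sub>0" by simp
  qed
  \<comment> \<open>The sequence on the left is the same for each \<open>L\<close>, so uniqueness of
    limits makes the magnetization per site of \<omega> the same in every box.\<close>
  have mag: "((\<lambda>k. mag_density n (Ls k) (\<Phi> k)) \<longlongrightarrow> Re (\<omega> (box L) (stag n L)) / real (card (box L :: 'd site set))) F"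
    if "1 \<le> L" for L
  proof -
    have "((\<lambda>k. Re (vstate n (Ls k) (\<Phi> k) (box L) (stag n L)) / real (card (box L :: 'd site set)))
       \<longlongrightarrow> Re (\<omega> (box L) (stag n L)) / real (card (box L :: 'd site set))) F"
      using that by (intro tendsto_intros conv alg_stag) (auto simp: card_box)
    moreover have "eventually (\<lambda>k. Re (vstate n (Ls k) (\<Phi> k) (box L) (stag n L)) / real (card (box L :: 'd site set)) = mag_density n (Ls k) (\<Phi> k)) F"
      using large[of L] by eventually_elim (use mag_density_vstate[OF that _ t] in simp)
    ultimately show ?thesis by (rule Lim_transform_eventually)
  qed
  define s where "s = Re (\<omega> (box 1) (stag n 1)) / real (card (box 1 :: 'd site set))"
  have "\<forall>L\<ge>1. Re (\<omega> (box L) (stag n L)) / real (card (box L :: 'd site set)) = s"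
    unfolding s_def using tendsto_unique[OF F(1) mag mag[OF order_refl]] by blast
  moreover have "c \<le> s"
    by (rule tendsto_le[OF F(1) mag[OF order_refl, folded s_def] tendsto_mono[OF F(2) cs(1)]]) (simp add: cs(2))
  ultimately show thesis using that loc gs by blast
qed

section \<open>The limit at zero field and its maximality\<close>

theorem theorem2p1:
  fixes n :: nat and \<Phi> :: "nat \<Rightarrow> real \<Rightarrow> ('d::finite) cfg \<Rightarrow> complex"
  assumes "n \<ge> 1"
    and "\<forall>L\<ge>1. \<forall>B>0. ground_vec n (box L) (hamB n L B) (\<Phi> L B) \<and> trans_inv2 n L (\<Phi> L B)"
  shows "\<exists>ms::real.
     (\<forall>\<epsilon>>0. \<exists>\<delta>>0. \<forall>B r. 0 < B \<and> B < \<delta> \<and> strict_mono r \<and> (\<forall>k. 1 \<le> r k) \<and>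
           wstar_conv n r (\<lambda>k. \<Phi> (r k) B) \<longrightarrow>
           (\<exists>m. (\<lambda>k. mag_density n (r k) (\<Phi> (r k) B)) \<longlonglongrightarrow> m \<and> \<bar>m - ms\<bar> < \<epsilon>)) \<and>
     (\<exists>\<omega> :: 'd site set \<Rightarrow> 'd op \<Rightarrow> complex. loc_state n \<omega> \<and> inf_gs n \<omega> \<and> spont n \<omega> = ereal ms) \<and>
     (\<forall>\<omega> :: 'd site set \<Rightarrow> 'd op \<Rightarrow> complex. loc_state n \<omega> \<and> inf_gs n \<omega> \<longrightarrow> spont n \<omega> \<le> ereal ms)"
proof -
  define m where "m = (\<lambda>L B. mag_density n L (\<Phi> L B))"
  define x where "x = (\<lambda>(\<omega> :: 'd site set \<Rightarrow> 'd op \<Rightarrow> complex) L. Re (\<omega> (box L) (stag n L)) / real (card (box L :: 'd site set)))"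
  have g: "ground_vec n (box L) (hamB n L B) (\<Phi> L B)" and t: "trans_inv2 n L (\<Phi> L B)" if "L \<ge> 1" "B > 0" for L B
    using assms(2) that by auto
  obtain K where K_upper: "\<forall>L\<ge>1. \<forall>B>0. \<forall>(\<omega> :: 'd site set \<Rightarrow> 'd op \<Rightarrow> complex) (\<phi> :: 'd cfg \<Rightarrow> complex).
      loc_state n \<omega> \<longrightarrow> inf_gs n \<omega> \<longrightarrow> ground_vec n (box L) (hamB n L B) \<phi> \<longrightarrow>
      Re (\<omega> (box L) (stag n L)) / real (card (box L :: 'd site set)) \<le> mag_density n L \<phi> + K / (B * real L)"
    using staggered_magnetization_upper[where ?'d = 'd, of n] by (elim exE) (rule that)
  have upper: "x \<omega> L \<le> m L B + K / (B * real L)" if "L \<ge> 1" "B > 0" "loc_state n \<omega>" "inf_gs n \<omega>" for L B \<omega>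
    unfolding x_def m_def by (rule K_upper[rule_format, OF that g[OF that(1,2)]])
  have m_bound: "\<bar>m L B\<bar> \<le> real n" if "L \<ge> 1" "B > 0" for L B
    unfolding m_def by (rule mag_density_bounded[OF that(1)]) (use g[OF that] in \<open>simp add: ground_vec_def\<close>)
  \<comment> \<open>Magnetizations of ground states whose density is the same in every box, so that
    the limsup in \<open>spont\<close> is that of a constant sequence up to one term.\<close>
  define S where "S = {s. \<exists>\<omega>. loc_state n \<omega> \<and> inf_gs n \<omega> \<and> (\<forall>L\<ge>1. x \<omega> L = s)}"
  have cluster: "\<exists>s\<in>S. c \<le> s"
    if hyps: "filterlim Ls at_top sequentially" "Bs \<longlonglongrightarrow> 0" "\<And>k. Ls k \<ge> 1" "\<And>k. Bs k > 0" "cs \<longlonglongrightarrow> c" "\<And>k. cs k \<le> m (Ls k) (Bs k)"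
    for Ls Bs cs c
  proof -
    obtain \<omega> s where "loc_state n \<omega>" "inf_gs n \<omega>" "c \<le> s" "\<forall>L\<ge>1. x \<omega> L = s"
      unfolding x_def
      by (rule cluster_ground_state[of Ls Bs n "\<lambda>k. \<Phi> (Ls k) (Bs k)" cs c])
        (use hyps g t in \<open>auto simp: m_def intro: that\<close>)
    then show ?thesis unfolding S_def by blast
  qed
  have S_le: "s \<le> m L B + K / (B * real L)" if "s \<in> S" "L \<ge> 1" "B > 0" for s L B
    using that upper[OF that(2,3)] unfolding S_def by auto
  have inv_lim: "(\<lambda>k. 1 / real (k + 1)) \<longlonglongrightarrow> 0"
    using LIMSEQ_inverse_real_of_nat by (simp add: inverse_eq_divide)
  \<comment> \<open>The uniform bound on \<open>m\<close> supplies a constant lower sequence, so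
    some cluster ground state exists.\<close>
  have "S \<noteq> {}"
  proof -
    have "filterlim (\<lambda>k. k + 1) at_top sequentially" by (rule filterlim_add_const_nat_at_top)
    then have "\<exists>s\<in>S. - real n \<le> s"
    proof (rule cluster[OF _ inv_lim])
      fix k show "- real n \<le> m (k + 1) (1 / real (k + 1))"
        using m_bound[of "k + 1" "1 / real (k + 1)"] by (simp add: abs_le_iff)
    qed (simp_all add: tendsto_const)
    then show ?thesis by blast
  qed
  have S_bdd: "bdd_above S"
    by (rule bdd_aboveI) (rule S_le[of _ 1 1], auto)
  define ms where "ms = Sup S"
  have ms_le: "ms \<le> m L B + K / (B * real L)" if "L \<ge> 1" "B > 0" for L B
    unfolding ms_def using \<open>S \<noteq> {}\<close> S_le[OF _ that] by (rule cSup_least)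
  have le_ms: "s \<le> ms" if "s \<in> S" for s
    unfolding ms_def by (rule cSup_upper[OF that S_bdd])
  \<comment> \<open>Otherwise fields below \<open>1 / (k + 1)\<close> and boxes of size at least
    \<open>k + 1\<close> could be chosen with \<open>m\<close> at least
    \<open>ms + \<epsilon>\<close>, and a cluster point would have magnetization above the
    supremum.\<close>
  have above: "\<exists>\<delta>>0. \<forall>B. 0 < B \<and> B < \<delta> \<longrightarrow> (\<exists>N. \<forall>L\<ge>N. m L B < ms + \<epsilon>)" if "\<epsilon> > 0" for \<epsilon>
  proof (rule ccontr)
    assume "\<not> ?thesis"
    then have *: "\<And>\<delta>. \<delta> > 0 \<Longrightarrow> \<exists>B. 0 < B \<and> B < \<delta> \<and> (\<forall>N. \<exists>L\<ge>N. ms + \<epsilon> \<le> m L B)"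
      by (meson linorder_not_less)
    have "\<exists>B L. 0 < B \<and> B < 1 / real (k + 1) \<and> L \<ge> k + 1 \<and> ms + \<epsilon> \<le> m L B" for k
    proof -
      have "1 / real (k + 1) > 0" by simp
      from *[OF this] show ?thesis by blast
    qed
    then obtain Bs Ls where BL: "\<And>k. 0 < Bs k" "\<And>k. Bs k < 1 / real (k + 1)" "\<And>k. Ls k \<ge> k + 1" "\<And>k. ms + \<epsilon> \<le> m (Ls k) (Bs k)"
      by metis
    have "filterlim Ls at_top sequentially"
      by (rule filterlim_at_top_mono[OF filterlim_add_const_nat_at_top[of 1]]) (use BL(3) in simp)
    moreover have "Bs \<longlonglongrightarrow> 0"
      by (rule tendsto_sandwich[OF _ _ tendsto_const inv_lim]) (use BL(1,2) in \<open>auto intro!: always_eventually less_imp_le\<close>)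
    ultimately have "\<exists>s\<in>S. ms + \<epsilon> \<le> s"
      by (rule cluster[where cs = "\<lambda>_. ms + \<epsilon>"]) (use BL(1,4) order_trans[OF _ BL(3)] in auto)
    then show False using le_ms that by force
  qed
  have K_lim: "(\<lambda>k. K / (B * real (r k))) \<longlonglongrightarrow> 0" if "filterlim r at_top sequentially" "B > 0" for r B
  proof -
    have "filterlim (\<lambda>k. B * real (r k)) at_top sequentially"
      using that by (intro filterlim_tendsto_pos_mult_at_top[OF tendsto_const]
          filterlim_compose[OF filterlim_real_sequentially])
    then show ?thesis by (intro tendsto_divide_0[OF tendsto_const] filterlim_at_top_imp_at_infinity)
  qed
  have part1: "\<exists>\<delta>>0. \<forall>B r. 0 < B \<and> B < \<delta> \<and> strict_mono r \<and> (\<forall>k. 1 \<le> r k) \<and>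
           wstar_conv n r (\<lambda>k. \<Phi> (r k) B) \<longrightarrow>
           (\<exists>m. (\<lambda>k. mag_density n (r k) (\<Phi> (r k) B)) \<longlonglongrightarrow> m \<and> \<bar>m - ms\<bar> < \<epsilon>)" if "\<epsilon> > 0" for \<epsilon>
  proof -
    from above[of "\<epsilon> / 2"] that obtain \<delta> where \<delta>: "\<delta> > 0" "\<And>B. 0 < B \<Longrightarrow> B < \<delta> \<Longrightarrow> \<exists>N. \<forall>L\<ge>N. m L B < ms + \<epsilon> / 2"
      by auto
    show ?thesis
    proof (rule exI[of _ \<delta>], intro conjI \<delta>(1) allI impI)
      fix B r assume a: "0 < B \<and> B < \<delta> \<and> strict_mono r \<and> (\<forall>k. 1 \<le> r k) \<and> wstar_conv n r (\<lambda>k. \<Phi> (r k) B)"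
      then have B: "0 < B" "B < \<delta>" and r: "\<And>k. 1 \<le> r k" and r_top: "filterlim r at_top sequentially"
        by (auto intro: filterlim_subseq)
      \<comment> \<open>Weak-* convergence is applied to the staggered magnetization of the smallest
        box; by translation invariance its value per site is the density of the whole box.\<close>
      have "convergent (\<lambda>k. vstate n (r k) (\<Phi> (r k) B) (box 1) (stag n 1))"
        using a alg_stag finite_box unfolding wstar_conv_def by blast
      then obtain v where "(\<lambda>k. vstate n (r k) (\<Phi> (r k) B) (box 1) (stag n 1)) \<longlonglongrightarrow> v"
        by (auto simp: convergent_def)
      then have "(\<lambda>k. Re (vstate n (r k) (\<Phi> (r k) B) (box 1) (stag n 1)) / real (card (box 1 :: 'd site set)))
        \<longlonglongrightarrow> Re v / real (card (box 1 :: 'd site set))" by (intro tendsto_intros) (auto simp: card_box)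
      then have lim: "(\<lambda>k. m (r k) B) \<longlonglongrightarrow> Re v / real (card (box 1 :: 'd site set))" (is "_ \<longlonglongrightarrow> ?l")
        unfolding m_def using mag_density_vstate[OF order_refl r t[OF r B(1)]] by simp
      \<comment> \<open>At fixed \<open>B\<close> the surface correction vanishes along
        \<open>r\<close>, so the lower bound \<open>ms\<close> on the limit carries no
        error.\<close>
      have "ms \<le> ?l + 0"
        by (rule LIMSEQ_le_const[OF tendsto_add[OF lim K_lim[OF r_top B(1)]]]) (use ms_le[OF r B(1)] in auto)
      moreover have "?l \<le> ms + \<epsilon> / 2"
      proof -
        from \<delta>(2)[OF B] obtain N where "\<And>L. L \<ge> N \<Longrightarrow> m L B < ms + \<epsilon> / 2" by blast
        moreover have "eventually (\<lambda>k. N \<le> r k) sequentially" using r_top by (auto simp: filterlim_at_top)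
        ultimately have "eventually (\<lambda>k. m (r k) B \<le> ms + \<epsilon> / 2) sequentially"
          by (auto elim!: eventually_mono intro: less_imp_le)
        then show ?thesis by (rule tendsto_upperbound[OF lim]) simp
      qed
      ultimately have "\<bar>?l - ms\<bar> < \<epsilon>" using that by linarith
      with lim show "\<exists>m. (\<lambda>k. mag_density n (r k) (\<Phi> (r k) B)) \<longlonglongrightarrow> m \<and> \<bar>m - ms\<bar> < \<epsilon>"
        unfolding m_def by blast
    qed
  qed
  have part2: "\<exists>\<omega> :: 'd site set \<Rightarrow> 'd op \<Rightarrow> complex. loc_state n \<omega> \<and> inf_gs n \<omega> \<and> spont n \<omega> = ereal ms"
  proof -
    \<comment> \<open>With \<open>B = 1 / (k + 1)\<close> the squares give
      \<open>B * L = k + 1\<close>, so that the surface correction tends to zero together with the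
      field.\<close>
    define Ls where "Ls = (\<lambda>k::nat. (k + 1) * (k + 1))"
    have top: "filterlim Ls at_top sequentially"
      by (rule filterlim_at_top_mono[OF filterlim_add_const_nat_at_top[of 1]]) (simp add: Ls_def)
    have Ls1: "1 \<le> Ls k" for k by (simp add: Ls_def)
    have lim: "(\<lambda>k. ms - K * (1 / real (k + 1))) \<longlonglongrightarrow> ms - K * 0"
      by (intro tendsto_intros inv_lim)
    have "ms - K * (1 / real (k + 1)) \<le> m (Ls k) (1 / real (k + 1))" for k
    proof -
      have "K / (1 / real (k + 1) * real (Ls k)) = K * (1 / real (k + 1))"
        unfolding Ls_def of_nat_mult by (simp del: of_nat_Suc of_nat_add)
      then show ?thesis using ms_le[OF Ls1[of k], of "1 / real (k + 1)"] by simp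
    qed
    with cluster[OF top inv_lim Ls1 _ lim] have "\<exists>s\<in>S. ms - K * 0 \<le> s" by simp
    \<comment> \<open>The supremum is attained: the cluster point has magnetization at least
      \<open>ms\<close>, and elements of \<open>S\<close> are at most \<open>ms\<close>.\<close>
    then have "ms \<in> S" using le_ms by force
    then obtain \<omega> where \<omega>: "loc_state n \<omega>" "inf_gs n \<omega>" "\<forall>L\<ge>1. x \<omega> L = ms" unfolding S_def by blast
    have "eventually (\<lambda>L. ereal (x \<omega> L) = ereal ms) sequentially"
      using eventually_ge_at_top[of 1] by eventually_elim (use \<omega>(3) in simp)
    then have "spont n \<omega> = ereal ms"
      unfolding spont_def x_def by (intro lim_imp_Limsup tendsto_eventually) auto
    then show ?thesis using \<omega> by blast
  qed
  \<comment> \<open>The density of an arbitrary ground state may vary with the box. In each box it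
    is compared with \<open>m\<close> at one fixed small field, and the surface correction
    disappears as the box grows.\<close>
  have part3: "spont n \<omega> \<le> ereal ms" if \<omega>: "loc_state n \<omega>" "inf_gs n \<omega>" for \<omega> :: "'d site set \<Rightarrow> 'd op \<Rightarrow> complex"
  proof (rule ereal_le_epsilon2)
    fix e :: real assume e: "e > 0"
    with above[of "e / 2"] obtain \<delta> where \<delta>: "\<delta> > 0" "\<And>B. 0 < B \<and> B < \<delta> \<Longrightarrow> \<exists>N. \<forall>L\<ge>N. m L B < ms + e / 2"
      by auto
    define B where "B = \<delta> / 2"
    have B: "B > 0" "B < \<delta>" using \<delta>(1) by (auto simp: B_def)
    then obtain N where N: "\<And>L. L \<ge> N \<Longrightarrow> m L B < ms + e / 2" using \<delta>(2) by blast
    have "eventually (\<lambda>L. K / (B * real L) < e / 2) sequentially"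
      using K_lim[OF filterlim_ident B(1)] e by (intro order_tendstoD(2)[of _ 0]) auto
    moreover have "eventually (\<lambda>L. N \<le> L \<and> 1 \<le> L) sequentially"
      by (intro eventually_conj eventually_ge_at_top)
    ultimately have "eventually (\<lambda>L. ereal (x \<omega> L) \<le> ereal (ms + e)) sequentially"
    proof eventually_elim
      case (elim L)
      then have "x \<omega> L \<le> m L B + K / (B * real L)" "m L B < ms + e / 2"
        using upper[OF _ B(1) \<omega>, of L] N[of L] by blast+
      with elim have "x \<omega> L \<le> ms + e" by linarith
      then show ?case by simp
    qed
    then show "spont n \<omega> \<le> ereal ms + ereal e"
      unfolding spont_def x_def by (intro Limsup_bounded) simp
  qed
  show ?thesis using part1 part2 part3 by blast
qed

end
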